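(* There exist constants $c>0$ and $x_0$ such that for all real $x\ge x_0$, $$N^+_{\omega}(x):=\#\{n\le x:\ n=k+\omega(k)\text{ for some positive integer }k\}\ \ge\ c\,x.$$
   Context: $\omega(n)$ denotes the number of distinct prime divisors of a positive integer $n$; $n$ and $k$ range over positive integers. *)

theory Defs
  imports Complex_Main "HOL-Computational_Algebra.Primes"
begin

definition omega :: "nat \<Rightarrow> nat"
  where "omega n = card (prime_factors n)"

definition N_plus_omega :: "real \<Rightarrow> nat"
  where "N_plus_omega x = card {n::nat. n > 0 \<and> real n \<le> x \<and> (\<exists>k>0. n = k + omega k)}"

end

theory Submission
  imports Defs "HOL-Number_Theory.Cong" "HOL-Computational_Algebra.Squarefree" "HOL-Library.FuncSet"
begin

text \<open>Consider the integers \<open>k = m p \<le> N\<close> with \<open>m \<le> N\<^bsup>1/4\<^esup>\<close> squarefree and \<open>p > N\<^bsup>1/4\<^esup>\<close> prime;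
  they have positive density by Chebyshev's lower bound for the number of primes. Since
  \<open>\<omega>(k) = \<omega>(m) + 1\<close>, a collision \<open>k + \<omega>(k) = k' + \<omega>(k')\<close> of \<open>k = m p\<close> and \<open>k' = m' p'\<close> means
  \<open>m p - m' p' = h\<close> with \<open>h = \<omega>(m') - \<omega>(m)\<close>, so every pair \<open>(m, m')\<close> comes with a single shift \<open>h\<close>.
  Selberg's upper bound sieve shows that such a pair has, up to local factors, at most
  \<open>O(N / (lcm(m, m') log\<^sup>2 N))\<close> collisions if \<open>h \<noteq> 0\<close>. The local factors at primes dividing \<open>h\<close>
  and the gcd of \<open>m\<close> and \<open>m'\<close>, which divides \<open>h\<close>, are bounded on average because, weighted by
  \<open>1/m\<close>, the value \<open>\<omega>(m)\<close> is dominated by a Poisson variable of parameter \<open>log log N + O(1)\<close>.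
  Hence there are \<open>O(N)\<close> collisions, and the Cauchy-Schwarz inequality gives \<open>\<ge> c N\<close> values.\<close>

section \<open>Sums over primes\<close>

text \<open>The orders of magnitude balance exactly. For each \<open>m\<close> there are about
  \<open>N / (m log N)\<close> primes and the sum of \<open>1/m\<close> has order
  \<open>log N\<close>, so the numbers \<open>k\<close> have positive density; the sieve saves
  \<open>log^2 N\<close> for each pair, and the sum of \<open>1/(m m')\<close> over all pairs gives
  it back. Hence no unbounded loss is affordable: the sums over primes are bounded inside
  \<open>exp\<close>, up to a constant factor, to make the Poisson mass \<open>exp \<mu>\<close> at
  most \<open>O(log N)\<close>. The obstacle is that \<open>h\<close> varies with the pair. The
  sieve bound carries a product over the primes dividing \<open>h\<close>, and
  \<open>1/lcm(m, m')\<close> exceeds \<open>1/(m m')\<close> by the gcd. Neither is bounded; on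
  average both are, because the gap of two Poisson variables has size about
  \<open>sqrt \<mu>\<close> and falls into a class modulo \<open>d\<close> with probability at most
  \<open>1/d + 1/sqrt \<mu>\<close>. If \<open>h = 0\<close>, then \<open>m p = m' p'\<close>, and
  \<open>p = p'\<close> is the only prime factor beyond the bound for \<open>m\<close>, so the
  collision is trivial. The parameter \<open>q\<close> stands for \<open>N^(1/24)\<close>.\<close>

definition primes_le :: "nat \<Rightarrow> nat set"
  where "primes_le n = {p. prime p \<and> p \<le> n}"

lemma finite_primes_le [simp]: "finite (primes_le n)"
  by (rule finite_subset[of _ "{..n}"]) (auto simp: primes_le_def)

lemma primes_leD: "p \<in> primes_le n \<Longrightarrow> prime p" "p \<in> primes_le n \<Longrightarrow> p \<le> n"
  by (auto simp: primes_le_def)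

lemma prime_factors_Prod_primes:
  fixes A :: "nat set"
  assumes "finite A" "\<forall>p\<in>A. prime p"
  shows "prime_factors (\<Prod>A) = A"
proof -
  have "prime_factors (\<Prod>A) = \<Union> ((prime_factors \<circ> (\<lambda>p. p)) ` A)"
    using assms by (intro prime_factors_prod) auto
  also have "\<dots> = A" using assms by (auto simp: prime_prime_factors)
  finally show ?thesis .
qed

lemma Prod_primes_pos:
  fixes A :: "nat set"
  assumes "\<forall>p\<in>A. prime p"
  shows "0 < \<Prod>A"
  using assms by (intro prod_pos) (auto simp: prime_gt_0_nat)

lemma Prod_primes_dvd_iff:
  fixes A :: "nat set"
  assumes "finite A" "\<forall>p\<in>A. prime p"
  shows "\<Prod>A dvd n \<longleftrightarrow> (\<forall>p\<in>A. p dvd n)"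
proof
  assume "\<forall>p\<in>A. p dvd n"
  with assms show "\<Prod>A dvd n"
  proof (induction A)
    case (insert p A)
    have "coprime p (\<Prod>A)"
      using insert by (intro prod_coprime_right) (auto intro: primes_coprime)
    thus ?case using insert by (simp add: divides_mult)
  qed auto
next
  assume "\<Prod>A dvd n"
  thus "\<forall>p\<in>A. p dvd n" using assms by (meson dvd_prodI dvd_trans)
qed

lemma inj_on_Prod_primes:
  assumes "\<And>A. A \<in> \<A> \<Longrightarrow> finite A \<and> (\<forall>p\<in>A. prime p)"
  shows "inj_on (\<lambda>A :: nat set. \<Prod>A) \<A>"
  by (rule inj_on_inverseI[where g = prime_factors])
     (use assms prime_factors_Prod_primes in auto)

lemma prod_one_plus_Pow:
  fixes f :: "'a \<Rightarrow> 'b :: comm_semiring_1"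
  assumes "finite A"
  shows "(\<Prod>x\<in>A. 1 + f x) = (\<Sum>X\<in>Pow A. \<Prod>x\<in>X. f x)"
  using prod_add[OF assms, of f "\<lambda>_. 1"] by (simp add: add.commute)

section \<open>Upper bounds of Mertens type, from the prime factors of a factorial\<close>

lemma prime_power_dvd_fact:
  "(p::nat) > 0 \<Longrightarrow> p ^ k dvd fact (p * k)"
proof (induction k)
  case (Suc k)
  define m where "m = p * Suc k - 1"
  have m: "p * Suc k = Suc m" "p * k \<le> m" using Suc.prems by (auto simp: m_def)
  have "p ^ k dvd fact m"
    using Suc m by (meson dvd_trans fact_dvd)
  hence "p ^ k * p dvd fact m * (p * Suc k)" by (intro mult_dvd_mono) auto
  thus ?case unfolding m(1) fact_Suc by (simp add: mult.commute)
qed auto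

text \<open>The product of \<open>p ^ (n div p)\<close> divides \<open>fact n\<close>, which is at
  most \<open>n ^ n\<close>. Taking logarithms and using \<open>n div p \<ge> n / (2 p)\<close>
  gives the bound. The factor 2 is harmless, because the sum will be multiplied by
  \<open>1 / ln n\<close>.\<close>

lemma sum_ln_over_primes_le:
  assumes "n \<ge> 1"
  shows "(\<Sum>p\<in>primes_le n. ln (real p) / real p) \<le> 2 * ln (real n)"
proof -
  have "(\<Prod>p\<in>primes_le n. p ^ (n div p)) dvd (fact n :: nat)"
  proof -
    have "finite B \<Longrightarrow> B \<subseteq> primes_le n \<Longrightarrow> (\<Prod>p\<in>B. p ^ (n div p)) dvd (fact n :: nat)" for B
    proof (induction B rule: finite_induct)
      case (insert p B)
      have p: "prime p" using insert.prems by (auto simp: primes_le_def)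
      have "p ^ (n div p) dvd fact (p * (n div p))"
        using p by (intro prime_power_dvd_fact) (auto simp: prime_gt_0_nat)
      also have "(fact (p * (n div p)) :: nat) dvd fact n" by (intro fact_dvd) auto
      finally have "p ^ (n div p) dvd (fact n :: nat)" .
      moreover have "coprime (p ^ (n div p)) (\<Prod>p\<in>B. p ^ (n div p))"
      proof (intro prod_coprime_right)
        fix r assume "r \<in> B"
        hence "prime r" "p \<noteq> r" using insert by (auto simp: primes_le_def)
        thus "coprime (p ^ (n div p)) (r ^ (n div r))" using p by (simp add: primes_coprime)
      qed
      ultimately show ?case using insert by (simp add: divides_mult)
    qed auto
    thus ?thesis by simp
  qed
  hence "(\<Prod>p\<in>primes_le n. p ^ (n div p)) \<le> fact n" by (rule dvd_imp_le) simp
  also have "(fact n :: nat) \<le> n ^ n" using fact_le_power[of n, where 'a = nat] by simp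
  finally have "real (\<Prod>p\<in>primes_le n. p ^ (n div p)) \<le> real (n ^ n)" by (simp only: of_nat_le_iff)
  moreover have "(\<Prod>p\<in>primes_le n. p ^ (n div p)) > 0"
    by (intro prod_pos) (auto simp: primes_le_def prime_gt_0_nat)
  ultimately have "ln (real (\<Prod>p\<in>primes_le n. p ^ (n div p))) \<le> ln (real (n ^ n))"
    by (intro ln_mono) (simp_all only: of_nat_0_less_iff)
  also have "ln (real (n ^ n)) = n * ln (real n)" using assms by (simp add: ln_realpow)
  also have "ln (real (\<Prod>p\<in>primes_le n. p ^ (n div p))) = (\<Sum>p\<in>primes_le n. real (n div p) * ln (real p))"
    unfolding of_nat_prod
    by (subst ln_prod) (auto intro!: sum.cong simp: primes_le_def prime_gt_0_nat ln_realpow)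
  finally have *: "(\<Sum>p\<in>primes_le n. real (n div p) * ln (real p)) \<le> n * ln (real n)" .
  have "(\<Sum>p\<in>primes_le n. real n / (2 * real p) * ln (real p)) \<le> (\<Sum>p\<in>primes_le n. real (n div p) * ln (real p))"
  proof (intro sum_mono mult_right_mono)
    fix p assume p: "p \<in> primes_le n"
    hence p0: "p > 0" "p \<le> n" by (auto simp: primes_le_def prime_gt_0_nat)
    have "n < p * (n div p) + p" using p0(1)
      by (metis add_strict_left_mono mod_less_divisor mult_div_mod_eq)
    also have "\<dots> \<le> p * (n div p) + p * (n div p)" using p0
      by (intro add_left_mono) (simp add: div_greater_zero_iff Suc_leI)
    finally have "n \<le> 2 * p * (n div p)" by simp
    hence "real n \<le> real (2 * p * (n div p))" by (simp only: of_nat_le_iff)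
    thus "real n / (2 * real p) \<le> real (n div p)" using p0 by (simp add: field_simps)
    show "0 \<le> ln (real p)" using p0 by simp
  qed
  with * have "(\<Sum>p\<in>primes_le n. real n / (2 * real p) * ln (real p)) \<le> n * ln (real n)" by linarith
  also have "(\<Sum>p\<in>primes_le n. real n / (2 * real p) * ln (real p)) = real n * ((\<Sum>p\<in>primes_le n. ln (real p) / real p) / 2)"
    by (simp add: sum_distrib_left sum_divide_distrib mult_ac)
  finally have "(\<Sum>p\<in>primes_le n. ln (real p) / real p) / 2 \<le> ln (real n)"
    using assms by (subst (asm) mult_le_cancel_left_pos) auto
  thus ?thesis by simp
qed

lemma sum_inverse_squares_le:
  "(\<Sum>k=1..n. 1 / real k ^ 2) \<le> 2"
proof -
  have "n \<ge> 1 \<Longrightarrow> (\<Sum>k=1..n. 1 / real k ^ 2) \<le> 2 - 1 / real n"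
  proof (induction n rule: dec_induct)
    case (step n)
    have "1 / real (Suc n) ^ 2 \<le> 1 / real n - 1 / real (Suc n)"
      using step.hyps by (simp add: divide_simps power2_eq_square)
    thus ?case using step by simp
  qed auto
  thus ?thesis by (cases "n = 0") (auto intro: order_trans)
qed

lemma sum_primes_inverse_squares_le:
  assumes "finite P" "\<forall>p\<in>P. prime p"
  shows "(\<Sum>p\<in>P. 1 / real p ^ 2) \<le> 2"
proof -
  have "(\<Sum>p\<in>P. 1 / real p ^ 2) \<le> (\<Sum>k=1..Max (insert 0 P). 1 / real k ^ 2)"
    using assms by (intro sum_mono2) (auto simp: Suc_le_eq prime_gt_0_nat)
  thus ?thesis using sum_inverse_squares_le[of "Max (insert 0 P)"] by linarith
qed

text \<open>Comparison with the integral of \<open>t powr -(1 + e)\<close>: the induction carries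
  the value \<open>(1 - n powr -e) / e\<close> of the integral from 1 to \<open>n\<close>, and the
  mean value theorem supplies one step.\<close>

lemma sum_powr_minus_le:
  fixes e :: real
  assumes "e > 0"
  shows "(\<Sum>k=1..n. real k powr (-(1+e))) \<le> 1 + 1 / e"
proof -
  have "n \<ge> 1 \<Longrightarrow> (\<Sum>k=1..n. real k powr (-(1+e))) \<le> 1 + (1 - real n powr (-e)) / e"
  proof (induction n rule: dec_induct)
    case (step n)
    have n: "real n > 0" using step.hyps by simp
    have "\<exists>z. real n < z \<and> z < real (Suc n) \<and>
      (real (Suc n) powr (-e)) - (real n powr (-e)) = (real (Suc n) - real n) * (-e * z powr (-e-1))"
      using n by (intro MVT2) (auto intro!: derivative_eq_intros simp: field_simps powr_diff)
    then obtain z where z: "real n < z" "z < real (Suc n)"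
      "real (Suc n) powr (-e) - real n powr (-e) = -e * z powr (-e-1)" by auto
    have "real (Suc n) powr (-(1+e)) \<le> z powr (-e-1)"
      using powr_mono2'[of "-(1+e)" z "real (Suc n)"] z n assms
      by (simp add: add.commute minus_diff_commute)
    hence "e * real (Suc n) powr (-(1+e)) \<le> e * z powr (-e-1)"
      using assms by (intro mult_left_mono) auto
    hence "e * real (Suc n) powr (-(1+e)) \<le> real n powr (-e) - real (Suc n) powr (-e)"
      using z(3) by linarith
    hence "real (Suc n) powr (-(1+e)) \<le> (real n powr (-e) - real (Suc n) powr (-e)) / e"
      using assms by (simp add: pos_le_divide_eq mult.commute)
    thus ?case using step by (simp add: diff_divide_distrib)
  qed auto
  moreover have "1 + (1 - real n powr (-e)) / e \<le> 1 + 1 / e"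
    using assms by (simp add: divide_right_mono)
  ultimately show ?thesis using assms by (cases "n = 0") auto
qed

text \<open>Rankin's trick: \<open>1/p\<close> is compared with \<open>p powr -(1 + 1 / ln n)\<close>.\<close>

lemma exp_sum_primes_inverse_le:
  assumes "n \<ge> 3"
  shows "exp (\<Sum>p\<in>primes_le n. 1 / real p) \<le> exp 5 * ln (real n)"
proof -
  have ln1: "ln (real n) \<ge> 1"
  proof -
    have "exp 1 \<le> (3::real)" by (rule exp_le)
    also have "\<dots> \<le> real n" using assms by simp
    finally show ?thesis using assms by (subst ln_ge_iff) auto
  qed
  \<comment> \<open>With this exponent \<open>p powr e \<le> exp 1\<close> for all
    \<open>p \<le> n\<close>, so the passage from \<open>1/p\<close> to \<open>f p\<close> costs a
    constant in the sum, while the series over all integers is still at most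
    \<open>1 + ln n\<close>.\<close>
  define e where "e = 1 / ln (real n)"
  have e: "e > 0" using ln1 by (auto simp: e_def)
  define f where "f = (\<lambda>p::nat. real p powr (-(1+e)))"
  have f: "0 < f p" "f p \<le> 1 / real p" "1 / real p - f p \<le> e * (ln (real p) / real p)"
    if "p \<in> primes_le n" for p
  proof -
    have p: "p > 1" using that prime_gt_1_nat by (auto simp: primes_le_def)
    have fp: "f p = 1 / real p * exp (- (e * ln (real p)))"
    proof -
      have "f p = real p powr (-1) * real p powr (-e)"
        unfolding f_def by (subst powr_add [symmetric]) simp
      thus ?thesis using p by (simp add: powr_minus powr_def exp_minus divide_inverse)
    qed
    show "0 < f p" using p by (simp add: f_def)
    have "exp (- (e * ln (real p))) \<le> 1" using p e by simp
    thus "f p \<le> 1 / real p" unfolding fp using p by (simp add: divide_right_mono)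
    have "exp (- (e * ln (real p))) \<ge> 1 + (- (e * ln (real p)))" by (rule exp_ge_add_one_self)
    hence "1 / real p * exp (- (e * ln (real p))) \<ge> 1 / real p * (1 + (- (e * ln (real p))))"
      by (intro mult_left_mono) auto
    thus "1 / real p - f p \<le> e * (ln (real p) / real p)" unfolding fp by (simp add: algebra_simps)
  qed
  have "(\<Sum>p\<in>primes_le n. 1 / real p) - (\<Sum>p\<in>primes_le n. f p) \<le> (\<Sum>p\<in>primes_le n. e * (ln (real p) / real p))"
    unfolding sum_subtractf[symmetric] by (intro sum_mono f)
  also have "\<dots> \<le> e * (2 * ln (real n))"
    unfolding sum_distrib_left[symmetric] using e sum_ln_over_primes_le[of n] assms by (intro mult_left_mono) auto
  also have "\<dots> = 2" using ln1 by (simp add: e_def)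
  finally have 1: "(\<Sum>p\<in>primes_le n. 1 / real p) \<le> (\<Sum>p\<in>primes_le n. f p) + 2" by simp
  \<comment> \<open>Expanding the product gives a sum over squarefree numbers, a part of the sum
    over all integers.\<close>
  have prod_le: "(\<Prod>p\<in>primes_le n. 1 + f p) \<le> 2 * ln (real n)"
  proof -
    let ?P = "Pow (primes_le n)"
    have "(\<Prod>p\<in>primes_le n. 1 + f p) = (\<Sum>A\<in>?P. \<Prod>p\<in>A. f p)"
      by (rule prod_one_plus_Pow) simp
    also have "\<dots> = (\<Sum>A\<in>?P. real (\<Prod>A) powr (-(1+e)))"
      by (intro sum.cong refl) (auto simp: f_def prod_powr_distrib)
    also have "\<dots> = (\<Sum>k\<in>(\<lambda>A. \<Prod>A) ` ?P. real k powr (-(1+e)))"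
      by (subst sum.reindex)
         (auto intro!: inj_on_Prod_primes finite_subset[OF _ finite_primes_le] dest: primes_leD)
    also have "\<dots> \<le> (\<Sum>k=1..Max ((\<lambda>A. \<Prod>A) ` ?P). real k powr (-(1+e)))"
    proof (intro sum_mono2)
      show "(\<lambda>A. \<Prod>A) ` ?P \<subseteq> {1..Max ((\<lambda>A. \<Prod>A) ` ?P)}"
      proof safe
        fix A assume "A \<subseteq> primes_le n"
        thus "\<Prod>A \<in> {1..Max ((\<lambda>A. \<Prod>A) ` ?P)}"
          using Prod_primes_pos[of A] by (auto simp: Suc_le_eq primes_le_def)
      qed
    qed auto
    also have "\<dots> \<le> 1 + 1 / e" by (rule sum_powr_minus_le) fact
    also have "\<dots> \<le> 2 * ln (real n)" using ln1 by (simp add: e_def)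
    finally show ?thesis .
  qed
  \<comment> \<open>From the product back to the sum by \<open>ln (1 + y) \<ge> y - y^2\<close>; the
    squares add at most 2. The final constant is \<open>5 = 2 + 2 + 1\<close>, where 1 pays for
    bounding the factor 2 by \<open>exp 1\<close>.\<close>
  have "(\<Sum>p\<in>primes_le n. f p) \<le> (\<Sum>p\<in>primes_le n. ln (1 + f p) + 1 / real p ^ 2)"
  proof (rule sum_mono)
    fix p assume p: "p \<in> primes_le n"
    have "f p \<le> 1" using f(2)[OF p] p by (smt (verit) divide_le_eq_1 of_nat_0_le_iff One_nat_def of_nat_1 of_nat_mono primes_leD(1) prime_ge_1_nat)
    hence "f p - f p ^ 2 \<le> ln (1 + f p)" using f(1)[OF p] by (intro ln_one_plus_pos_lower_bound) auto
    moreover have "f p ^ 2 \<le> (1 / real p) ^ 2" using f[OF p] by (intro power_mono) auto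
    ultimately show "f p \<le> ln (1 + f p) + 1 / real p ^ 2" by (simp add: power_divide)
  qed
  also have "\<dots> \<le> (\<Sum>p\<in>primes_le n. ln (1 + f p)) + 2"
    unfolding sum.distrib using sum_primes_inverse_squares_le[OF finite_primes_le, of n] primes_leD(1)
    by (intro add_left_mono) blast
  also have "(\<Sum>p\<in>primes_le n. ln (1 + f p)) = ln (\<Prod>p\<in>primes_le n. 1 + f p)"
    using f(1) by (subst ln_prod) (auto intro: add_pos_pos less_imp_neq[symmetric] simp: add_nonneg_eq_0_iff less_imp_le)
  also have "ln (\<Prod>p\<in>primes_le n. 1 + f p) \<le> ln (2 * ln (real n))"
    using prod_le f(1) by (intro ln_mono prod_pos) (auto intro: add_pos_pos)
  also have "ln (2 * ln (real n)) \<le> ln (exp 1 * ln (real n))"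
    using ln1 exp_ge_add_one_self[of 1] by (subst ln_le_cancel_iff) (auto intro!: mult_right_mono)
  also have "\<dots> = 1 + ln (ln (real n))" using ln1 by (subst ln_mult) auto
  finally have "(\<Sum>p\<in>primes_le n. f p) \<le> 3 + ln (ln (real n))"
    by simp
  with 1 have "(\<Sum>p\<in>primes_le n. 1 / real p) \<le> 5 + ln (ln (real n))" by linarith
  hence "exp (\<Sum>p\<in>primes_le n. 1 / real p) \<le> exp (5 + ln (ln (real n)))" by simp
  also have "\<dots> = exp 5 * ln (real n)" using ln1 by (simp add: exp_add)
  finally show ?thesis .
qed

section \<open>A lower bound for the number of primes\<close>

text \<open>Nair's lower bound for the least common multiple: with \<open>u(m, k) = m * (m + k choose m)\<close>
  one has \<open>1 / u(m, k + 1) = 1 / u(m, k) - 1 / u(m + 1, k)\<close>.\<close>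

lemma mult_binomial_dvd_common_multiple:
  fixes M n :: nat
  assumes "M > 0" "\<And>j. 1 \<le> j \<Longrightarrow> j \<le> n \<Longrightarrow> j dvd M" "m \<ge> 1" "m + k \<le> n"
  shows "m * (m + k choose m) dvd M"
  using assms(3,4)
proof (induction k arbitrary: m)
  case 0
  thus ?case using assms(2)[of m] by simp
next
  case (Suc k)
  define c where "c = (m + k choose m)"
  have c: "c > 0" by (simp add: c_def zero_less_binomial_iff)
  obtain a where a: "M = m * c * a"
    using Suc.IH[of m] Suc.prems by (auto simp: c_def elim: dvdE)
  have v: "Suc m * (Suc m + k choose Suc m) = (m + k + 1) * c"
    using Suc_times_binomial_eq[of "m + k" m] by (simp add: c_def mult.commute)
  obtain b where b: "M = (m + k + 1) * c * b"
    using Suc.IH[of "Suc m"] Suc.prems unfolding v by (auto elim: dvdE)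
  have w: "(k + 1) * (m * (m + Suc k choose m)) = m * ((m + k + 1) * c)"
    using Suc_times_binomial_add[of m k] v by (simp add: mult_ac)
  define w where "w = m * (m + Suc k choose m)"
  have w': "(k + 1) * w = m * ((m + k + 1) * c)" using w by (simp add: w_def)
  \<comment> \<open>Here \<open>a = M / u(m, k)\<close> and \<open>b = M / u(m + 1, k)\<close>, so
    \<open>a - b\<close> must be \<open>M / u(m, k + 1)\<close>. Multiplication by
    \<open>k + 1\<close> avoids fractions, and integers are used since a difference occurs.\<close>
  have "(int k + 1) * (int w * (int a - int b)) = int m * ((int m + int k + 1) * int c) * (int a - int b)"
    using arg_cong[OF w', of int] by (simp add: algebra_simps)
  also have "\<dots> = (int m + int k + 1) * (int m * int c * int a) - int m * ((int m + int k + 1) * int c * int b)"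
    by (simp add: algebra_simps)
  also have "\<dots> = (int m + int k + 1) * int M - int m * int M"
  proof -
    have "int m * int c * int a = int M" "(int m + int k + 1) * int c * int b = int M"
      by (metis a of_nat_mult) (metis b of_nat_mult of_nat_add of_nat_1)
    moreover have "(int m + int k + 1) * (int m * int c * int a) - int m * ((int m + int k + 1) * int c * int b)
        = (int m + int k + 1) * int M - int m * int M"
      unfolding calculation ..
    ultimately show ?thesis by (simp only:)
  qed
  also have "\<dots> = (int k + 1) * int M" by (simp add: algebra_simps)
  finally have "int w * (int a - int b) = int M" by simp
  hence "int M = int w * (int a - int b)" by simp
  hence "int w dvd int M" by (rule dvdI)
  thus ?case unfolding int_dvd_int_iff w_def .
qed

text \<open>\<open>M\<close> is the least common multiple of \<open>1, ..., n\<close>: each prime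
  contributes its largest power not exceeding \<open>n\<close>. Bounding every such power by
  \<open>n\<close> turns a lower bound for common multiples into one for the number of
  primes.\<close>

lemma common_multiple_le_power_card_primes:
  assumes "n \<ge> 1"
  obtains M where "M > 0" "\<And>j. 1 \<le> j \<Longrightarrow> j \<le> n \<Longrightarrow> j dvd M" "M \<le> n ^ card (primes_le n)"
proof -
  have "\<exists>a. p ^ a \<le> n \<and> n < p ^ (a + 1)" if "p \<in> primes_le n" for p
    using ex_power_ivl1[of p n] that assms by (auto simp: primes_le_def prime_ge_2_nat)
  then obtain a where a: "p ^ a p \<le> n" "n < p ^ (a p + 1)" if "p \<in> primes_le n" for p by metis
  define M where "M = (\<Prod>p\<in>primes_le n. p ^ a p)"
  show ?thesis
  proof
    show "M > 0" unfolding M_def by (intro prod_pos) (auto simp: primes_le_def prime_gt_0_nat)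
    have "M \<le> (\<Prod>p\<in>primes_le n. n)" unfolding M_def by (intro prod_mono) (use a(1) in auto)
    thus "M \<le> n ^ card (primes_le n)" by simp
    fix j assume j: "1 \<le> j" "j \<le> n"
    have "(\<Prod>p\<in>prime_factors j. p ^ multiplicity p j) dvd M"
      unfolding M_def
    proof (rule prod_dvd_prod_subset2)
      show "prime_factors j \<subseteq> primes_le n"
        using j by (auto simp: primes_le_def prime_factors_dvd dest: dvd_imp_le)
      fix p assume p: "p \<in> prime_factors j"
      hence "p \<in> primes_le n" using j by (auto simp: primes_le_def prime_factors_dvd dest: dvd_imp_le)
      note a = a[OF this]
      have "p ^ multiplicity p j \<le> j" using j by (intro dvd_imp_le multiplicity_dvd) auto
      hence "p ^ multiplicity p j < p ^ (a p + 1)" using a j by linarith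
      hence "multiplicity p j < a p + 1"
        using p prime_gt_1_nat[of p] by (subst (asm) power_strict_increasing_iff) (auto simp: in_prime_factors_iff)
      thus "p ^ multiplicity p j dvd p ^ a p" by (simp add: le_imp_power_dvd)
    qed simp
    thus "j dvd M" using j prime_factorization_nat[of j] by simp
  qed
qed

text \<open>With \<open>j = t div 2\<close>, the number
  \<open>j * (2 j choose j) \<ge> 4^j / 2\<close> divides a common multiple that is at most
  \<open>t\<close> to the number of primes. Taking logarithms leaves at least
  \<open>j - t/8\<close>, and \<open>j \<ge> t/3\<close> makes this at least
  \<open>t/8\<close>.\<close>

lemma chebyshev_lower:
  "\<exists>c>0. \<exists>t0. \<forall>t\<ge>t0. c * real t / ln (real t) \<le> real (card (primes_le t))"
proof -
  have "eventually (\<lambda>x::real. ln x \<le> x / 8) at_top"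
  proof -
    have "((\<lambda>x::real. ln x / x) \<longlongrightarrow> 0) at_top" by (rule ln_x_over_x_tendsto_0) 
    hence "eventually (\<lambda>x::real. ln x / x < 1/8) at_top" by (rule order_tendstoD) simp
    thus ?thesis using eventually_gt_at_top[of 0] by eventually_elim (simp add: field_simps)
  qed
  then obtain x0 where x0: "\<And>x::real. x \<ge> x0 \<Longrightarrow> ln x \<le> x / 8"
    by (auto simp: eventually_at_top_linorder)
  have "1/8 * real t / ln (real t) \<le> real (card (primes_le t))" if t: "t \<ge> max 6 (nat \<lceil>x0\<rceil>)" for t
  proof -
    define j where "j = t div 2"
    have j: "j \<ge> 1" "2 * j \<le> t" "3 * real j \<ge> real t" using t by (auto simp: j_def)
    have "real (nat \<lceil>x0\<rceil>) \<le> real t" using t by simp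
    hence "real t \<ge> x0" by linarith
    have t1: "t \<ge> 1" using t by simp
    obtain M where M: "M > 0" "\<And>j. 1 \<le> j \<Longrightarrow> j \<le> t \<Longrightarrow> j dvd M" "M \<le> t ^ card (primes_le t)"
      using common_multiple_le_power_card_primes[OF t1] by metis
    have "j * (j + j choose j) dvd M" 
      by (rule mult_binomial_dvd_common_multiple[OF M(1), of t]) (use M(2) j in auto)
    hence "j * (2 * j choose j) \<le> M" using M(1) by (intro dvd_imp_le) (auto simp: mult_2)
    hence "j * (2 * j choose j) \<le> t ^ card (primes_le t)" using M(3) by linarith
    hence "real (j * (2 * j choose j)) \<le> real (t ^ card (primes_le t))" by (simp only: of_nat_le_iff)
    moreover have "4 ^ j / 2 \<le> real (j * (2 * j choose j))"
      using central_binomial_lower_bound[of j] j(1) by (simp add: field_simps)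
    ultimately have "4 ^ j \<le> 2 * real t ^ card (primes_le t)" by simp
    hence "ln (4 ^ j) \<le> ln (2 * real t ^ card (primes_le t))" using t by (intro ln_mono) auto
    hence "j * ln 4 \<le> ln 2 + card (primes_le t) * ln (real t)"
      using t by (simp add: ln_mult ln_realpow)
    moreover have "ln 4 \<ge> (1::real)"
      using exp_le by (subst ln_ge_iff) (auto intro: order_trans)
    hence "j * ln 4 \<ge> j * (1::real)" by (intro mult_left_mono) auto
    moreover have "ln 2 \<le> ln (real t)" "ln (real t) \<le> real t / 8" using t x0[OF \<open>real t \<ge> x0\<close>] by auto
    ultimately have "card (primes_le t) * ln (real t) \<ge> real t / 8" using j(3) by linarith
    moreover have "ln (real t) > 0" using t by simp
    ultimately show ?thesis by (simp add: field_simps)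
  qed
  thus ?thesis by (intro exI[of _ "1/8"] conjI exI[of _ "max 6 (nat \<lceil>x0\<rceil>)"] allI impI) simp_all
qed

section \<open>Selberg's sieve\<close>

text \<open>Moebius inversion on the sets between \<open>L\<close> and \<open>C\<close>: the sum
  factors into terms \<open>1 + (-1)\<close>, one for each element of \<open>C - L\<close>. It
  evaluates the diagonal variables of Selberg's quadratic form.\<close>

lemma sum_alternating_between:
  assumes "finite C" "L \<subseteq> C"
  shows "(\<Sum>A | L \<subseteq> A \<and> A \<subseteq> C. (-1) ^ card A) = (if L = C then (-1) ^ card L else (0::real))"
proof -
  have fin: "finite L" "finite (C - L)" using assms finite_subset by auto
  have "(\<Sum>A | L \<subseteq> A \<and> A \<subseteq> C. (-1) ^ card A) = (\<Sum>X\<in>Pow (C - L). (-1) ^ card (L \<union> X) :: real)"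
    using assms by (intro sum.reindex_bij_witness[of _ "\<lambda>X. L \<union> X" "\<lambda>A. A - L"]) (auto simp: Un_absorb1)
  also have "\<dots> = (\<Sum>X\<in>Pow (C - L). (-1) ^ card L * (\<Prod>x\<in>X. -1))"
  proof (intro sum.cong refl)
    fix X assume "X \<in> Pow (C - L)"
    hence "card (L \<union> X) = card L + card X" using fin finite_subset[of X] by (intro card_Un_disjoint) auto
    thus "(-1) ^ card (L \<union> X) = (-1) ^ card L * (\<Prod>x\<in>X. -1 :: real)" by (simp add: power_add)
  qed
  also have "\<dots> = (-1) ^ card L * (\<Prod>x\<in>C - L. 1 + (-1))"
    using fin by (subst prod_one_plus_Pow) (auto simp: sum_distrib_left)
  also have "\<dots> = (if L = C then (-1) ^ card L else 0)"
    using assms fin by (auto simp: card_gt_0_iff)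
  finally show ?thesis .
qed

text \<open>The divisors of a squarefree modulus are represented by sets of primes, so that \<open>lcm\<close> and
  \<open>gcd\<close> become union and intersection. The weights \<open>\<lambda>\<close> are the optimal ones, for which
  the quadratic form takes the value \<open>1 / J\<close>; the error term uses only \<open>\<bar>\<lambda> A\<bar> \<le> 1 / prod g A\<close>.\<close>

theorem selberg_sieve:
  fixes P :: "'a set" and g :: "'a \<Rightarrow> real" and D :: "'a set set" and U :: "'b set"
    and bad :: "'a \<Rightarrow> 'b \<Rightarrow> bool" and X :: real and err :: "'a set \<Rightarrow> real"
  assumes finP: "finite P" and g: "\<And>p. p \<in> P \<Longrightarrow> 0 < g p" "\<And>p. p \<in> P \<Longrightarrow> g p < 1"
    and D: "D \<subseteq> Pow P" "{} \<in> D" "\<And>A B. A \<in> D \<Longrightarrow> B \<subseteq> A \<Longrightarrow> B \<in> D"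
    and finU: "finite U"
    and count: "\<And>A. A \<subseteq> P \<Longrightarrow> \<bar>real (card {t\<in>U. \<forall>p\<in>A. bad p t}) - X * prod g A\<bar> \<le> err A"
  shows "real (card {t\<in>U. \<forall>p\<in>P. \<not> bad p t})
         \<le> X / (\<Sum>A\<in>D. \<Prod>p\<in>A. g p / (1 - g p))
           + (\<Sum>A\<in>D. \<Sum>B\<in>D. err (A \<union> B) / (prod g A * prod g B))"
proof -
  define h where "h = (\<lambda>A. \<Prod>p\<in>A. g p / (1 - g p))"
  define J where "J = (\<Sum>A\<in>D. h A)"
  \<comment> \<open>In the variables \<open>y L\<close>, the sum of \<open>prod g A * lam A\<close>
    over \<open>A \<supseteq> L\<close>, the quadratic form is the sum of
    \<open>(y L)^2 / h L\<close>, and \<open>lam {} = 1\<close> says that the sum of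
    \<open>(-1) ^ card L * y L\<close> is 1. By Cauchy-Schwarz the minimum is at
    \<open>y L = (-1) ^ card L * h L / J\<close>; inverting this gives \<open>lam\<close>.\<close>
  define lam where "lam = (\<lambda>A. (-1) ^ card A / prod g A * ((\<Sum>C | C \<in> D \<and> A \<subseteq> C. h C) / J))"
  have finD: "finite D" using D(1) finP finite_subset by blast
  have DP: "A \<subseteq> P" if "A \<in> D" for A using D(1) that by blast
  have finDe: "finite A" if "A \<in> D" for A using DP[OF that] finP finite_subset by blast
  have gpos: "0 < prod g A" if "A \<subseteq> P" for A using g(1) that by (intro prod_pos) auto
  have hpos: "0 < h A" if "A \<subseteq> P" for A
    unfolding h_def using g that by (intro prod_pos) (auto intro!: divide_pos_pos)
  have Jpos: "0 < J"
    unfolding J_def using D(2) finD hpos DP by (intro sum_pos) auto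
  have lam_empty: "lam {} = 1" using Jpos by (simp add: lam_def J_def)
  have lam_abs: "\<bar>lam A\<bar> \<le> 1 / prod g A" if "A \<in> D" for A
  proof -
    have "0 \<le> (\<Sum>C | C \<in> D \<and> A \<subseteq> C. h C)" using hpos DP by (intro sum_nonneg) (auto intro: less_imp_le)
    moreover have "(\<Sum>C | C \<in> D \<and> A \<subseteq> C. h C) \<le> J"
      unfolding J_def using hpos DP finD by (intro sum_mono2) (auto intro: less_imp_le)
    ultimately have "\<bar>(\<Sum>C | C \<in> D \<and> A \<subseteq> C. h C) / J\<bar> \<le> 1" using Jpos by simp
    hence "1 / prod g A * \<bar>(\<Sum>C | C \<in> D \<and> A \<subseteq> C. h C) / J\<bar> \<le> 1 / prod g A * 1"
      using gpos[OF DP[OF that]] by (intro mult_left_mono) auto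
    thus ?thesis using gpos[OF DP[OF that]] by (simp add: lam_def abs_mult power_abs)
  qed
  have diag: "(\<Sum>A | A \<in> D \<and> L \<subseteq> A. prod g A * lam A) = (-1) ^ card L * h L / J" if L: "L \<in> D" for L
  proof -
    have "(\<Sum>A | A \<in> D \<and> L \<subseteq> A. prod g A * lam A)
        = (\<Sum>A | A \<in> D \<and> L \<subseteq> A. \<Sum>C | C \<in> D \<and> A \<subseteq> C. (-1) ^ card A * (h C / J))"
    proof (intro sum.cong refl)
      fix A assume "A \<in> {A. A \<in> D \<and> L \<subseteq> A}"
      hence "prod g A \<noteq> 0" using gpos[OF DP, of A] by auto
      thus "prod g A * lam A = (\<Sum>C | C \<in> D \<and> A \<subseteq> C. (-1) ^ card A * (h C / J))"
        by (simp add: lam_def sum_distrib_left sum_divide_distrib)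
    qed
    also have "\<dots> = (\<Sum>C | C \<in> D \<and> L \<subseteq> C. \<Sum>A | A \<in> D \<and> L \<subseteq> A \<and> A \<subseteq> C. (-1) ^ card A * (h C / J))"
      
    proof -
      have "(\<Sum>A | A \<in> D \<and> L \<subseteq> A. \<Sum>C | C \<in> D \<and> A \<subseteq> C. (-1) ^ card A * (h C / J))
          = (\<Sum>C\<in>D. \<Sum>A | A \<in> {A. A \<in> D \<and> L \<subseteq> A} \<and> A \<subseteq> C. (-1) ^ card A * (h C / J))"
        using finD by (intro sum.swap_restrict) auto
      also have "\<dots> = (\<Sum>C | C \<in> D \<and> L \<subseteq> C. \<Sum>A | A \<in> D \<and> L \<subseteq> A \<and> A \<subseteq> C. (-1) ^ card A * (h C / J))"
      proof (intro sum.mono_neutral_cong_right ballI)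
        fix C assume "C \<in> D - {C. C \<in> D \<and> L \<subseteq> C}"
        hence "{A \<in> {A. A \<in> D \<and> L \<subseteq> A}. A \<subseteq> C} = {}" by blast
        thus "(\<Sum>A | A \<in> {A. A \<in> D \<and> L \<subseteq> A} \<and> A \<subseteq> C. (-1) ^ card A * (h C / J)) = 0"
          by (simp only: sum.empty)
      qed (use finD in \<open>auto intro!: sum.cong\<close>)
      finally show ?thesis .
    qed
    \<comment> \<open>Since \<open>D\<close> is closed under subsets, every set between
      \<open>L\<close> and \<open>C\<close> lies in \<open>D\<close>, so the inner sum is a full
      alternating sum.\<close>
    also have "\<dots> = (\<Sum>C | C \<in> D \<and> L \<subseteq> C. if C = L then (-1) ^ card L * h L / J else 0)"
    proof (intro sum.cong refl)
      fix C assume C: "C \<in> {C. C \<in> D \<and> L \<subseteq> C}"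
      have "(\<Sum>A | A \<in> D \<and> L \<subseteq> A \<and> A \<subseteq> C. (-1) ^ card A * (h C / J))
          = (\<Sum>A | L \<subseteq> A \<and> A \<subseteq> C. (-1) ^ card A) * (h C / J)"
        unfolding sum_distrib_right using C D(3) by (intro sum.cong) auto
      also have "(\<Sum>A | L \<subseteq> A \<and> A \<subseteq> C. (-1) ^ card A) = (if L = C then (-1) ^ card L else (0::real))"
        using C finDe by (intro sum_alternating_between) auto
      finally show "(\<Sum>A | A \<in> D \<and> L \<subseteq> A \<and> A \<subseteq> C. (-1) ^ card A * (h C / J))
          = (if C = L then (-1) ^ card L * h L / J else 0)" by auto
    qed
    also have "\<dots> = (-1) ^ card L * h L / J" using L finD by (subst sum.delta) auto
    finally show ?thesis .
  qed
  \<comment> \<open>The factor \<open>1 / prod g (A \<inter> B)\<close> is expanded over the subsets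
    of \<open>A \<inter> B\<close> through \<open>1 / g p = 1 + (1 - g p) / g p\<close>. This
    separates \<open>A\<close> from \<open>B\<close> and diagonalizes the form.\<close>
  have g_Un: "prod g (A \<union> B) = prod g A * prod g B * (\<Sum>L\<in>Pow (A \<inter> B). 1 / h L)" if "A \<in> D" "B \<in> D" for A B
  proof -
    have fin: "finite A" "finite B" using finDe that by auto
    have "(\<Sum>L\<in>Pow (A \<inter> B). 1 / h L) = (\<Sum>L\<in>Pow (A \<inter> B). \<Prod>p\<in>L. (1 - g p) / g p)"
      by (intro sum.cong refl) (simp add: h_def prod_dividef)
    also have "\<dots> = (\<Prod>p\<in>A \<inter> B. 1 + (1 - g p) / g p)" using fin by (subst prod_one_plus_Pow) auto
    also have "\<dots> = (\<Prod>p\<in>A \<inter> B. 1 / g p)"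
    proof (intro prod.cong refl)
      fix p assume "p \<in> A \<inter> B"
      hence "g p > 0" using g(1) DP that by blast
      thus "1 + (1 - g p) / g p = 1 / g p" by (simp add: field_simps)
    qed
    also have "\<dots> = 1 / prod g (A \<inter> B)" by (simp add: prod_dividef)
    finally have "(\<Sum>L\<in>Pow (A \<inter> B). 1 / h L) = 1 / prod g (A \<inter> B)" .
    moreover have "prod g (A \<union> B) * prod g (A \<inter> B) = prod g A * prod g B"
      using fin by (rule prod.union_inter)
    moreover have "prod g (A \<inter> B) > 0" using DP that by (intro gpos) auto
    ultimately show ?thesis by (metis (no_types, lifting) divide_divide_eq_left div_by_1 eq_divide_eq_1 mult.commute nonzero_mult_div_cancel_right less_irrefl times_divide_eq_right mult_1_right)
  qed
  have quad: "(\<Sum>A\<in>D. \<Sum>B\<in>D. lam A * lam B * prod g (A \<union> B)) = 1 / J"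
  proof -
    have "(\<Sum>A\<in>D. \<Sum>B\<in>D. lam A * lam B * prod g (A \<union> B))
        = (\<Sum>A\<in>D. \<Sum>B\<in>D. \<Sum>L | L \<in> D \<and> L \<subseteq> A \<and> L \<subseteq> B. (prod g A * lam A) * (prod g B * lam B) / h L)"
    proof (intro sum.cong refl)
      fix A B assume AB: "A \<in> D" "B \<in> D"
      have "Pow (A \<inter> B) = {L. L \<in> D \<and> L \<subseteq> A \<and> L \<subseteq> B}" using AB D(3) by auto
      thus "lam A * lam B * prod g (A \<union> B)
          = (\<Sum>L | L \<in> D \<and> L \<subseteq> A \<and> L \<subseteq> B. (prod g A * lam A) * (prod g B * lam B) / h L)"
        unfolding g_Un[OF AB] by (simp add: sum_distrib_left mult_ac)
    qed
    also have "\<dots> = (\<Sum>A\<in>D. \<Sum>B\<in>D. \<Sum>L\<in>D. if L \<subseteq> A \<and> L \<subseteq> B then (prod g A * lam A) * (prod g B * lam B) / h L else 0)"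
      by (intro sum.cong refl sum.inter_filter finD)
    also have "\<dots> = (\<Sum>L\<in>D. \<Sum>A\<in>D. \<Sum>B\<in>D. if L \<subseteq> A \<and> L \<subseteq> B then (prod g A * lam A) * (prod g B * lam B) / h L else 0)"
      by (rule trans[OF sum.cong[OF refl sum.swap] sum.swap])
    also have "\<dots> = (\<Sum>L\<in>D. (\<Sum>A | A \<in> D \<and> L \<subseteq> A. prod g A * lam A) ^ 2 / h L)"
    proof (intro sum.cong refl)
      fix L
      have "(\<Sum>A | A \<in> D \<and> L \<subseteq> A. prod g A * lam A) ^ 2
        = (\<Sum>A\<in>D. if L \<subseteq> A then prod g A * lam A else 0) * (\<Sum>B\<in>D. if L \<subseteq> B then prod g B * lam B else 0)"
        using finD by (simp add: power2_eq_square sum.inter_filter)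
      also have "\<dots> = (\<Sum>A\<in>D. \<Sum>B\<in>D. if L \<subseteq> A \<and> L \<subseteq> B then (prod g A * lam A) * (prod g B * lam B) else 0)"
        unfolding sum_product by (intro sum.cong) auto
      finally show "(\<Sum>A\<in>D. \<Sum>B\<in>D. if L \<subseteq> A \<and> L \<subseteq> B then (prod g A * lam A) * (prod g B * lam B) / h L else 0)
        = (\<Sum>A | A \<in> D \<and> L \<subseteq> A. prod g A * lam A) ^ 2 / h L"
        unfolding sum_divide_distrib by (simp only: sum_divide_distrib) (intro sum.cong refl, simp)
    qed
    also have "\<dots> = (\<Sum>L\<in>D. h L / J ^ 2)"
    proof (intro sum.cong refl)
      fix L assume L: "L \<in> D"
      have "((-1) ^ card L * h L / J) ^ 2 = h L ^ 2 / J ^ 2"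
        by (simp add: power_mult_distrib power_divide flip: power_mult)
      thus "(\<Sum>A | A \<in> D \<and> L \<subseteq> A. prod g A * lam A) ^ 2 / h L = h L / J ^ 2"
        unfolding diag[OF L] using hpos[OF DP[OF L]] by (simp add: power2_eq_square)
    qed
    also have "\<dots> = 1 / J" using Jpos by (simp add: J_def[symmetric] power2_eq_square flip: sum_divide_distrib)
    finally show ?thesis .
  qed
  define c where "c = (\<lambda>A. real (card {t\<in>U. \<forall>p\<in>A. bad p t}))"
  have "real (card {t\<in>U. \<forall>p\<in>P. \<not> bad p t}) = (\<Sum>t\<in>U. if \<forall>p\<in>P. \<not> bad p t then 1 else 0)"
    using finU by (simp add: sum.If_cases Int_def)
  \<comment> \<open>The square is a majorant of the indicator: it is nonnegative, and if no
    \<open>p\<close> is bad for \<open>t\<close>, only \<open>A = {}\<close> contributes, with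
    \<open>lam {} = 1\<close>.\<close>
  also have "\<dots> \<le> (\<Sum>t\<in>U. (\<Sum>A\<in>D. if \<forall>p\<in>A. bad p t then lam A else 0) ^ 2)"
  proof (rule sum_mono)
    fix t
    show "(if \<forall>p\<in>P. \<not> bad p t then 1 else 0) \<le> (\<Sum>A\<in>D. if \<forall>p\<in>A. bad p t then lam A else 0) ^ 2"
    proof (cases "\<forall>p\<in>P. \<not> bad p t")
      case True
      have "(\<Sum>A\<in>D. if \<forall>p\<in>A. bad p t then lam A else 0) = (\<Sum>A\<in>D. if A = {} then lam {} else 0)"
        
      proof (intro sum.cong refl)
        fix A assume "A \<in> D"
        hence "(\<forall>p\<in>A. bad p t) \<longleftrightarrow> A = {}" using True DP by blast
        thus "(if \<forall>p\<in>A. bad p t then lam A else 0) = (if A = {} then lam {} else 0)" by simp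
      qed
      thus ?thesis using D(2) finD lam_empty by (simp add: True)
    qed auto
  qed
  also have "\<dots> = (\<Sum>t\<in>U. \<Sum>A\<in>D. \<Sum>B\<in>D. if \<forall>p\<in>A \<union> B. bad p t then lam A * lam B else 0)"
    unfolding power2_eq_square sum_product by (intro sum.cong refl) auto
  also have "\<dots> = (\<Sum>A\<in>D. \<Sum>B\<in>D. \<Sum>t\<in>U. if \<forall>p\<in>A \<union> B. bad p t then lam A * lam B else 0)"
    by (rule trans[OF sum.swap sum.cong[OF refl sum.swap]])
  also have "\<dots> = (\<Sum>A\<in>D. \<Sum>B\<in>D. lam A * lam B * c (A \<union> B))"
    unfolding c_def using finU by (intro sum.cong refl) (simp add: sum.If_cases Int_def mult.commute)
  also have "\<dots> \<le> (\<Sum>A\<in>D. \<Sum>B\<in>D. X * (lam A * lam B * prod g (A \<union> B)) + err (A \<union> B) / (prod g A * prod g B))"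
  proof (intro sum_mono)
    fix A B assume AB: "A \<in> D" "B \<in> D"
    have "lam A * lam B * (c (A \<union> B) - X * prod g (A \<union> B)) \<le> \<bar>lam A\<bar> * \<bar>lam B\<bar> * \<bar>c (A \<union> B) - X * prod g (A \<union> B)\<bar>"
      by (metis abs_ge_self abs_mult)
    also have "\<dots> \<le> (1 / prod g A * (1 / prod g B)) * err (A \<union> B)"
      unfolding c_def using AB DP gpos
      by (intro mult_mono lam_abs count mult_nonneg_nonneg) (auto intro: less_imp_le)
    finally show "lam A * lam B * c (A \<union> B)
      \<le> X * (lam A * lam B * prod g (A \<union> B)) + err (A \<union> B) / (prod g A * prod g B)"
      by (simp add: algebra_simps)
  qed
  also have "\<dots> = X * (\<Sum>A\<in>D. \<Sum>B\<in>D. lam A * lam B * prod g (A \<union> B))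
      + (\<Sum>A\<in>D. \<Sum>B\<in>D. err (A \<union> B) / (prod g A * prod g B))"
    by (simp add: sum.distrib sum_distrib_left)
  finally show ?thesis unfolding quad by (simp add: J_def h_def)
qed

section \<open>Counting in periodic sets\<close>

text \<open>A union of \<open>c\<close> residue classes modulo \<open>n\<close>. The number
  \<open>c\<close> is recorded because the error in counting elements below a bound is at most
  \<open>c\<close>, far less than \<open>n\<close>, and because both numbers are multiplicative over
  coprime moduli.\<close>

definition periodic_set :: "nat set \<Rightarrow> nat \<Rightarrow> nat \<Rightarrow> bool"
  where "periodic_set S n c \<longleftrightarrow> n > 0 \<and> (\<forall>k. k + n \<in> S \<longleftrightarrow> k \<in> S) \<and> card {k\<in>S. k < n} = c"

lemma periodic_set_mod:
  assumes "periodic_set S n c"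
  shows "k mod n \<in> S \<longleftrightarrow> k \<in> S"
proof -
  have "r + n * j \<in> S \<longleftrightarrow> r \<in> S" for r j
  proof (induction j)
    case (Suc j)
    have "r + n * Suc j = (r + n * j) + n" by simp
    thus ?case using assms Suc unfolding periodic_set_def by metis
  qed auto
  from this[of "k mod n" "k div n"] show ?thesis by simp
qed

text \<open>By the Chinese remainder theorem, taking remainders modulo \<open>n\<close> and
  \<open>m\<close> maps one period of the intersection bijectively onto pairs of elements, one from
  a period of each set.\<close>

lemma periodic_set_Int:
  assumes S: "periodic_set S n c" and T: "periodic_set T m d" and cop: "coprime n m"
  shows "periodic_set (S \<inter> T) (n * m) (c * d)"
proof -
  have pos: "n > 0" "m > 0" using S T by (auto simp: periodic_set_def)
  have "bij_betw (\<lambda>k. (k mod n, k mod m)) {k\<in>S \<inter> T. k < n * m} ({k\<in>S. k < n} \<times> {k\<in>T. k < m})"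
    unfolding bij_betw_def
  proof
    show "inj_on (\<lambda>k. (k mod n, k mod m)) {k\<in>S \<inter> T. k < n * m}"
    proof (rule inj_onI, clarsimp)
      fix x y assume "x < n * m" "y < n * m" "x mod n = y mod n" "x mod m = y mod m"
      moreover from this have "[x = y] (mod n * m)" using cop by (intro coprime_cong_mult_nat) (auto simp: cong_def)
      ultimately show "x = y" by (simp add: cong_def)
    qed
    show "(\<lambda>k. (k mod n, k mod m)) ` {k\<in>S \<inter> T. k < n * m} = {k\<in>S. k < n} \<times> {k\<in>T. k < m}"
    proof (intro equalityI subsetI)
      fix z assume "z \<in> {k\<in>S. k < n} \<times> {k\<in>T. k < m}"
      then obtain a b where z: "z = (a, b)" "a \<in> S" "a < n" "b \<in> T" "b < m" by auto
      obtain x where x: "[x = a] (mod n)" "[x = b] (mod m)"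
        using binary_chinese_remainder_nat[OF cop] by blast
      define k where "k = x mod (n * m)"
      have k: "k < n * m" "k mod n = a" "k mod m = b"
        using x z pos by (auto simp: k_def cong_def mod_mod_cancel)
      moreover have "k \<in> S" "k \<in> T"
        using periodic_set_mod[OF S, of k] periodic_set_mod[OF T, of k] k z by auto
      ultimately show "z \<in> (\<lambda>k. (k mod n, k mod m)) ` {k\<in>S \<inter> T. k < n * m}"
        using z by (intro image_eqI[of _ _ k]) auto
    qed (use pos periodic_set_mod[OF S] periodic_set_mod[OF T] in auto)
  qed
  hence "card {k\<in>S \<inter> T. k < n * m} = c * d"
    using S T by (simp add: bij_betw_same_card card_cartesian_product periodic_set_def)
  moreover have "k + n * m \<in> S \<longleftrightarrow> k \<in> S" "k + n * m \<in> T \<longleftrightarrow> k \<in> T" for k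
    using periodic_set_mod[OF S, of "k + n * m"] periodic_set_mod[OF S, of k]
      periodic_set_mod[OF T, of "k + n * m"] periodic_set_mod[OF T, of k] by auto
  ultimately show ?thesis using pos by (simp add: periodic_set_def)
qed

lemma periodic_set_INT:
  assumes "finite A" "\<And>i. i \<in> A \<Longrightarrow> periodic_set (S i) (n i) (c i)"
    "\<And>i j. i \<in> A \<Longrightarrow> j \<in> A \<Longrightarrow> i \<noteq> j \<Longrightarrow> coprime (n i) (n j)"
    "periodic_set T m d" "\<And>i. i \<in> A \<Longrightarrow> coprime m (n i)"
  shows "periodic_set {k\<in>T. \<forall>i\<in>A. k \<in> S i} (m * (\<Prod>i\<in>A. n i)) (d * (\<Prod>i\<in>A. c i))"
  using assms
proof (induction A rule: finite_induct)
  case (insert i A)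
  have IH: "periodic_set {k\<in>T. \<forall>i\<in>A. k \<in> S i} (m * (\<Prod>i\<in>A. n i)) (d * (\<Prod>i\<in>A. c i))"
    using insert by (intro insert.IH) auto
  have "coprime (m * (\<Prod>i\<in>A. n i)) (n i)"
    using insert by (auto intro!: prod_coprime_left)
  from periodic_set_Int[OF IH insert.prems(1)[of i] this]
  have "periodic_set ({k\<in>T. \<forall>i\<in>A. k \<in> S i} \<inter> S i) (m * (\<Prod>i\<in>A. n i) * n i) (d * (\<Prod>i\<in>A. c i) * c i)" by simp
  moreover have "{k\<in>T. \<forall>i\<in>A. k \<in> S i} \<inter> S i = {k\<in>T. \<forall>j\<in>insert i A. k \<in> S j}" by auto
  ultimately show ?case using insert.hyps by (simp add: mult_ac)
qed auto

text \<open>Complete periods are counted exactly. The incomplete last one contains between 0 and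
  \<open>c\<close> elements, and its expected share lies between the same bounds.\<close>

lemma periodic_set_count:
  assumes S: "periodic_set S n c"
  shows "\<bar>real (card {k\<in>S. k < N}) - real N * real c / real n\<bar> \<le> real c"
proof -
  have n: "n > 0" using S by (simp add: periodic_set_def)
  have step: "card {k\<in>S. k < n + M} = c + card {k\<in>S. k < M}" for M
  proof -
    have "{k\<in>S. k < n + M} = {k\<in>S. k < n} \<union> (\<lambda>k. k + n) ` {k\<in>S. k < M}" (is "?L = ?R")
    proof (intro equalityI subsetI)
      fix x assume x: "x \<in> ?L"
      show "x \<in> ?R"
      proof (cases "x < n")
        case False
        hence "x = (x - n) + n" by simp
        moreover have "x - n \<in> S" using S x calculation unfolding periodic_set_def by (metis (mono_tags, lifting) mem_Collect_eq)
        ultimately show ?thesis using x False by (intro UnI2 image_eqI[of _ _ "x - n"]) auto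
      qed (use x in auto)
    qed (use S in \<open>auto simp: periodic_set_def\<close>)
    moreover have "card ({k\<in>S. k < n} \<union> (\<lambda>k. k + n) ` {k\<in>S. k < M}) = card {k\<in>S. k < n} + card ((\<lambda>k. k + n) ` {k\<in>S. k < M})"
      by (intro card_Un_disjoint) auto
    moreover have "card ((\<lambda>k. k + n) ` {k\<in>S. k < M}) = card {k\<in>S. k < M}"
      by (intro card_image) (auto simp: inj_on_def)
    ultimately show ?thesis using S by (simp add: periodic_set_def)
  qed
  have full: "card {k\<in>S. k < n * q + r} = c * q + card {k\<in>S. k < r}" for q r
    by (induction q) (auto simp: step add.assoc)
  define q r where "q = N div n" and "r = N mod n"
  have N: "N = n * q + r" "r < n" using n by (auto simp: q_def r_def)
  have "card {k\<in>S. k < r} \<le> card {k\<in>S. k < n}" using N by (intro card_mono) auto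
  hence le: "card {k\<in>S. k < r} \<le> c" using S by (simp add: periodic_set_def)
  define e where "e = r / n * c"
  have "real N * real c / real n = c * q + e" unfolding e_def using n N by (simp add: field_simps)
  moreover have "e \<ge> 0" by (simp add: e_def)
  moreover have "e \<le> 1 * real c" unfolding e_def 
    using N n by (intro mult_right_mono) (auto simp: divide_le_eq)
  moreover have "real (card {k\<in>S. k < N}) = c * q + card {k\<in>S. k < r}" using full[of q r] N(1) by simp
  ultimately show ?thesis using le by (auto simp: abs_le_iff)
qed

section \<open>The main term of the sieve\<close>

lemma ln_Suc_le_sum_inverse: "ln (real (Suc n)) \<le> (\<Sum>k=1..n. 1 / real k)"
proof (induction n)
  case (Suc n)
  define x where "x = real (Suc n)"
  have "ln (real (Suc (Suc n))) = ln (x * (1 + 1 / x))" by (simp add: x_def distrib_left)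
  also have "\<dots> = ln x + ln (1 + 1 / x)"
  proof -
    have "x > 0" "1 + 1 / x > 0" by (auto simp: x_def intro!: add_pos_pos)
    thus ?thesis by (intro ln_mult_pos)
  qed
  also have "ln (1 + 1 / x) \<le> 1 / x" by (rule ln_add_one_self_le_self) (simp add: x_def)
  finally show ?case using Suc by (simp add: x_def)
qed auto

lemma ln_le_sum_inverse: "n \<ge> 1 \<Longrightarrow> ln (real n) \<le> (\<Sum>k=1..n. 1 / real k)"
  using ln_Suc_le_sum_inverse[of n] ln_mono[of "real n" "real (Suc n)"] by linarith

text \<open>The numbers \<open>a\<close> are determined by their exponents at the primes of
  \<open>A\<close>, all positive. Letting these vary independently gives a product of geometric
  series with sums at most \<open>1 / (p - 1)\<close>.\<close>

lemma sum_inverse_same_prime_factors_le: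
  assumes "finite A" "\<forall>p\<in>A. prime p"
  shows "(\<Sum>a | a \<in> {1..n} \<and> prime_factors a = A. 1 / real a) \<le> (\<Prod>p\<in>A. 1 / (real p - 1))"
proof -
  define S where "S = {a. a \<in> {1..n} \<and> prime_factors a = A}"
  define e where "e = (\<lambda>a. restrict (\<lambda>p. multiplicity p a) A)"
  have val: "a = (\<Prod>p\<in>A. p ^ e a p)" if "a \<in> S" for a
    using that prime_factorization_nat[of a] by (auto simp: S_def e_def)
  have inj: "inj_on e S" by (rule inj_onI) (metis val)
  have sub: "e ` S \<subseteq> PiE A (\<lambda>_. {1..n})"
  proof (intro image_subsetI PiE_I)
    fix a p assume a: "a \<in> S" "p \<in> A"
    have "multiplicity p a < p ^ multiplicity p a"
      using a assms prime_gt_1_nat[of p] by (intro power_gt_expt) auto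
    also have "p ^ multiplicity p a \<le> a" using a by (intro dvd_imp_le multiplicity_dvd) (auto simp: S_def)
    also have "a \<le> n" using a by (simp add: S_def)
    finally have "multiplicity p a \<le> n" by simp
    moreover have "p \<in> prime_factors a" using a by (auto simp: S_def)
    hence "multiplicity p a \<ge> 1" by (simp add: prime_factors_multiplicity Suc_le_eq)
    ultimately show "e a p \<in> {1..n}" using a by (simp add: e_def)
  qed (auto simp: e_def)
  have "(\<Sum>a\<in>S. 1 / real a) = (\<Sum>a\<in>S. \<Prod>p\<in>A. 1 / real p ^ e a p)"
  proof (intro sum.cong refl)
    fix a assume "a \<in> S"
    hence "real a = (\<Prod>p\<in>A. real p ^ e a p)" by (subst val) simp_all
    thus "1 / real a = (\<Prod>p\<in>A. 1 / real p ^ e a p)" by (simp add: prod_dividef)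
  qed
  also have "\<dots> = (\<Sum>g\<in>e ` S. \<Prod>p\<in>A. 1 / real p ^ g p)" by (subst sum.reindex[OF inj]) simp
  also have "\<dots> \<le> (\<Sum>g\<in>PiE A (\<lambda>_. {1..n}). \<Prod>p\<in>A. 1 / real p ^ g p)"
    using assms by (intro sum_mono2 sub finite_PiE) (auto intro: prod_nonneg)
  also have "\<dots> = (\<Prod>p\<in>A. \<Sum>k=1..n. 1 / real p ^ k)" using assms by (subst prod_sum_PiE) auto
  also have "\<dots> \<le> (\<Prod>p\<in>A. 1 / (real p - 1))"
  proof (intro prod_mono conjI sum_nonneg)
    fix p assume "p \<in> A"
    hence p: "real p > 1" using assms prime_gt_1_nat[of p] by auto
    have "(\<Sum>k=1..n. 1 / real p ^ k) = (1 - 1 / real p ^ n) / (real p - 1)"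
    proof (induction n)
      case (Suc n)
      have "(1 - y) / (real p - 1) + y / real p = (1 - y / real p) / (real p - 1)" for y
        using p by (simp add: field_simps)
      from this[of "1 / real p ^ n"] Suc show ?case by (simp add: mult.commute)
    qed simp
    thus "(\<Sum>k=1..n. 1 / real p ^ k) \<le> 1 / (real p - 1)" using p by (simp add: divide_right_mono)
  qed auto
  finally show ?thesis by (simp add: S_def)
qed

text \<open>Squarefree numbers up to \<open>n\<close>, each given by its set of prime factors.
  Restricting to primes up to \<open>n\<close> keeps the sets finite; an infinite set would have
  product 1 by convention.\<close>

definition sqfree_sets :: "nat \<Rightarrow> nat set set"
  where "sqfree_sets n = {A. A \<subseteq> primes_le n \<and> \<Prod>A \<le> n}"

lemma finite_sqfree_sets [simp]: "finite (sqfree_sets n)"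
  by (rule finite_subset[of _ "Pow (primes_le n)"]) (auto simp: sqfree_sets_def)

lemma sqfree_setsD:
  assumes "A \<in> sqfree_sets n"
  shows "finite A" "\<forall>p\<in>A. prime p" "\<Prod>A \<le> n" "\<Prod>A > 0" "A \<subseteq> primes_le n"
proof -
  show "finite A" "\<forall>p\<in>A. prime p" "\<Prod>A \<le> n" "A \<subseteq> primes_le n"
    using assms finite_subset[OF _ finite_primes_le, of A n] by (auto simp: sqfree_sets_def primes_le_def)
  thus "\<Prod>A > 0" by (intro Prod_primes_pos)
qed

lemma prime_factors_in_sqfree_sets:
  assumes "1 \<le> a" "a \<le> n"
  shows "prime_factors a \<in> sqfree_sets n"
proof -
  have "\<Prod>(prime_factors a) dvd a" by (subst Prod_primes_dvd_iff) auto
  hence "\<Prod>(prime_factors a) \<le> a" using assms by (intro dvd_imp_le) auto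
  moreover have "prime_factors a \<subseteq> primes_le n"
    using assms by (auto simp: primes_le_def prime_factors_dvd dest: dvd_imp_le)
  ultimately show ?thesis using assms by (simp add: sqfree_sets_def)
qed

text \<open>The integers up to \<open>n\<close> are grouped by their radical.\<close>

lemma sum_inverse_le_sum_sqfree_sets:
  "(\<Sum>a=1..n. 1 / real a) \<le> (\<Sum>A\<in>sqfree_sets n. \<Prod>p\<in>A. 1 / (real p - 1))"
proof -
  have "(\<Sum>a=1..n. 1 / real a) = (\<Sum>A\<in>sqfree_sets n. \<Sum>a | a \<in> {1..n} \<and> prime_factors a = A. 1 / real a)"
    by (rule sum.group [symmetric]) (auto intro: prime_factors_in_sqfree_sets)
  also have "\<dots> \<le> (\<Sum>A\<in>sqfree_sets n. \<Prod>p\<in>A. 1 / (real p - 1))"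
    by (intro sum_mono sum_inverse_same_prime_factors_le) (auto dest: sqfree_setsD)
  finally show ?thesis .
qed

text \<open>Each \<open>p\<close> of \<open>A\<close> lies in \<open>B\<close> only, in
  \<open>C\<close> only, or in both, with total weight
  \<open>u p + u p + (u p)^2 = (1 + u p)^2 - 1\<close>.\<close>

lemma sum_pairs_Un_eq:
  fixes u :: "'a \<Rightarrow> real"
  assumes "finite A"
  shows "(\<Sum>B\<in>Pow A. \<Sum>C | C \<subseteq> A \<and> B \<union> C = A. prod u B * prod u C) = (\<Prod>p\<in>A. (1 + u p) ^ 2 - 1)"
proof -
  have "(\<Sum>C | C \<subseteq> A \<and> B \<union> C = A. prod u B * prod u C) = (\<Prod>p\<in>B. u p * (1 + u p)) * (\<Prod>p\<in>A - B. u p)"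
    if "B \<subseteq> A" for B
  proof -
    have fin: "finite B" "finite (A - B)" using assms that finite_subset by auto
    have "(\<Sum>C | C \<subseteq> A \<and> B \<union> C = A. prod u B * prod u C) = (\<Sum>X\<in>Pow B. prod u B * prod u ((A - B) \<union> X))"
      using that by (intro sum.reindex_bij_witness[of _ "\<lambda>X. (A - B) \<union> X" "\<lambda>C. C \<inter> B"]) (auto intro!: arg_cong[of _ _ "prod u"])
    also have "\<dots> = (\<Sum>X\<in>Pow B. prod u B * (prod u (A - B) * prod u X))"
    proof (intro sum.cong refl)
      fix X assume "X \<in> Pow B"
      hence "prod u ((A - B) \<union> X) = prod u (A - B) * prod u X"
        using fin finite_subset[of X B] by (intro prod.union_disjoint) auto
      thus "prod u B * prod u ((A - B) \<union> X) = prod u B * (prod u (A - B) * prod u X)" by simp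
    qed
    also have "\<dots> = prod u B * (prod u (A - B) * (\<Prod>p\<in>B. 1 + u p))"
      using fin by (simp add: prod_one_plus_Pow sum_distrib_left)
    finally show ?thesis by (simp add: prod.distrib mult_ac)
  qed
  hence "(\<Sum>B\<in>Pow A. \<Sum>C | C \<subseteq> A \<and> B \<union> C = A. prod u B * prod u C)
      = (\<Sum>B\<in>Pow A. (\<Prod>p\<in>B. u p * (1 + u p)) * (\<Prod>p\<in>A - B. u p))" by (intro sum.cong) auto
  also have "\<dots> = (\<Prod>p\<in>A. u p * (1 + u p) + u p)" using assms by (rule prod_add [symmetric])
  also have "\<dots> = (\<Prod>p\<in>A. (1 + u p) ^ 2 - 1)" by (simp add: power2_eq_square algebra_simps)
  finally show ?thesis .
qed

text \<open>The Euler factor \<open>(1 - 1/p)^(-2)\<close>, which a sieve removing two classes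
  modulo \<open>p\<close> loses, up to convergent factors, when \<open>p\<close> is not
  sifted.\<close>

definition euler_sq :: "nat \<Rightarrow> real"
  where "euler_sq p = (real p / (real p - 1)) ^ 2"

lemma euler_sq_ge_1: "prime p \<Longrightarrow> euler_sq p \<ge> 1"
  using prime_gt_1_nat[of p] by (auto simp: euler_sq_def)

lemma Prod_Un_primes_le:
  assumes "B \<in> sqfree_sets m" "C \<in> sqfree_sets n" "m > 0" "n > 0"
  shows "B \<union> C \<in> sqfree_sets (m * n)"
proof -
  note B = sqfree_setsD[OF assms(1)] and C = sqfree_setsD[OF assms(2)]
  have "\<Prod>(B \<union> C) dvd \<Prod>B * \<Prod>C"
    using B C by (subst Prod_primes_dvd_iff) (auto intro: dvd_mult dvd_mult2 dvd_prodI)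
  hence "\<Prod>(B \<union> C) \<le> \<Prod>B * \<Prod>C" using B C by (intro dvd_imp_le) auto
  also have "\<dots> \<le> m * n" using B C by (intro mult_mono) auto
  finally have "\<Prod>(B \<union> C) \<le> m * n" .
  moreover have "x \<le> m * n" if "x \<le> m \<or> x \<le> n" for x
    using that assms(3,4) by (metis One_nat_def Suc_leI le_trans mult_le_mono nat_mult_1 nat_mult_1_right)
  hence "B \<union> C \<subseteq> primes_le (m * n)" using B(5) C(5) by (auto simp: primes_le_def)
  ultimately show ?thesis by (simp add: sqfree_sets_def)
qed

text \<open>The sum for a sieve of dimension two is obtained by squaring the one for dimension one,
  which is at least \<open>ln q\<close>. Pairs of squarefree numbers up to \<open>q\<close> are
  collected by their lcm, which is at most \<open>q * q\<close>; this fixes the sieving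
  limit.\<close>

lemma ln_sq_le_sum_euler_sq:
  assumes "q \<ge> 1"
  shows "ln (real q) ^ 2 \<le> (\<Sum>A\<in>sqfree_sets (q * q). \<Prod>p\<in>A. euler_sq p - 1)"
proof -
  define u where "u = (\<lambda>p::nat. 1 / (real p - 1))"
  have u: "u p > 0" "(1 + u p) ^ 2 = euler_sq p" if "prime p" for p
    using prime_gt_1_nat[OF that] by (auto simp: u_def euler_sq_def field_simps)
  have pu: "prod u B \<ge> 0" if "\<forall>p\<in>B. prime p" for B using that u(1) by (intro prod_nonneg) (auto intro: less_imp_le)
  have "ln (real q) \<le> (\<Sum>A\<in>sqfree_sets q. prod u A)"
    unfolding u_def using ln_le_sum_inverse[OF assms] sum_inverse_le_sum_sqfree_sets[of q] by linarith
  hence "ln (real q) ^ 2 \<le> (\<Sum>A\<in>sqfree_sets q. prod u A) ^ 2"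
    using assms by (intro power_mono) auto
  also have "\<dots> = (\<Sum>z\<in>sqfree_sets q \<times> sqfree_sets q. prod u (fst z) * prod u (snd z))"
    by (simp add: power2_eq_square sum_product sum.cartesian_product case_prod_unfold)
  also have "\<dots> = (\<Sum>A\<in>sqfree_sets (q * q). \<Sum>z | z \<in> sqfree_sets q \<times> sqfree_sets q \<and> fst z \<union> snd z = A. prod u (fst z) * prod u (snd z))"
    using assms by (intro sum.group [symmetric]) (auto intro: Prod_Un_primes_le)
  also have "\<dots> \<le> (\<Sum>A\<in>sqfree_sets (q * q). \<Prod>p\<in>A. euler_sq p - 1)"
  proof (rule sum_mono)
    fix A assume A: "A \<in> sqfree_sets (q * q)"
    note A' = sqfree_setsD[OF A]
    have "(\<Sum>z | z \<in> sqfree_sets q \<times> sqfree_sets q \<and> fst z \<union> snd z = A. prod u (fst z) * prod u (snd z))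
        \<le> (\<Sum>z\<in>(SIGMA B:Pow A. {C. C \<subseteq> A \<and> B \<union> C = A}). prod u (fst z) * prod u (snd z))"
      using A' by (intro sum_mono2 finite_SigmaI) (auto intro!: mult_nonneg_nonneg pu)
    also have "\<dots> = (\<Sum>B\<in>Pow A. \<Sum>C | C \<subseteq> A \<and> B \<union> C = A. prod u B * prod u C)"
      using A' by (subst sum.Sigma) (auto simp: case_prod_unfold)
    also have "\<dots> = (\<Prod>p\<in>A. (1 + u p) ^ 2 - 1)" using A' by (intro sum_pairs_Un_eq)
    also have "\<dots> = (\<Prod>p\<in>A. euler_sq p - 1)" using A' u by (intro prod.cong) auto
    finally show "(\<Sum>z | z \<in> sqfree_sets q \<times> sqfree_sets q \<and> fst z \<union> snd z = A. prod u (fst z) * prod u (snd z)) \<le> (\<Prod>p\<in>A. euler_sq p - 1)" .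
  qed
  finally show ?thesis .
qed

text \<open>Splitting each set into its parts inside and outside \<open>Q\<close> bounds the sum of
  the preceding lemma by a product. The part inside contributes at most
  \<open>prod euler_sq Q\<close>, the price of not sifting by \<open>Q\<close>. Outside, all primes
  are at least 3, where \<open>euler_sq p - 1\<close> is at most the Selberg weight of density
  \<open>2/p\<close>.\<close>

lemma ln_sq_le_selberg_sum:
  assumes "q \<ge> 1" "finite Q" "\<forall>p\<in>Q. prime p" "2 \<in> Q"
  shows "ln (real q) ^ 2 \<le> prod euler_sq Q *
    (\<Sum>A | A \<in> sqfree_sets (q * q) \<and> A \<inter> Q = {}. \<Prod>p\<in>A. 2 / real p / (1 - 2 / real p))"
proof -
  define H where "H = (\<lambda>A. \<Prod>p\<in>A. euler_sq p - 1)"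
  define D where "D = {A. A \<in> sqfree_sets (q * q) \<and> A \<inter> Q = {}}"
  have H0: "H A \<ge> 0" if "\<forall>p\<in>A. prime p" for A
    unfolding H_def using that by (intro prod_nonneg) (auto dest: euler_sq_ge_1)
  have fD: "finite D" by (simp add: D_def)
  have inD: "A - Q \<in> D" if A: "A \<in> sqfree_sets (q * q)" for A
  proof -
    have "\<Prod>(A - Q) \<le> \<Prod>A" using sqfree_setsD[OF A] by (intro dvd_imp_le prod_dvd_prod_subset) auto
    thus ?thesis using A by (auto simp: D_def sqfree_sets_def)
  qed
  have "ln (real q) ^ 2 \<le> (\<Sum>A\<in>sqfree_sets (q * q). H A)"
    unfolding H_def by (rule ln_sq_le_sum_euler_sq) fact
  also have "\<dots> = (\<Sum>A\<in>sqfree_sets (q * q). H (A \<inter> Q) * H (A - Q))"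
    unfolding H_def by (intro sum.cong refl prod.Int_Diff) (auto dest: sqfree_setsD)
  also have "\<dots> = (\<Sum>z\<in>(\<lambda>A. (A \<inter> Q, A - Q)) ` sqfree_sets (q * q). H (fst z) * H (snd z))"
  proof (subst sum.reindex)
    show "inj_on (\<lambda>A. (A \<inter> Q, A - Q)) (sqfree_sets (q * q))"
      by (rule inj_onI) (metis Int_Diff_Un prod.inject)
  qed simp
  also have "\<dots> \<le> (\<Sum>z\<in>Pow Q \<times> D. H (fst z) * H (snd z))"
  proof (intro sum_mono2)
    show "finite (Pow Q \<times> D)" using assms(2) fD by simp
    show "(\<lambda>A. (A \<inter> Q, A - Q)) ` sqfree_sets (q * q) \<subseteq> Pow Q \<times> D" using inD by auto
    fix z assume "z \<in> Pow Q \<times> D - (\<lambda>A. (A \<inter> Q, A - Q)) ` sqfree_sets (q * q)"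
    hence "fst z \<subseteq> Q" "snd z \<in> sqfree_sets (q * q)" by (auto simp: D_def)
    thus "0 \<le> H (fst z) * H (snd z)"
      using assms(3) sqfree_setsD(2)[of "snd z"] by (intro mult_nonneg_nonneg H0) blast+
  qed
  also have "\<dots> = (\<Sum>X\<in>Pow Q. H X) * (\<Sum>A\<in>D. H A)"
    by (simp add: sum_product sum.cartesian_product case_prod_unfold)
  also have "(\<Sum>X\<in>Pow Q. H X) = prod euler_sq Q"
    unfolding H_def using assms by (subst prod_one_plus_Pow [symmetric]) auto
  also have "prod euler_sq Q * (\<Sum>A\<in>D. H A) \<le> prod euler_sq Q * (\<Sum>A\<in>D. \<Prod>p\<in>A. 2 / real p / (1 - 2 / real p))"
  proof (intro mult_left_mono sum_mono)
    fix A assume A: "A \<in> D"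
    show "H A \<le> (\<Prod>p\<in>A. 2 / real p / (1 - 2 / real p))"
      unfolding H_def
    proof (intro prod_mono conjI)
      fix p assume p: "p \<in> A"
      hence pr: "prime p" using A by (auto simp: D_def dest: sqfree_setsD)
      hence "p \<noteq> 2" using A p assms(4) by (auto simp: D_def)
      hence p3: "real p \<ge> 3" using prime_ge_2_nat[OF pr] by simp
      show "0 \<le> euler_sq p - 1" using euler_sq_ge_1[OF pr] by simp
      have "euler_sq p - 1 = (real p ^ 2 - (real p - 1) ^ 2) / (real p - 1) ^ 2"
        using p3 by (simp add: euler_sq_def power_divide diff_divide_distrib)
      also have "real p ^ 2 - (real p - 1) ^ 2 = 2 * real p - 1"
        by (simp add: power2_eq_square algebra_simps)
      also have "(2 * real p - 1) / (real p - 1) ^ 2 \<le> 2 / (real p - 2)"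
      proof (rule mult_imp_div_pos_le)
        have "(2 * real p - 1) * (real p - 2) \<le> 2 * (real p - 1) ^ 2"
          using p3 by (simp add: power2_eq_square algebra_simps)
        hence "2 * real p - 1 \<le> 2 * (real p - 1) ^ 2 / (real p - 2)"
          using p3 by (subst pos_le_divide_eq) auto
        thus "2 * real p - 1 \<le> 2 / (real p - 2) * (real p - 1) ^ 2" by simp
      qed (use p3 in auto)
      also have "\<dots> = 2 / real p / (1 - 2 / real p)" using p3 by (simp add: field_simps)
      finally show "euler_sq p - 1 \<le> 2 / real p / (1 - 2 / real p)" .
    qed
  next
    show "0 \<le> prod euler_sq Q" by (intro prod_nonneg) (simp add: euler_sq_def)
  qed
  finally show ?thesis by (simp add: D_def)
qed

section \<open>Poisson weights\<close>

text \<open>Poisson weights without the factor \<open>exp (-\<mu>)\<close>, so that their total mass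
  is \<open>exp \<mu>\<close>, which will be of the size of a logarithm.\<close>

definition poisson :: "real \<Rightarrow> nat \<Rightarrow> real"
  where "poisson \<mu> j = \<mu> ^ j / fact j"

lemma poisson_nonneg: "\<mu> \<ge> 0 \<Longrightarrow> poisson \<mu> j \<ge> 0"
  by (simp add: poisson_def)

lemma poisson_Suc: "real (Suc j) * poisson \<mu> (Suc j) = \<mu> * poisson \<mu> j"
  by (simp add: poisson_def fact_Suc del: of_nat_Suc)

lemma poisson_sums: "poisson \<mu> sums exp \<mu>"
  using exp_converges[of \<mu>] by (simp add: poisson_def [abs_def] field_simps)

lemma sum_poisson_le:
  assumes "\<mu> \<ge> 0" "finite I"
  shows "sum (poisson \<mu>) I \<le> exp \<mu>"
  using sum_le_suminf[of "poisson \<mu>" I] poisson_sums[of \<mu>] assms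
  by (auto simp: sums_iff poisson_nonneg)

text \<open>The first two moments follow from the shift
  \<open>j * poisson \<mu> j = \<mu> * poisson \<mu> (j - 1)\<close>.\<close>

lemma poisson_variance_sums: "(\<lambda>j. (real j - \<mu>) ^ 2 * poisson \<mu> j) sums (\<mu> * exp \<mu>)"
proof -
  have 1: "(\<lambda>j. real j * poisson \<mu> j) sums (\<mu> * exp \<mu>)"
    using sums_mult[OF poisson_sums, of \<mu> \<mu>] by (subst sums_Suc_iff [symmetric, where f = "\<lambda>j. real j * poisson \<mu> j", simplified, unfolded poisson_Suc[simplified]]) simp
  have "(\<lambda>j. real (Suc j) ^ 2 * poisson \<mu> (Suc j)) sums (\<mu> * (\<mu> * exp \<mu> + exp \<mu>))"
  proof -
    have "(\<lambda>j. \<mu> * (real j * poisson \<mu> j + poisson \<mu> j)) sums (\<mu> * (\<mu> * exp \<mu> + exp \<mu>))"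
      by (intro sums_mult sums_add 1 poisson_sums)
    moreover have "\<mu> * (real j * poisson \<mu> j + poisson \<mu> j) = real (Suc j) ^ 2 * poisson \<mu> (Suc j)" for j
    proof -
      have "real (Suc j) ^ 2 * poisson \<mu> (Suc j) = real (Suc j) * (\<mu> * poisson \<mu> j)"
        unfolding poisson_Suc [symmetric] by (simp add: power2_eq_square)
      thus ?thesis by (simp add: algebra_simps)
    qed
    ultimately show ?thesis by simp
  qed
  hence 2: "(\<lambda>j. real j ^ 2 * poisson \<mu> j) sums (\<mu> * (\<mu> * exp \<mu> + exp \<mu>))"
    by (subst (asm) sums_Suc_iff) simp
  have "(\<lambda>j. real j ^ 2 * poisson \<mu> j - 2 * \<mu> * (real j * poisson \<mu> j) + \<mu> ^ 2 * poisson \<mu> j)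
      sums (\<mu> * (\<mu> * exp \<mu> + exp \<mu>) - 2 * \<mu> * (\<mu> * exp \<mu>) + \<mu> ^ 2 * exp \<mu>)"
    by (intro sums_add sums_diff sums_mult 1 2 poisson_sums)
  thus ?thesis by (simp add: algebra_simps power2_eq_square)
qed

text \<open>Cauchy-Schwarz in pointwise form:
  \<open>\<bar>x\<bar> \<le> (x^2 / sqrt \<mu> + sqrt \<mu>) / 2\<close>, with both halves balanced
  by the variance \<open>\<mu>\<close>.\<close>

lemma sum_poisson_abs_deviation_le:
  assumes "\<mu> > 0" "finite I"
  shows "(\<Sum>j\<in>I. \<bar>real j - \<mu>\<bar> * poisson \<mu> j) \<le> sqrt \<mu> * exp \<mu>"
proof -
  have "\<bar>x\<bar> \<le> (x ^ 2 / sqrt \<mu> + sqrt \<mu>) / 2" for x :: real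
  proof -
    have "0 \<le> (\<bar>x\<bar> - sqrt \<mu>) ^ 2" by simp
    also have "\<dots> = x ^ 2 + sqrt \<mu> * sqrt \<mu> - 2 * \<bar>x\<bar> * sqrt \<mu>"
      by (simp add: power2_eq_square algebra_simps)
    finally show ?thesis using assms by (simp add: field_simps)
  qed
  hence "(\<Sum>j\<in>I. \<bar>real j - \<mu>\<bar> * poisson \<mu> j)
      \<le> (\<Sum>j\<in>I. ((real j - \<mu>) ^ 2 / sqrt \<mu> + sqrt \<mu>) / 2 * poisson \<mu> j)"
    using assms by (intro sum_mono mult_right_mono) (auto simp: poisson_nonneg)
  also have "\<dots> = (\<Sum>j\<in>I. (real j - \<mu>) ^ 2 * poisson \<mu> j) / (2 * sqrt \<mu>) + sqrt \<mu> / 2 * (\<Sum>j\<in>I. poisson \<mu> j)"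
    by (simp add: sum_divide_distrib sum_distrib_left flip: sum.distrib) (simp add: field_simps)
  also have "\<dots> \<le> (\<mu> * exp \<mu>) / (2 * sqrt \<mu>) + sqrt \<mu> / 2 * exp \<mu>"
  proof -
    have "(\<Sum>j\<in>I. (real j - \<mu>) ^ 2 * poisson \<mu> j) \<le> \<mu> * exp \<mu>"
      using sum_le_suminf[of "\<lambda>j. (real j - \<mu>) ^ 2 * poisson \<mu> j" I] poisson_variance_sums[of \<mu>] assms
      by (auto simp: sums_iff poisson_nonneg)
    thus ?thesis using assms by (intro add_mono divide_right_mono mult_left_mono sum_poisson_le) auto
  qed
  also have "\<dots> = sqrt \<mu> * exp \<mu>" using assms by (simp add: field_simps)
  finally show ?thesis .
qed

text \<open>Each value at a residue class is compared with the average over a block of length \<open>d\<close>;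
  the error is the total variation of the Poisson weights.\<close>

lemma sum_poisson_residue_class_le:
  assumes "\<mu> > 0" "d \<ge> 1"
  shows "(\<Sum>j | i < j \<and> j \<le> n \<and> d dvd (j - i). poisson \<mu> j) \<le> exp \<mu> * (1 / real d + 1 / sqrt \<mu>)"
proof -
  define v where "v = (\<lambda>j. \<bar>poisson \<mu> j - poisson \<mu> (j - 1)\<bar>)"
  define I where "I = {j. i < j \<and> j \<le> n \<and> d dvd (j - i)}"
  have finI: "finite I" by (rule finite_subset[of _ "{..n}"]) (auto simp: I_def)
  have jd: "j \<ge> i + d" if "j \<in> I" for j
    using that dvd_imp_le[of d "j - i"] by (auto simp: I_def)
  have tv: "poisson \<mu> j \<le> poisson \<mu> (j - u) + (\<Sum>s<u. v (j - s))" if "u \<le> j" for j u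
    using that
  proof (induction u)
    case (Suc u)
    have "poisson \<mu> (j - u) \<le> poisson \<mu> (j - Suc u) + v (j - u)" by (simp add: v_def)
    thus ?case using Suc by simp
  qed auto
  \<comment> \<open>The blocks \<open>j, j - 1, ..., j - d + 1\<close> are disjoint because the
    \<open>j\<close> are congruent modulo \<open>d\<close>. They stay above \<open>i\<close>, since
    \<open>j \<ge> i + d\<close>, so no subtraction is truncated.\<close>
  have inj: "inj_on (\<lambda>(j, s). j - s) (I \<times> {..<d})"
  proof (rule inj_onI, clarify)
    fix j s j' s' assume a: "j \<in> I" "s < d" "j' \<in> I" "s' < d" "j - s = j' - s'"
    have "d dvd (j - i)" "d dvd (j' - i)" using a by (auto simp: I_def)
    then obtain x y where xy: "j - i = d * x" "j' - i = d * y" by (auto elim!: dvdE)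
    have j: "j = i + d * x" "j' = i + d * y" using xy jd[OF a(1)] jd[OF a(3)] by linarith+
    have xy1: "x \<ge> 1" "y \<ge> 1" using j jd[OF a(1)] jd[OF a(3)] assms(2) by (auto intro: Suc_leI gr0I)
    have eq: "d * x + s' = d * y + s" using a j jd[OF a(1)] jd[OF a(3)] by linarith
    have "x = (d * x + s') div d" using a(4) assms(2) by simp
    also have "\<dots> = y" unfolding eq using a(2) assms(2) by simp
    finally show "j = j' \<and> s = s'" using eq j by simp
  qed
  define K where "K = (\<lambda>(j, s). j - s) ` (I \<times> {..<d})"
  have K: "finite K" "\<And>k. k \<in> K \<Longrightarrow> k \<ge> 1" using finI jd by (fastforce simp: K_def)+
  have sumK: "(\<Sum>j\<in>I. \<Sum>s<d. f (j - s)) = sum f K" for f :: "nat \<Rightarrow> real"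
    unfolding K_def by (subst sum.reindex[OF inj]) (simp add: sum.cartesian_product case_prod_unfold o_def)
  have "real d * (\<Sum>j\<in>I. poisson \<mu> j) = (\<Sum>j\<in>I. \<Sum>u<d. poisson \<mu> j)" by (simp add: sum_distrib_left)
  also have "\<dots> \<le> (\<Sum>j\<in>I. \<Sum>u<d. poisson \<mu> (j - u) + (\<Sum>s<d. v (j - s)))"
  proof (intro sum_mono)
    fix j u assume ju: "j \<in> I" "u \<in> {..<d}"
    have "poisson \<mu> j \<le> poisson \<mu> (j - u) + (\<Sum>s<u. v (j - s))" using ju jd[of j] by (intro tv) auto
    also have "(\<Sum>s<u. v (j - s)) \<le> (\<Sum>s<d. v (j - s))" using ju by (intro sum_mono2) (auto simp: v_def)
    finally show "poisson \<mu> j \<le> poisson \<mu> (j - u) + (\<Sum>s<d. v (j - s))" by simp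
  qed
  also have "\<dots> = sum (poisson \<mu>) K + real d * sum v K"
    by (simp add: sum.distrib sumK flip: sum_distrib_left)
  also have "sum (poisson \<mu>) K \<le> exp \<mu>" using assms K by (intro sum_poisson_le) auto
  \<comment> \<open>Since \<open>poisson \<mu> k - poisson \<mu> (k - 1) = - (k - \<mu>) * poisson
    \<mu> k / \<mu>\<close>, the variation is a mean absolute deviation divided by
    \<open>\<mu>\<close>.\<close>
  also have "sum v K \<le> exp \<mu> / sqrt \<mu>"
  proof -
    have "sum v K = (\<Sum>k\<in>K. \<bar>real k - \<mu>\<bar> * poisson \<mu> k / \<mu>)"
    proof (rule sum.cong[OF refl])
      fix k assume "k \<in> K"
      hence "k = Suc (k - 1)" using K(2)[of k] by simp
      hence "\<mu> * poisson \<mu> (k - 1) = real k * poisson \<mu> k" using poisson_Suc[of "k - 1" \<mu>] by simp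
      hence "poisson \<mu> k - poisson \<mu> (k - 1) = - ((real k - \<mu>) * poisson \<mu> k / \<mu>)"
        using assms by (simp add: field_simps)
      thus "v k = \<bar>real k - \<mu>\<bar> * poisson \<mu> k / \<mu>"
        using assms by (simp add: v_def abs_mult poisson_nonneg)
    qed
    also have "\<dots> \<le> sqrt \<mu> * exp \<mu> / \<mu>"
      unfolding sum_divide_distrib[symmetric] using assms K
      by (intro divide_right_mono sum_poisson_abs_deviation_le) auto
    also have "\<dots> = exp \<mu> / sqrt \<mu>" using assms by (simp add: field_simps)
    finally show ?thesis .
  qed
  finally have "real d * (\<Sum>j\<in>I. poisson \<mu> j) \<le> exp \<mu> + real d * (exp \<mu> / sqrt \<mu>)"
    by (simp add: mult_left_mono)
  hence "(\<Sum>j\<in>I. poisson \<mu> j) \<le> (exp \<mu> + real d * (exp \<mu> / sqrt \<mu>)) / real d"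
    using assms(2) by (simp add: pos_le_divide_eq mult.commute)
  also have "\<dots> = exp \<mu> * (1 / real d + 1 / sqrt \<mu>)" using assms by (simp add: field_simps)
  finally show ?thesis by (simp add: I_def)
qed

section \<open>Divisor sums of the gap of two Poisson variables\<close>

lemma sum_inverse_sqrt_le:
  "(\<Sum>d=1..n. 1 / sqrt (real d)) \<le> 2 * sqrt (real n)"
proof (induction n)
  case (Suc n)
  have "sqrt (real (Suc n)) * sqrt (real n) \<le> (real (Suc n) + real n) / 2"
    using arith_geo_mean_sqrt[of "real (Suc n)" "real n"] by (simp add: real_sqrt_mult)
  hence "1 / sqrt (real (Suc n)) \<le> 2 * sqrt (real (Suc n)) - 2 * sqrt (real n)"
    by (simp add: field_simps)
  thus ?case using Suc by simp
qed auto

lemma sum_inverse_sqrt_cube_le: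
  "(\<Sum>d=1..n. 1 / (real d * sqrt (real d))) \<le> 3"
proof -
  have "n \<ge> 1 \<Longrightarrow> (\<Sum>d=1..n. 1 / (real d * sqrt (real d))) \<le> 3 - 2 / sqrt (real n)"
  proof (induction n rule: dec_induct)
    case (step n)
    define a b where "a = sqrt (real n)" and "b = sqrt (real (Suc n))"
    have ab: "0 < a" "a \<le> b" "b ^ 2 = a ^ 2 + 1" "b ^ 2 = real (Suc n)" using step.hyps by (auto simp: a_def b_def)
    have "a * b * (a + b) \<le> b * b * (b + b)" using ab(1,2) by (intro mult_mono) auto
    hence "2 / (b * b * (b + b)) \<le> 2 / (a * b * (a + b))" using ab(1,2) by (intro divide_left_mono) auto
    moreover have "1 / (b ^ 2 * b) = 2 / (b * b * (b + b))" using ab(1,2) by (simp add: field_simps power2_eq_square)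
    ultimately have "1 / (b ^ 2 * b) \<le> 2 / (a * b * (a + b))" by (simp only:)
    also have "\<dots> = 2 * ((b - a) * (a + b)) / (a * b * (a + b))"
      using ab by (simp add: algebra_simps power2_eq_square)
    also have "\<dots> = 2 * (b - a) / (a * b)"
      using ab(1,2) nonzero_mult_divide_mult_cancel_right[of "a + b" "2 * (b - a)" "a * b"]
      by (simp add: mult.assoc)
    also have "\<dots> = 2 / a - 2 / b" using ab(1,2) by (simp add: field_simps)
    finally show ?case using step ab by (simp add: a_def b_def)
  qed auto
  moreover have "3 - 2 / sqrt (real n) \<le> 3" by simp
  ultimately show ?thesis by (cases "n = 0") (auto intro: order_trans)
qed


text \<open>Divisors \<open>d \<le> \<mu>\<close> of the gap are handled by the bound for residue
  classes; the sum of \<open>(1/d + 1/sqrt \<mu>) / sqrt d\<close> over them is at most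
  \<open>3 + 2\<close>. There are at most \<open>j - i\<close> larger divisors, each of weight at
  most \<open>1 / sqrt \<mu>\<close>, and the mean gap is \<open>O(sqrt \<mu>)\<close>; they
  contribute at most 2.\<close>

lemma sum_poisson_pairs_divisor_sum_le:
  assumes "\<mu> \<ge> 1"
  shows "(\<Sum>i\<le>n. \<Sum>j | i < j \<and> j \<le> n. poisson \<mu> i * poisson \<mu> j * (\<Sum>d | d dvd (j - i). 1 / sqrt (real d)))
         \<le> 7 * exp \<mu> ^ 2"
proof -
  \<comment> \<open>The cutoff at \<open>\<mu>\<close> keeps both parts bounded: the sum of
    \<open>1 / sqrt d\<close> up to it is of order \<open>sqrt \<mu>\<close>, as is the mean
    gap.\<close>
  define D where "D = nat \<lfloor>\<mu>\<rfloor>"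
  have D: "real D \<le> \<mu>" "\<mu> < real D + 1" using assms by (auto simp: D_def)
  have mu: "\<mu> > 0" using assms by simp
  have split: "(\<Sum>d | d dvd h. 1 / sqrt (real d)) \<le> (\<Sum>d=1..D. if d dvd h then 1 / sqrt (real d) else 0) + real h / sqrt \<mu>"
    if h: "h > 0" for h
  proof -
    have fin: "finite {d. d dvd h}" using h by simp
    have "(\<Sum>d | d dvd h. 1 / sqrt (real d))
        = (\<Sum>d\<in>{d. d dvd h} \<inter> {..D}. 1 / sqrt (real d)) + (\<Sum>d\<in>{d. d dvd h} - {..D}. 1 / sqrt (real d))"
      using fin by (rule sum.Int_Diff)
    also have "(\<Sum>d\<in>{d. d dvd h} \<inter> {..D}. 1 / sqrt (real d)) = (\<Sum>d=1..D. if d dvd h then 1 / sqrt (real d) else 0)"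
      using h by (subst sum.inter_filter [symmetric]) (auto intro!: sum.cong Suc_leI gr0I)
    also have "(\<Sum>d\<in>{d. d dvd h} - {..D}. 1 / sqrt (real d)) \<le> (\<Sum>d\<in>{d. d dvd h} - {..D}. 1 / sqrt \<mu>)"
      using D mu by (intro sum_mono divide_left_mono) auto
    also have "\<dots> \<le> real h / sqrt \<mu>"
    proof -
      have "card ({d. d dvd h} - {..D}) \<le> card {1..h}"
        using h by (intro card_mono) (auto intro: dvd_imp_le Suc_leI gr0I)
      thus ?thesis using mu by (simp add: divide_right_mono)
    qed
    finally show ?thesis by simp
  qed
  define p where "p = poisson \<mu>"
  have p0: "p j \<ge> 0" for j using mu by (simp add: p_def poisson_nonneg)
  have sp: "(\<Sum>i\<le>n. p i) \<le> exp \<mu>" unfolding p_def using mu by (intro sum_poisson_le) auto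
  have fin: "finite {j. i < j \<and> j \<le> n}" for i by (rule finite_subset[of _ "{..n}"]) auto
  have "(\<Sum>i\<le>n. \<Sum>j | i < j \<and> j \<le> n. p i * p j * (\<Sum>d | d dvd (j - i). 1 / sqrt (real d)))
      \<le> (\<Sum>i\<le>n. \<Sum>j | i < j \<and> j \<le> n. p i * p j * ((\<Sum>d=1..D. if d dvd (j - i) then 1 / sqrt (real d) else 0)
           + real (j - i) / sqrt \<mu>))"
    using p0 by (intro sum_mono mult_left_mono split) auto
  also have "\<dots> = (\<Sum>i\<le>n. \<Sum>j | i < j \<and> j \<le> n. p i * p j * (\<Sum>d=1..D. if d dvd (j - i) then 1 / sqrt (real d) else 0))
      + (\<Sum>i\<le>n. \<Sum>j | i < j \<and> j \<le> n. p i * p j * (real (j - i) / sqrt \<mu>))"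
    by (simp add: distrib_left sum.distrib)
  also have "(\<Sum>i\<le>n. \<Sum>j | i < j \<and> j \<le> n. p i * p j * (\<Sum>d=1..D. if d dvd (j - i) then 1 / sqrt (real d) else 0))
      \<le> 5 * exp \<mu> ^ 2"
  proof -
    have "(\<Sum>i\<le>n. \<Sum>j | i < j \<and> j \<le> n. p i * p j * (\<Sum>d=1..D. if d dvd (j - i) then 1 / sqrt (real d) else 0))
        = (\<Sum>i\<le>n. p i * (\<Sum>d=1..D. 1 / sqrt (real d) * (\<Sum>j | i < j \<and> j \<le> n \<and> d dvd (j - i). p j)))"
    proof (intro sum.cong refl)
      fix i
      have "(\<Sum>j | i < j \<and> j \<le> n. p i * p j * (\<Sum>d=1..D. if d dvd (j - i) then 1 / sqrt (real d) else 0))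
          = (\<Sum>j | i < j \<and> j \<le> n. \<Sum>d=1..D. if d dvd (j - i) then p i * (1 / sqrt (real d) * p j) else 0)"
        by (simp add: sum_distrib_left if_distrib mult_ac cong: if_cong)
      also have "\<dots> = (\<Sum>d=1..D. \<Sum>j | i < j \<and> j \<le> n. if d dvd (j - i) then p i * (1 / sqrt (real d) * p j) else 0)"
        by (rule sum.swap)
      also have "\<dots> = (\<Sum>d=1..D. \<Sum>j | i < j \<and> j \<le> n \<and> d dvd (j - i). p i * (1 / sqrt (real d) * p j))"
        using fin[of i] by (subst sum.inter_filter [symmetric]) (auto intro!: sum.cong)
      finally show "(\<Sum>j | i < j \<and> j \<le> n. p i * p j * (\<Sum>d=1..D. if d dvd (j - i) then 1 / sqrt (real d) else 0))
          = p i * (\<Sum>d=1..D. 1 / sqrt (real d) * (\<Sum>j | i < j \<and> j \<le> n \<and> d dvd (j - i). p j))"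
        by (simp add: sum_distrib_left)
    qed
    also have "\<dots> \<le> (\<Sum>i\<le>n. p i * (\<Sum>d=1..D. 1 / sqrt (real d) * (exp \<mu> * (1 / real d + 1 / sqrt \<mu>))))"
      unfolding p_def using p0 mu
      by (intro sum_mono mult_left_mono sum_poisson_residue_class_le) (auto simp: p_def)
    also have "\<dots> = (\<Sum>i\<le>n. p i) * (exp \<mu> * ((\<Sum>d=1..D. 1 / (real d * sqrt (real d))) + (\<Sum>d=1..D. 1 / sqrt (real d)) / sqrt \<mu>))"
      unfolding sum_distrib_right by (simp add: sum_distrib_left sum_divide_distrib algebra_simps flip: sum.distrib)
    also have "\<dots> \<le> exp \<mu> * (exp \<mu> * (3 + 2 * sqrt (real D) / sqrt \<mu>))"
      using mu by (intro mult_mono sp mult_left_mono add_mono divide_right_mono sum_inverse_sqrt_cube_le sum_inverse_sqrt_le)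
         (auto intro!: mult_nonneg_nonneg add_nonneg_nonneg divide_nonneg_nonneg sum_nonneg)
    also have "\<dots> \<le> exp \<mu> * (exp \<mu> * (3 + 2))"
      using D mu by (intro mult_left_mono add_mono) (auto simp: divide_le_eq)
    finally show ?thesis by (simp add: power2_eq_square)
  qed
  also have "(\<Sum>i\<le>n. \<Sum>j | i < j \<and> j \<le> n. p i * p j * (real (j - i) / sqrt \<mu>)) \<le> 2 * exp \<mu> ^ 2"
  proof -
    define q where "q = (\<lambda>j. \<bar>real j - \<mu>\<bar> * p j)"
    have q0: "q j \<ge> 0" for j using p0 by (simp add: q_def)
    have sq: "(\<Sum>i\<le>n. q i) \<le> sqrt \<mu> * exp \<mu>"
      unfolding q_def p_def using mu by (intro sum_poisson_abs_deviation_le) auto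
    have "(\<Sum>i\<le>n. \<Sum>j | i < j \<and> j \<le> n. p i * p j * (real (j - i) / sqrt \<mu>))
        \<le> (\<Sum>i\<le>n. \<Sum>j | i < j \<and> j \<le> n. (p i * q j + q i * p j) / sqrt \<mu>)"
    proof (intro sum_mono)
      fix i j assume "j \<in> {j. i < j \<and> j \<le> n}"
      hence "real (j - i) \<le> \<bar>real j - \<mu>\<bar> + \<bar>real i - \<mu>\<bar>" by auto
      hence "p i * p j * real (j - i) / sqrt \<mu> \<le> p i * p j * (\<bar>real j - \<mu>\<bar> + \<bar>real i - \<mu>\<bar>) / sqrt \<mu>"
        using mu p0 by (intro divide_right_mono mult_left_mono) auto
      thus "p i * p j * (real (j - i) / sqrt \<mu>) \<le> (p i * q j + q i * p j) / sqrt \<mu>"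
        by (simp add: q_def algebra_simps)
    qed
    also have "\<dots> \<le> (\<Sum>i\<le>n. \<Sum>j\<le>n. (p i * q j + q i * p j) / sqrt \<mu>)"
      using p0 q0 mu by (intro sum_mono sum_mono2) (auto intro!: divide_nonneg_nonneg add_nonneg_nonneg mult_nonneg_nonneg)
    also have "\<dots> = 2 * ((\<Sum>i\<le>n. p i) * (\<Sum>i\<le>n. q i)) / sqrt \<mu>"
    proof -
      have "(\<Sum>i\<le>n. \<Sum>j\<le>n. p i * q j) = (\<Sum>i\<le>n. p i) * (\<Sum>i\<le>n. q i)"
        "(\<Sum>i\<le>n. \<Sum>j\<le>n. q i * p j) = (\<Sum>i\<le>n. q i) * (\<Sum>i\<le>n. p i)"
        by (simp_all add: sum_product)
      thus ?thesis by (simp add: sum.distrib flip: sum_divide_distrib)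
    qed
    also have "\<dots> \<le> 2 * (exp \<mu> * (sqrt \<mu> * exp \<mu>)) / sqrt \<mu>"
      using mu q0 by (intro divide_right_mono mult_left_mono mult_mono sp sq) (auto intro: sum_nonneg)
    also have "\<dots> = 2 * exp \<mu> ^ 2" using mu by (simp add: power2_eq_square)
    finally show ?thesis .
  qed
  finally show ?thesis by (simp add: p_def)
qed

section \<open>Sifting a pair of multiples\<close>

text \<open>An elementary symmetric sum: in the \<open>j\<close>-th power of the total weight, every
  \<open>j\<close>-element set occurs \<open>fact j\<close> times. This is how the number of prime
  factors comes to be dominated by a Poisson variable.\<close>

lemma sum_prod_card_eq_le_poisson:
  fixes w :: "'a \<Rightarrow> real"
  assumes "finite P" "\<And>p. p \<in> P \<Longrightarrow> w p \<ge> 0"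
  shows "(\<Sum>A | A \<subseteq> P \<and> card A = j. prod w A) \<le> poisson (sum w P) j"
  using assms
proof (induction P arbitrary: j rule: finite_induct)
  case empty
  have eq: "{A. A \<subseteq> {} \<and> card A = j} = (if j = 0 then {{}} else {})" by auto
  have "(\<Sum>A | A \<subseteq> {} \<and> card A = j. prod w A) = (if j = 0 then 1 else 0)"
    unfolding eq by simp
  thus ?case by (simp add: poisson_def)
next
  case (insert x P j)
  have nn: "sum w P \<ge> 0" "w x \<ge> 0" using insert.prems by (auto intro!: sum_nonneg)
  show ?case
  proof (cases j)
    case 0
    have "{A. A \<subseteq> insert x P \<and> card A = j} = {{}}"
      using 0 insert.hyps finite_subset[of _ "insert x P"] by auto
    thus ?thesis using 0 by (simp add: poisson_def)
  next
    case (Suc i)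
    have fin: "finite A" if "A \<subseteq> P" for A using that insert.hyps finite_subset by auto
    have "{A. A \<subseteq> insert x P \<and> card A = j} = {A. A \<subseteq> P \<and> card A = j} \<union> insert x ` {A. A \<subseteq> P \<and> card A = i}"
      (is "?L = ?R")
    proof (intro equalityI subsetI)
      fix A assume A: "A \<in> ?L"
      show "A \<in> ?R"
      proof (cases "x \<in> A")
        case True
        hence "A = insert x (A - {x})" "A - {x} \<subseteq> P" using A by auto
        moreover have "card (A - {x}) = i" using A True Suc by simp
        ultimately show ?thesis by blast
      qed (use A in auto)
    next
      fix A assume "A \<in> ?R"
      thus "A \<in> ?L" using insert.hyps Suc fin by (auto simp: card_insert_if)
    qed
    moreover have "(\<Sum>A\<in>{A. A \<subseteq> P \<and> card A = j} \<union> insert x ` {A. A \<subseteq> P \<and> card A = i}. prod w A)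
        = (\<Sum>A | A \<subseteq> P \<and> card A = j. prod w A) + (\<Sum>A\<in>insert x ` {A. A \<subseteq> P \<and> card A = i}. prod w A)"
      using insert.hyps by (intro sum.union_disjoint) auto
    moreover have "(\<Sum>A\<in>insert x ` {A. A \<subseteq> P \<and> card A = i}. prod w A) = (\<Sum>A | A \<subseteq> P \<and> card A = i. w x * prod w A)"
    proof (subst sum.reindex)
      show "inj_on (insert x) {A. A \<subseteq> P \<and> card A = i}"
        using insert.hyps by (intro inj_onI) (metis (no_types, lifting) insert_ident mem_Collect_eq subsetD)
      show "sum (prod w \<circ> insert x) {A. A \<subseteq> P \<and> card A = i} = (\<Sum>A | A \<subseteq> P \<and> card A = i. w x * prod w A)"
      proof (intro sum.cong refl)
        fix A assume "A \<in> {A. A \<subseteq> P \<and> card A = i}"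
        hence "finite A" "x \<notin> A" using insert.hyps fin by auto
        thus "(prod w \<circ> insert x) A = w x * prod w A" by simp
      qed
    qed
    ultimately have "(\<Sum>A | A \<subseteq> insert x P \<and> card A = j. prod w A)
        = (\<Sum>A | A \<subseteq> P \<and> card A = j. prod w A) + w x * (\<Sum>A | A \<subseteq> P \<and> card A = i. prod w A)"
      by (simp add: sum_distrib_left)
    also have "\<dots> \<le> poisson (sum w P) j + w x * poisson (sum w P) i"
      using insert.IH insert.prems nn by (intro add_mono mult_left_mono) auto
    \<comment> \<open>The left side consists of the first two terms of the binomial expansion of
      \<open>(w x + s) ^ j\<close>, divided by \<open>fact j\<close>.\<close>
    also have "\<dots> \<le> poisson (w x + sum w P) j"
    proof -
      define s where "s = sum w P"
      have "s ^ Suc i + real (Suc i) * w x * s ^ i \<le> (w x + s) ^ Suc i"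
      proof -
        have ind: "s ^ Suc i + real (Suc i) * w x * s ^ i \<le> (w x + s) ^ Suc i" if "s \<ge> 0" for i
        proof (induction i)
          case (Suc i)
          have "(w x + s) * (s ^ Suc i + real (Suc i) * w x * s ^ i) \<le> (w x + s) * (w x + s) ^ Suc i"
            using Suc nn that by (intro mult_left_mono) auto
          moreover have "(w x + s) * (s ^ Suc i + real (Suc i) * w x * s ^ i)
              = s ^ Suc (Suc i) + real (Suc (Suc i)) * w x * s ^ Suc i + real (Suc i) * (w x * w x) * s ^ i"
            by (simp add: algebra_simps)
          moreover have "0 \<le> real (Suc i) * (w x * w x) * s ^ i" using that by simp
          ultimately show ?case by simp
        qed simp
        show ?thesis using nn by (intro ind) (simp add: s_def)
      qed
      hence "(s ^ Suc i + real (Suc i) * w x * s ^ i) / fact (Suc i) \<le> (w x + s) ^ Suc i / fact (Suc i)"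
        by (intro divide_right_mono) auto
      moreover have "real (Suc i) * w x * s ^ i / fact (Suc i) = w x * (s ^ i / fact i)"
        unfolding fact_Suc of_nat_mult by (simp del: of_nat_Suc)
      ultimately show ?thesis by (simp add: poisson_def Suc s_def add_divide_distrib)
    qed
    finally show ?thesis using insert.hyps by simp
  qed
qed

text \<open>After clearing denominators the claim is \<open>(x - 2) * (4 x - 3) \<ge> 0\<close>; the
  constant 6 is attained at \<open>p = 2\<close>.\<close>

lemma euler_sq_le: "prime p \<Longrightarrow> euler_sq p \<le> 1 + 6 / real p"
proof -
  assume p: "prime p"
  define x where "x = real p"
  have x: "x \<ge> 2" using prime_ge_2_nat[OF p] by (simp add: x_def)
  have "0 \<le> (x - 2) * (4 * x - 3)" using x by (intro mult_nonneg_nonneg) auto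
  hence "x * x ^ 2 \<le> (x + 6) * (x - 1) ^ 2" using x by (simp add: algebra_simps power2_eq_square)
  hence "x * x ^ 2 / (x * (x - 1) ^ 2) \<le> (x + 6) * (x - 1) ^ 2 / (x * (x - 1) ^ 2)"
    using x by (intro divide_right_mono) auto
  moreover have "x * x ^ 2 / (x * (x - 1) ^ 2) = (x / (x - 1)) ^ 2" using x by (simp add: power_divide)
  moreover have "(x + 6) * (x - 1) ^ 2 / (x * (x - 1) ^ 2) = 1 + 6 / x" using x by (simp add: add_divide_distrib)
  ultimately show ?thesis by (simp add: euler_sq_def x_def)
qed

text \<open>The local factor is at most \<open>1 + 22/p\<close>, and
  \<open>22/p \<le> 1 / sqrt p\<close> as soon as \<open>p \<ge> 484 = 22^2\<close>. Each smaller
  prime costs at most a factor 23, which goes into \<open>C\<close>. The product of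
  \<open>1 + 1 / sqrt p\<close> then expands into a sum over squarefree divisors. The factor
  \<open>1 + euler_sq p / p\<close> will come from summing over the gcd of a pair.\<close>

lemma prod_local_factor_le_divisor_sum:
  "\<exists>C>0. \<forall>h>0. (\<Prod>p\<in>prime_factors h. euler_sq p * (1 + euler_sq p / real p))
     \<le> C * (\<Sum>d | d dvd h. 1 / sqrt (real d))"
proof -
  define C where "C = (23::real) ^ card {..<484::nat}"
  have C0: "C > 0" unfolding C_def by (rule zero_less_power) simp
  have fac: "euler_sq p * (1 + euler_sq p / real p) \<le> (if p < 484 then 23 else 1) * (1 + 1 / sqrt (real p))"
    if p: "prime p" for p
  proof -
    define u where "u = 1 / real p"
    have u: "0 < u" "u \<le> 1/2" using prime_ge_2_nat[OF p] by (auto simp: u_def field_simps)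
    have e: "euler_sq p \<le> 1 + 6 * u" "euler_sq p \<ge> 1" using euler_sq_le[OF p] euler_sq_ge_1[OF p] by (auto simp: u_def)
    have "euler_sq p * (1 + euler_sq p / real p) = euler_sq p * (1 + euler_sq p * u)" by (simp add: u_def)
    also have "\<dots> \<le> (1 + 6 * u) * (1 + (1 + 6 * u) * u)" using e u by (intro mult_mono add_mono) auto
    also have "\<dots> = 1 + u * (7 + 12 * u + 36 * (u * u))" by (simp add: algebra_simps)
    also have "\<dots> \<le> 1 + u * (7 + 12 * (1/2) + 36 * (1/2 * (1/2)))"
      using u by (intro add_mono mult_left_mono mult_mono) auto
    finally have le: "euler_sq p * (1 + euler_sq p / real p) \<le> 1 + 22 * u" by simp
    show ?thesis
    proof (cases "p < 484")
      case True
      have "1 + 22 * u \<le> 23 * (1 + 0)" using u by simp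
      also have "\<dots> \<le> 23 * (1 + 1 / sqrt (real p))" by (intro mult_left_mono add_mono) auto
      finally show ?thesis using le True by simp
    next
      case False
      hence "sqrt 484 \<le> sqrt (real p)" by (intro real_sqrt_le_mono) auto
      moreover have "sqrt 484 = (22::real)" by (rule real_sqrt_unique) auto
      ultimately have s: "22 \<le> sqrt (real p)" by simp
      have "22 * u \<le> sqrt (real p) * u" using s u by (intro mult_right_mono) auto
      also have "sqrt (real p) * u = 1 / sqrt (real p)" by (simp add: u_def real_div_sqrt divide_simps)
      finally show ?thesis using le False by simp
    qed
  qed
  show ?thesis
  proof (intro exI[of _ C] conjI allI impI)
    fix h :: nat assume h: "h > 0"
    have "(\<Prod>p\<in>prime_factors h. euler_sq p * (1 + euler_sq p / real p))
        \<le> (\<Prod>p\<in>prime_factors h. (if p < 484 then 23 else 1) * (1 + 1 / sqrt (real p)))"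
      by (intro prod_mono conjI fac) (auto simp: euler_sq_def)
    also have "\<dots> = (\<Prod>p\<in>prime_factors h. if p < 484 then 23 else 1) * (\<Prod>p\<in>prime_factors h. 1 + 1 / sqrt (real p))"
      by (rule prod.distrib)
    also have "\<dots> \<le> C * (\<Sum>d | d dvd h. 1 / sqrt (real d))"
    proof (intro mult_mono)
      have "(\<Prod>p\<in>prime_factors h. if p < 484 then 23 else 1 :: real) = 23 ^ card {p \<in> prime_factors h. p < 484}"
        by (simp add: prod.If_cases Int_def)
      also have "\<dots> \<le> C" unfolding C_def by (intro power_increasing card_mono) auto
      finally show "(\<Prod>p\<in>prime_factors h. if p < 484 then 23 else 1 :: real) \<le> C" .
      have "(\<Prod>p\<in>prime_factors h. 1 + 1 / sqrt (real p)) = (\<Sum>X\<in>Pow (prime_factors h). \<Prod>p\<in>X. 1 / sqrt (real p))"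
        by (rule prod_one_plus_Pow) simp
      also have "\<dots> = (\<Sum>X\<in>Pow (prime_factors h). 1 / sqrt (real (\<Prod>X)))"
      proof (intro sum.cong refl)
        fix X assume "X \<in> Pow (prime_factors h)"
        hence "finite X" using finite_subset by blast
        hence "sqrt (\<Prod>p\<in>X. real p) = (\<Prod>p\<in>X. sqrt (real p))" by induction (auto simp: real_sqrt_mult)
        thus "(\<Prod>p\<in>X. 1 / sqrt (real p)) = 1 / sqrt (real (\<Prod>X))" by (simp add: prod_dividef)
      qed
      also have "\<dots> = (\<Sum>d\<in>(\<lambda>X. \<Prod>X) ` Pow (prime_factors h). 1 / sqrt (real d))"
        by (subst sum.reindex) (auto intro!: inj_on_Prod_primes dest: finite_subset)
      also have "\<dots> \<le> (\<Sum>d | d dvd h. 1 / sqrt (real d))"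
      proof (rule sum_mono2)
        show "finite {d. d dvd h}" using h by simp
        show "0 \<le> 1 / sqrt (real b)" for b by simp
        show "(\<lambda>X. \<Prod>X) ` Pow (prime_factors h) \<subseteq> {d. d dvd h}"
        proof (rule image_subsetI)
        fix X assume X: "X \<in> Pow (prime_factors h)"
        hence "finite X" using finite_subset by blast
        thus "\<Prod>X \<in> {d. d dvd h}" using X by (auto simp: Prod_primes_dvd_iff in_prime_factors_iff subset_iff)
        qed
      qed
      finally show "(\<Prod>p\<in>prime_factors h. 1 + 1 / sqrt (real p)) \<le> (\<Sum>d | d dvd h. 1 / sqrt (real d))" .
    qed (use C0 in \<open>auto intro!: prod_nonneg\<close>)
    finally show "(\<Prod>p\<in>prime_factors h. euler_sq p * (1 + euler_sq p / real p)) \<le> C * (\<Sum>d | d dvd h. 1 / sqrt (real d))" .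
  qed (rule C0)
qed

text \<open>The prime 2 is not sifted, since its sieve density \<open>2/2\<close> is not less than 1.\<close>

lemma sifted_pair_count_le:
  fixes h q N :: nat and A B :: "nat set"
  assumes q: "q \<ge> 2" and h: "h > 0"
    and A: "finite A" "\<forall>p\<in>A. prime p" and B: "finite B" "\<forall>p\<in>B. prime p"
  defines "Q \<equiv> {2} \<union> A \<union> B \<union> prime_factors h"
  shows "real (card {k. k < N \<and> (\<forall>r\<in>A. r dvd k) \<and> (\<forall>r\<in>B. [k = h] (mod r)) \<and>
            (\<forall>r\<in>primes_le (q * q) - Q. \<not> (r dvd k \<or> [k = h] (mod r)))})
         \<le> real N / real (\<Prod>(A \<union> B)) * (prod euler_sq Q / ln (real q) ^ 2) + real (q ^ 8)"
proof -
  define l where "l = \<Prod>(A \<union> B)"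
  \<comment> \<open>In the application \<open>k = m p\<close> and \<open>k - h = m' p'\<close>,
    where \<open>A\<close> and \<open>B\<close> are the prime factors of \<open>m\<close> and
    \<open>m'\<close>. The conditions in \<open>T\<close> are the forced divisibilities; a prime of
    \<open>P\<close> must divide neither number.\<close>
  define T where "T = {k. (\<forall>r\<in>A. r dvd k) \<and> (\<forall>r\<in>B. [k = h] (mod r))}"
  define bad where "bad = (\<lambda>r k. r dvd k \<or> [k = h] (mod r))"
  define P where "P = primes_le (q * q) - Q"
  define D where "D = {A. A \<in> sqfree_sets (q * q) \<and> A \<inter> Q = {}}"
  have Q: "finite Q" "\<forall>p\<in>Q. prime p" "2 \<in> Q" using A B by (auto simp: Q_def in_prime_factors_iff)
  have l: "l > 0" unfolding l_def using A B by (intro Prod_primes_pos) auto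
  have lnq: "ln (real q) > 0" using q by simp
  have mod_dvd: "r dvd k + r \<longleftrightarrow> r dvd k" "[k + r = h] (mod r) \<longleftrightarrow> [k = h] (mod r)" for r k :: nat
    by (simp_all add: cong_def)
  have P: "finite P" "\<And>p. p \<in> P \<Longrightarrow> prime p \<and> p \<ge> 3 \<and> p \<le> q * q \<and> p \<notin> A \<and> p \<notin> B \<and> \<not> p dvd h"
  proof -
    fix p assume "p \<in> P"
    hence p: "prime p" "p \<le> q * q" "p \<notin> Q" by (auto simp: P_def primes_le_def)
    moreover have "p \<noteq> 2" using p by (auto simp: Q_def)
    moreover have "\<not> p dvd h" using p h by (auto simp: Q_def in_prime_factors_iff)
    ultimately show "prime p \<and> p \<ge> 3 \<and> p \<le> q * q \<and> p \<notin> A \<and> p \<notin> B \<and> \<not> p dvd h"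
      using prime_ge_2_nat[of p] by (auto simp: Q_def)
  qed (simp add: P_def)
  \<comment> \<open>The forced conditions define one residue class modulo \<open>l\<close>, or none,
    as when some prime of \<open>A \<inter> B\<close> does not divide \<open>h\<close>.\<close>
  obtain c where c: "periodic_set T l c" "c \<le> 1"
  proof -
    define S where "S = (\<lambda>r::nat. {k. (r \<in> A \<longrightarrow> r dvd k) \<and> (r \<in> B \<longrightarrow> [k = h] (mod r))})"
    define cc where "cc = (\<lambda>r. card {k\<in>S r. k < r})"
    have per: "periodic_set (S r) r (cc r)" if "r \<in> A \<union> B" for r
      using that A B prime_gt_0_nat[of r] by (auto simp: periodic_set_def S_def cc_def mod_dvd)
    have cc: "cc r \<le> 1" if "r \<in> A \<union> B" for r
    proof -
      have "{k\<in>S r. k < r} \<subseteq> {0} \<or> {k\<in>S r. k < r} \<subseteq> {h mod r}"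
        using that by (auto simp: S_def cong_def dest: dvd_imp_le)
      hence "card {k\<in>S r. k < r} \<le> card {0::nat} \<or> card {k\<in>S r. k < r} \<le> card {h mod r}"
        by (meson card_mono finite.emptyI finite.insertI)
      thus ?thesis by (simp add: cc_def)
    qed
    have "periodic_set {k\<in>UNIV. \<forall>i\<in>A \<union> B. k \<in> S i} (1 * (\<Prod>i\<in>A \<union> B. i)) (1 * (\<Prod>i\<in>A \<union> B. cc i))"
      using A B per by (intro periodic_set_INT) (auto simp: primes_coprime periodic_set_def)
    moreover have "{k\<in>UNIV. \<forall>i\<in>A \<union> B. k \<in> S i} = T" by (auto simp: S_def T_def)
    ultimately have "periodic_set T l (\<Prod>i\<in>A \<union> B. cc i)" by (simp add: l_def)
    moreover have "(\<Prod>i\<in>A \<union> B. cc i) \<le> 1" using cc prod_mono[of "A \<union> B" cc "\<lambda>_. 1"] by simp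
    ultimately show ?thesis using that by blast
  qed
  \<comment> \<open>The two forbidden classes 0 and \<open>h\<close> are distinct because
    \<open>r\<close> does not divide \<open>h\<close>; this gives the sieve density
    \<open>2/r\<close>.\<close>
  have bad_per: "periodic_set {k. bad r k} r 2" if r: "r \<in> P" for r
  proof -
    note r = P(2)[OF r]
    have "{k\<in>{k. bad r k}. k < r} = {0, h mod r}"
      using r prime_gt_0_nat[of r] by (auto simp: bad_def cong_def dest: dvd_imp_le)
    moreover have "h mod r \<noteq> 0" using r by (simp add: dvd_eq_mod_eq_0)
    ultimately have "card {k\<in>{k. bad r k}. k < r} = 2" by simp
    thus ?thesis using r by (auto simp: periodic_set_def bad_def mod_dvd)
  qed
  have count: "\<bar>real (card {t\<in>{k\<in>T. k < N}. \<forall>p\<in>C. bad p t}) - real N * real c / real l * (\<Prod>r\<in>C. 2 / real r)\<bar>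
      \<le> 2 ^ card C" if C: "C \<subseteq> P" for C
  proof -
    have finC: "finite C" using C P(1) finite_subset by blast
    have "periodic_set {k\<in>T. \<forall>i\<in>C. k \<in> {k. bad i k}} (l * (\<Prod>i\<in>C. i)) (c * (\<Prod>i\<in>C. 2))"
    proof (intro periodic_set_INT finC bad_per c)
      fix i assume i: "i \<in> C"
      show "coprime l i"
        unfolding l_def using C i P(2)[of i] A B by (intro prod_coprime_left primes_coprime) auto
      fix j assume "j \<in> C" "i \<noteq> j"
      thus "coprime i j" using C i P(2)[of i] P(2)[of j] by (intro primes_coprime) auto
    qed (use C in auto)
    from periodic_set_count[OF this, of N]
    have "\<bar>real (card {k\<in>{k\<in>T. \<forall>i\<in>C. k \<in> {k. bad i k}}. k < N}) - real N * real (c * 2 ^ card C) / real (l * \<Prod>C)\<bar>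
      \<le> real (c * 2 ^ card C)" by simp
    also have "{k\<in>{k\<in>T. \<forall>i\<in>C. k \<in> {k. bad i k}}. k < N} = {t\<in>{k\<in>T. k < N}. \<forall>p\<in>C. bad p t}" by auto
    also have "real N * real (c * 2 ^ card C) / real (l * \<Prod>C) = real N * real c / real l * (\<Prod>r\<in>C. 2 / real r)"
      by (simp add: prod_dividef)
    also have "real (c * 2 ^ card C) \<le> 2 ^ card C" using c(2) by simp
    finally show ?thesis .
  qed
  define J where "J = (\<Sum>A\<in>D. \<Prod>p\<in>A. 2 / real p / (1 - 2 / real p))"
  define err where "err = (\<lambda>C :: nat set. 2 ^ card C :: real)"
  have DP: "C \<subseteq> P" if "C \<in> D" for C
    using that by (auto simp: D_def P_def dest: sqfree_setsD)
  have "real (card {t\<in>{k\<in>T. k < N}. \<forall>p\<in>P. \<not> bad p t})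
      \<le> real N * real c / real l / J + (\<Sum>A\<in>D. \<Sum>B\<in>D. err (A \<union> B) / ((\<Prod>r\<in>A. 2 / real r) * (\<Prod>r\<in>B. 2 / real r)))"
    unfolding J_def
  proof (rule selberg_sieve)
    show "0 < 2 / real p" "2 / real p < 1" if "p \<in> P" for p using P(2)[OF that] by auto
    show "{} \<in> D" using q by (auto simp: D_def sqfree_sets_def)
    show "F \<in> D" if "C \<in> D" "F \<subseteq> C" for C F
    proof -
      have "\<Prod>F \<le> \<Prod>C" using that sqfree_setsD[of C "q * q"]
        by (intro dvd_imp_le prod_dvd_prod_subset) (auto simp: D_def)
      thus ?thesis using that by (auto simp: D_def sqfree_sets_def)
    qed
  qed (use P count DP in \<open>auto simp: err_def\<close>)
  also have "real N * real c / real l / J \<le> real N / real l * (prod euler_sq Q / ln (real q) ^ 2)"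
  proof -
    have "ln (real q) ^ 2 \<le> prod euler_sq Q * J"
      unfolding J_def D_def using q by (intro ln_sq_le_selberg_sum Q) auto
    moreover have Q1: "prod euler_sq Q \<ge> 1" using Q euler_sq_ge_1 by (intro prod_ge_1) auto
    moreover have "ln (real q) ^ 2 > 0" using lnq by simp
    ultimately have J: "J > 0" "1 / J \<le> prod euler_sq Q / ln (real q) ^ 2"
    proof -
      assume a: "ln (real q) ^ 2 \<le> prod euler_sq Q * J" "prod euler_sq Q \<ge> 1" "ln (real q) ^ 2 > 0"
      hence "0 < prod euler_sq Q * J" by linarith
      thus J: "J > 0" using a(2) by (simp add: zero_less_mult_iff)
      show "1 / J \<le> prod euler_sq Q / ln (real q) ^ 2" using a J by (simp add: divide_simps mult.commute)
    qed
    have "real N * real c / real l / J = real N / real l * (real c * (1 / J))" by simp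
    also have "\<dots> \<le> real N / real l * (1 * (prod euler_sq Q / ln (real q) ^ 2))"
      using c J by (intro mult_left_mono mult_mono) auto
    finally show ?thesis by simp
  qed
  \<comment> \<open>The powers of 2 in \<open>err\<close> are absorbed by the numerators of
    \<open>2/r\<close>, which leaves the square of a sum of at most \<open>q^2\<close> numbers, each
    at most \<open>q^2\<close>.\<close>
  also have "(\<Sum>A\<in>D. \<Sum>B\<in>D. err (A \<union> B) / ((\<Prod>r\<in>A. 2 / real r) * (\<Prod>r\<in>B. 2 / real r))) \<le> real (q ^ 8)"
  proof -
    have "(\<Sum>A\<in>D. \<Sum>B\<in>D. err (A \<union> B) / ((\<Prod>r\<in>A. 2 / real r) * (\<Prod>r\<in>B. 2 / real r)))
        \<le> (\<Sum>A\<in>D. \<Sum>B\<in>D. real (\<Prod>A) * real (\<Prod>B))"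
    proof (intro sum_mono)
      fix A B assume AB: "A \<in> D" "B \<in> D"
      have "card (A \<union> B) \<le> card A + card B" by (rule card_Un_le)
      hence "err (A \<union> B) \<le> 2 ^ card A * 2 ^ card B" unfolding err_def power_add [symmetric]
        by (intro power_increasing) auto
      hence "err (A \<union> B) / ((\<Prod>r\<in>A. 2 / real r) * (\<Prod>r\<in>B. 2 / real r))
          \<le> 2 ^ card A * 2 ^ card B / ((\<Prod>r\<in>A. 2 / real r) * (\<Prod>r\<in>B. 2 / real r))"
        by (intro divide_right_mono mult_nonneg_nonneg prod_nonneg) auto
      thus "err (A \<union> B) / ((\<Prod>r\<in>A. 2 / real r) * (\<Prod>r\<in>B. 2 / real r)) \<le> real (\<Prod>A) * real (\<Prod>B)"
        by (simp add: prod_dividef)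
    qed
    also have "\<dots> = (\<Sum>A\<in>D. real (\<Prod>A)) ^ 2" by (simp add: power2_eq_square sum_product)
    also have "\<dots> \<le> (real (q * q) * real (q * q)) ^ 2"
    proof (rule power_mono)
      have "(\<Sum>A\<in>D. real (\<Prod>A)) = (\<Sum>k\<in>(\<lambda>A. \<Prod>A) ` D. real k)"
        by (subst sum.reindex) (auto intro!: inj_on_Prod_primes simp: D_def dest: sqfree_setsD)
      also have "\<dots> \<le> (\<Sum>k\<in>{1..q * q}. real (q * q))"
      proof (rule order_trans[OF sum_mono2])
        show "(\<lambda>A. \<Prod>A) ` D \<subseteq> {1..q * q}"
          using sqfree_setsD(3,4)[of _ "q * q"] by (auto simp: D_def Suc_le_eq)
        show "(\<Sum>k\<in>{1..q * q}. real k) \<le> (\<Sum>k\<in>{1..q * q}. real (q * q))"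
          by (intro sum_mono) (simp only: of_nat_le_iff atLeastAtMost_iff)
      qed auto
      finally show "(\<Sum>A\<in>D. real (\<Prod>A)) \<le> real (q * q) * real (q * q)" by simp
    qed (intro sum_nonneg of_nat_0_le_iff)
    also have "\<dots> = real (q ^ 8)" by (simp add: power_numeral_reduce)
    finally show ?thesis .
  qed
  finally have "real (card {t\<in>{k\<in>T. k < N}. \<forall>p\<in>P. \<not> bad p t})
      \<le> real N / real l * (prod euler_sq Q / ln (real q) ^ 2) + real (q ^ 8)" by simp
  also have "{t\<in>{k\<in>T. k < N}. \<forall>p\<in>P. \<not> bad p t} = {k. k < N \<and> (\<forall>r\<in>A. r dvd k) \<and> (\<forall>r\<in>B. [k = h] (mod r)) \<and>
            (\<forall>r\<in>primes_le (q * q) - Q. \<not> (r dvd k \<or> [k = h] (mod r)))}"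
    by (auto simp: T_def P_def bad_def)
  finally show ?thesis by (simp add: l_def)
qed

section \<open>Averages over pairs of squarefree numbers\<close>

text \<open>The weights exceed \<open>1/p\<close> by at most \<open>6/p^2\<close>, so the sum grows
  by at most 12 and \<open>exp 5\<close> becomes \<open>exp 17\<close>.\<close>

lemma exp_sum_weights_le:
  assumes "n \<ge> 3"
  shows "exp (\<Sum>p\<in>primes_le n. euler_sq p / real p) \<le> exp 17 * ln (real n)"
proof -
  have "(\<Sum>p\<in>primes_le n. euler_sq p / real p) \<le> (\<Sum>p\<in>primes_le n. 1 / real p + 6 * (1 / real p ^ 2))"
  proof (rule sum_mono)
    fix p assume "p \<in> primes_le n"
    hence "prime p" by (simp add: primes_le_def)
    hence "euler_sq p / real p \<le> (1 + 6 / real p) / real p" by (intro divide_right_mono euler_sq_le) auto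
    thus "euler_sq p / real p \<le> 1 / real p + 6 * (1 / real p ^ 2)"
      by (simp add: add_divide_distrib power2_eq_square)
  qed
  also have "\<dots> = (\<Sum>p\<in>primes_le n. 1 / real p) + 6 * (\<Sum>p\<in>primes_le n. 1 / real p ^ 2)"
    by (simp add: sum.distrib sum_distrib_left)
  also have "(\<Sum>p\<in>primes_le n. 1 / real p ^ 2) \<le> 2"
    by (rule sum_primes_inverse_squares_le) (auto simp: primes_le_def)
  finally have "exp (\<Sum>p\<in>primes_le n. euler_sq p / real p) \<le> exp ((\<Sum>p\<in>primes_le n. 1 / real p) + 12)"
    by simp
  also have "\<dots> = exp (\<Sum>p\<in>primes_le n. 1 / real p) * exp 12" by (simp add: exp_add)
  also have "\<dots> \<le> exp 5 * ln (real n) * exp 12"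
    by (intro mult_right_mono exp_sum_primes_inverse_le assms) auto
  also have "\<dots> = exp 17 * ln (real n)"
    using exp_add[of 5 "12::real"] by simp
  finally show ?thesis .
qed

text \<open>A pair of squarefree numbers, given by sets \<open>A\<close>, \<open>B\<close> of primes, is written in terms of
  its gcd \<open>A \<inter> B\<close> and the cofactors \<open>A - B\<close>, \<open>B - A\<close>; the gcd is absorbed by the
  divisors of the shift \<open>card B - card A\<close>.\<close>

lemma weighted_pair_sum_le:
  "\<exists>C>0. \<forall>P \<mu>. finite P \<longrightarrow> (\<forall>p\<in>P. prime p) \<longrightarrow> 1 \<le> \<mu> \<longrightarrow> (\<Sum>p\<in>P. euler_sq p / real p) \<le> \<mu> \<longrightarrow>
    (\<Sum>(A, B) | A \<subseteq> P \<and> B \<subseteq> P \<and> card A < card B \<and> A \<inter> B \<subseteq> prime_factors (card B - card A).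
       prod euler_sq (A \<union> B) / real (\<Prod>(A \<union> B)) * prod euler_sq (prime_factors (card B - card A))) \<le> C * exp \<mu> ^ 2"
proof -
  obtain C where C: "C > 0" and Cb: "\<And>h. h > 0 \<Longrightarrow>
      (\<Prod>p\<in>prime_factors h. euler_sq p * (1 + euler_sq p / real p)) \<le> C * (\<Sum>d | d dvd h. 1 / sqrt (real d))"
    using prod_local_factor_le_divisor_sum by blast
  show ?thesis
  proof (intro exI[of _ "7 * C"] conjI allI impI)
    show "7 * C > 0" using C by simp
    fix P :: "nat set" and \<mu> :: real
    assume P: "finite P" "\<forall>p\<in>P. prime p" and mu: "1 \<le> \<mu>" "(\<Sum>p\<in>P. euler_sq p / real p) \<le> \<mu>"
    define w where "w = (\<lambda>p. euler_sq p / real p)"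
    define n where "n = card P"
    define E where "E = (\<lambda>h::nat. prod euler_sq (prime_factors h))"
    define Z where "Z = {(A, B). A \<subseteq> P \<and> B \<subseteq> P \<and> card A < card B \<and> A \<inter> B \<subseteq> prime_factors (card B - card A)}"
    have w0: "w p \<ge> 0" for p by (simp add: w_def euler_sq_def)
    have W0: "prod w X \<ge> 0" for X using w0 by (intro prod_nonneg) auto
    have E0: "E h \<ge> 0" for h unfolding E_def by (intro prod_nonneg) (simp add: euler_sq_def)
    have fin: "finite X" if "X \<subseteq> P" for X using that P finite_subset by blast
    define Y where "Y = {(A, B). A \<subseteq> P \<and> B \<subseteq> P \<and> card A < card B}"
    have finY: "finite Y" by (rule finite_subset[of _ "Pow P \<times> Pow P"]) (use P in \<open>auto simp: Y_def\<close>)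
    define \<phi> where "\<phi> = (\<lambda>(A, B). ((A - B, B - A), A \<inter> B) :: (nat set \<times> nat set) \<times> nat set)"
    \<comment> \<open>Removing the gcd from both sets preserves the difference of cardinalities,
      hence the shift. \<open>T\<close> drops the disjointness of the two cofactors and the gcd,
      which only adds nonnegative terms.\<close>
    define T where "T = (SIGMA z:Y. Pow (prime_factors (card (snd z) - card (fst z))))"
    have cards: "card B - card A = card (B - A) - card (A - B)" "card A < card B \<longleftrightarrow> card (A - B) < card (B - A)"
      if "A \<subseteq> P" "B \<subseteq> P" for A B
    proof -
      have "card A = card (A - B) + card (A \<inter> B)" "card B = card (B - A) + card (A \<inter> B)"
        using that fin card_Diff_subset_Int[of A B] card_mono[of A "A \<inter> B"] card_Diff_subset_Int[of B A] card_mono[of B "A \<inter> B"]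
        by (auto simp: Int_commute)
      thus "card B - card A = card (B - A) - card (A - B)" "card A < card B \<longleftrightarrow> card (A - B) < card (B - A)" by auto
    qed
    have "(\<Sum>(A, B)\<in>Z. prod euler_sq (A \<union> B) / real (\<Prod>(A \<union> B)) * E (card B - card A))
        = (\<Sum>t\<in>\<phi> ` Z. prod w (fst (fst t)) * prod w (snd (fst t)) * E (card (snd (fst t)) - card (fst (fst t))) * prod w (snd t))"
    proof (subst sum.reindex)
      show "inj_on \<phi> Z" by (rule inj_onI) (auto simp: \<phi>_def)
      show "(\<Sum>(A, B)\<in>Z. prod euler_sq (A \<union> B) / real (\<Prod>(A \<union> B)) * E (card B - card A))
        = sum ((\<lambda>t. prod w (fst (fst t)) * prod w (snd (fst t)) * E (card (snd (fst t)) - card (fst (fst t))) * prod w (snd t)) \<circ> \<phi>) Z"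
      proof (intro sum.cong refl, clarify)
        fix A B assume "(A, B) \<in> Z"
        hence AB: "A \<subseteq> P" "B \<subseteq> P" by (auto simp: Z_def)
        have "A \<union> B = (A - B) \<union> ((B - A) \<union> (A \<inter> B))" by auto
        hence "prod w (A \<union> B) = prod w ((A - B) \<union> ((B - A) \<union> (A \<inter> B)))" by simp
        also have "\<dots> = prod w (A - B) * prod w ((B - A) \<union> (A \<inter> B))"
          using AB fin by (intro prod.union_disjoint) auto
        also have "prod w ((B - A) \<union> (A \<inter> B)) = prod w (B - A) * prod w (A \<inter> B)"
          using AB fin by (intro prod.union_disjoint) auto
        finally have "prod w (A \<union> B) = prod w (A - B) * (prod w (B - A) * prod w (A \<inter> B))" .
        moreover have "prod euler_sq (A \<union> B) / real (\<Prod>(A \<union> B)) = prod w (A \<union> B)"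
          by (simp add: w_def prod_dividef)
        ultimately show "prod euler_sq (A \<union> B) / real (\<Prod>(A \<union> B)) * E (card B - card A)
          = ((\<lambda>t. prod w (fst (fst t)) * prod w (snd (fst t)) * E (card (snd (fst t)) - card (fst (fst t))) * prod w (snd t)) \<circ> \<phi>) (A, B)"
          by (simp add: \<phi>_def cards[OF AB])
      qed
    qed
    also have "\<dots> \<le> (\<Sum>t\<in>T. prod w (fst (fst t)) * prod w (snd (fst t)) * E (card (snd (fst t)) - card (fst (fst t))) * prod w (snd t))"
    proof (rule sum_mono2)
      show "finite T" unfolding T_def using finY by (intro finite_SigmaI) auto
      show "\<phi> ` Z \<subseteq> T"
      proof (rule image_subsetI, clarify)
        fix A B assume Z: "(A, B) \<in> Z"
        hence AB: "A \<subseteq> P" "B \<subseteq> P" by (auto simp: Z_def)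
        show "\<phi> (A, B) \<in> T" using Z cards[OF AB] by (auto simp: \<phi>_def T_def Y_def Z_def)
      qed
    qed (intro mult_nonneg_nonneg W0 E0)
    also have "\<dots> = (\<Sum>z\<in>Y. \<Sum>G\<in>Pow (prime_factors (card (snd z) - card (fst z))).
          prod w (fst z) * prod w (snd z) * E (card (snd z) - card (fst z)) * prod w G)"
      unfolding T_def using finY by (subst sum.Sigma) (auto simp: case_prod_unfold)
    \<comment> \<open>Summing over the possible gcds \<open>G\<close> yields the product of
      \<open>1 + w p\<close> over the primes dividing the shift. It merges with the sieve factor
      \<open>E\<close> into the local factor bounded by \<open>Cb\<close>.\<close>
    also have "\<dots> \<le> (\<Sum>z\<in>Y. prod w (fst z) * prod w (snd z) * (C * (\<Sum>d | d dvd (card (snd z) - card (fst z)). 1 / sqrt (real d))))"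
    proof (rule sum_mono)
      fix z assume z: "z \<in> Y"
      define h where "h = card (snd z) - card (fst z)"
      have h: "h > 0" using z by (auto simp: h_def Y_def)
      have "(\<Sum>G\<in>Pow (prime_factors h). prod w (fst z) * prod w (snd z) * E h * prod w G)
          = prod w (fst z) * prod w (snd z) * (E h * (\<Prod>p\<in>prime_factors h. 1 + w p))"
        by (simp add: prod_one_plus_Pow sum_distrib_left mult_ac)
      also have "E h * (\<Prod>p\<in>prime_factors h. 1 + w p) = (\<Prod>p\<in>prime_factors h. euler_sq p * (1 + euler_sq p / real p))"
        by (simp add: E_def w_def prod.distrib)
      also have "prod w (fst z) * prod w (snd z) * (\<Prod>p\<in>prime_factors h. euler_sq p * (1 + euler_sq p / real p))
          \<le> prod w (fst z) * prod w (snd z) * (C * (\<Sum>d | d dvd h. 1 / sqrt (real d)))"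
        using h by (intro mult_left_mono Cb mult_nonneg_nonneg W0)
      finally show "(\<Sum>G\<in>Pow (prime_factors (card (snd z) - card (fst z))).
          prod w (fst z) * prod w (snd z) * E (card (snd z) - card (fst z)) * prod w G)
        \<le> prod w (fst z) * prod w (snd z) * (C * (\<Sum>d | d dvd (card (snd z) - card (fst z)). 1 / sqrt (real d)))"
        by (simp only: h_def)
    qed
    \<comment> \<open>The shift depends only on the two cardinalities; once these are fixed, the sum
      factors into two elementary symmetric sums.\<close>
    also have "\<dots> = (\<Sum>c\<in>(SIGMA i:{..n}. {j. i < j \<and> j \<le> n}). \<Sum>z | z \<in> Y \<and> (card (fst z), card (snd z)) = c.
        prod w (fst z) * prod w (snd z) * (C * (\<Sum>d | d dvd (card (snd z) - card (fst z)). 1 / sqrt (real d))))"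
    proof (rule sum.group [symmetric])
      show "(\<lambda>z. (card (fst z), card (snd z))) ` Y \<subseteq> (SIGMA i:{..n}. {j. i < j \<and> j \<le> n})"
        using P by (auto simp: Y_def n_def card_mono)
    qed (use finY in auto)
    also have "\<dots> \<le> (\<Sum>c\<in>(SIGMA i:{..n}. {j. i < j \<and> j \<le> n}). C * (poisson \<mu> (fst c) * poisson \<mu> (snd c) * (\<Sum>d | d dvd (snd c - fst c). 1 / sqrt (real d))))"
    proof (rule sum_mono)
      fix c assume "c \<in> (SIGMA i:{..n}. {j. i < j \<and> j \<le> n})"
      then obtain i j where c: "c = (i, j)" "i < j" by auto
      define S where "S = (\<Sum>d | d dvd (j - i). 1 / sqrt (real d))"
      have S0: "S \<ge> 0" unfolding S_def by (intro sum_nonneg) auto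
      have e: "(\<Sum>A | A \<subseteq> P \<and> card A = k. prod w A) \<le> poisson \<mu> k" for k
      proof -
        have "(\<Sum>A | A \<subseteq> P \<and> card A = k. prod w A) \<le> poisson (sum w P) k"
          using P w0 by (intro sum_prod_card_eq_le_poisson)
        also have "\<dots> \<le> poisson \<mu> k"
          unfolding poisson_def using mu w0 by (intro divide_right_mono power_mono) (auto simp: w_def intro: sum_nonneg)
        finally show ?thesis .
      qed
      have "{z. z \<in> Y \<and> (card (fst z), card (snd z)) = c} = {A. A \<subseteq> P \<and> card A = i} \<times> {B. B \<subseteq> P \<and> card B = j}"
        using c by (auto simp: Y_def)
      hence "(\<Sum>z | z \<in> Y \<and> (card (fst z), card (snd z)) = c.
        prod w (fst z) * prod w (snd z) * (C * (\<Sum>d | d dvd (card (snd z) - card (fst z)). 1 / sqrt (real d))))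
        = (\<Sum>z\<in>{A. A \<subseteq> P \<and> card A = i} \<times> {B. B \<subseteq> P \<and> card B = j}. prod w (fst z) * prod w (snd z) * (C * S))"
        by (intro sum.cong) (auto simp: S_def)
      also have "\<dots> = (\<Sum>A | A \<subseteq> P \<and> card A = i. prod w A) * (\<Sum>A | A \<subseteq> P \<and> card A = j. prod w A) * (C * S)"
        by (simp only: sum_distrib_right [symmetric] sum_product sum.cartesian_product case_prod_unfold)
      also have "\<dots> \<le> poisson \<mu> i * poisson \<mu> j * (C * S)"
        using C S0 W0 mu by (intro mult_right_mono mult_mono e) (auto intro!: sum_nonneg poisson_nonneg)
      finally show "(\<Sum>z | z \<in> Y \<and> (card (fst z), card (snd z)) = c.
        prod w (fst z) * prod w (snd z) * (C * (\<Sum>d | d dvd (card (snd z) - card (fst z)). 1 / sqrt (real d))))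
        \<le> C * (poisson \<mu> (fst c) * poisson \<mu> (snd c) * (\<Sum>d | d dvd (snd c - fst c). 1 / sqrt (real d)))"
        by (simp add: c S_def mult_ac)
    qed
    also have "\<dots> = C * (\<Sum>i\<le>n. \<Sum>j | i < j \<and> j \<le> n. poisson \<mu> i * poisson \<mu> j * (\<Sum>d | d dvd (j - i). 1 / sqrt (real d)))"
      by (subst sum.Sigma) (auto simp: case_prod_unfold sum_distrib_left)
    also have "\<dots> \<le> C * (7 * exp \<mu> ^ 2)"
      using C mu by (intro mult_left_mono sum_poisson_pairs_divisor_sum_le) auto
    finally show "(\<Sum>(A, B) | A \<subseteq> P \<and> B \<subseteq> P \<and> card A < card B \<and> A \<inter> B \<subseteq> prime_factors (card B - card A).
       prod euler_sq (A \<union> B) / real (\<Prod>(A \<union> B)) * prod euler_sq (prime_factors (card B - card A))) \<le> 7 * C * exp \<mu> ^ 2"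
      by (simp add: Z_def E_def mult_ac)
  qed
qed

section \<open>Squarefree numbers and the second moment inequality\<close>

lemma Prod_prime_factors_squarefree:
  fixes m :: nat
  assumes "squarefree m"
  shows "\<Prod>(prime_factors m) = m"
proof -
  have "m \<noteq> 0" using assms by (metis not_squarefree_0)
  hence "m = (\<Prod>p\<in>prime_factors m. p ^ multiplicity p m)" using prime_factorization_nat[of m] by simp
  also have "\<dots> = (\<Prod>p\<in>prime_factors m. p)"
    using assms \<open>m \<noteq> 0\<close> squarefree_factorial_semiring'[of m] by (intro prod.cong) auto
  finally show ?thesis by simp
qed

text \<open>Writing \<open>k = m * s^2\<close> with \<open>m\<close> squarefree bounds the harmonic
  sum by the sum of \<open>1/m\<close> times the sum of \<open>1/s^2\<close>, which is at most
  2.\<close>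

lemma ln_le_sum_sqfree_sets:
  assumes "n \<ge> 1"
  shows "ln (real n) \<le> 2 * (\<Sum>A\<in>sqfree_sets n. 1 / real (\<Prod>A))"
proof -
  define \<phi> where "\<phi> = (\<lambda>k::nat. (prime_factors (squarefree_part k), square_part k))"
  have eq: "k = \<Prod>(fst (\<phi> k)) * (snd (\<phi> k)) ^ 2" for k
    using squarefree_decompose[of k] Prod_prime_factors_squarefree[of "squarefree_part k"] by (simp add: \<phi>_def)
  have inj: "inj_on \<phi> {1..n}" by (rule inj_onI) (metis eq)
  have sub: "\<phi> ` {1..n} \<subseteq> sqfree_sets n \<times> {1..n}"
  proof (rule image_subsetI)
    fix k assume k: "k \<in> {1..n}"
    have d: "squarefree_part k dvd k" "square_part k dvd k"
      using squarefree_decompose[of k] by (metis dvd_triv_left, metis dvd_mult dvd_power dvd_trans pos2 dvd_refl)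
    have pos: "squarefree_part k > 0" "square_part k > 0" using k by (auto intro: gr0I)
    have "squarefree_part k \<le> n" "square_part k \<le> n" using d k by (auto dest!: dvd_imp_le)
    thus "\<phi> k \<in> sqfree_sets n \<times> {1..n}"
      using pos prime_factors_in_sqfree_sets[of "squarefree_part k" n] by (auto simp: \<phi>_def Suc_le_eq)
  qed
  have "ln (real n) \<le> (\<Sum>k=1..n. 1 / real k)" using assms by (rule ln_le_sum_inverse)
  also have "\<dots> = (\<Sum>k=1..n. 1 / real (\<Prod>(fst (\<phi> k))) * (1 / real (snd (\<phi> k)) ^ 2))"
  proof (intro sum.cong refl)
    fix k
    have "real k = real (\<Prod>(fst (\<phi> k))) * real (snd (\<phi> k)) ^ 2" using arg_cong[OF eq[of k], of real] by simp
    thus "1 / real k = 1 / real (\<Prod>(fst (\<phi> k))) * (1 / real (snd (\<phi> k)) ^ 2)" by simp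
  qed
  also have "\<dots> = (\<Sum>z\<in>\<phi> ` {1..n}. 1 / real (\<Prod>(fst z)) * (1 / real (snd z) ^ 2))"
    by (subst sum.reindex[OF inj]) simp
  also have "\<dots> \<le> (\<Sum>z\<in>sqfree_sets n \<times> {1..n}. 1 / real (\<Prod>(fst z)) * (1 / real (snd z) ^ 2))"
    by (intro sum_mono2 sub) (simp_all del: of_nat_prod)
  also have "\<dots> = (\<Sum>A\<in>sqfree_sets n. 1 / real (\<Prod>A)) * (\<Sum>s=1..n. 1 / real s ^ 2)"
    by (simp add: sum_product sum.cartesian_product case_prod_unfold)
  also have "\<dots> \<le> (\<Sum>A\<in>sqfree_sets n. 1 / real (\<Prod>A)) * 2"
    by (intro mult_left_mono sum_inverse_squares_le sum_nonneg) (simp del: of_nat_prod)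
  finally show ?thesis by simp
qed

lemma card_sqfree_sets_le: "card (sqfree_sets n) \<le> n"
proof -
  have "inj_on (\<lambda>A. \<Prod>A) (sqfree_sets n)" by (intro inj_on_Prod_primes) (auto dest: sqfree_setsD)
  moreover have "(\<lambda>A. \<Prod>A) ` sqfree_sets n \<subseteq> {1..n}" using sqfree_setsD(3,4) by (auto simp: Suc_le_eq)
  ultimately show ?thesis using card_inj_on_le[of "\<lambda>A. \<Prod>A" "sqfree_sets n" "{1..n}"] by simp
qed

text \<open>Cauchy-Schwarz for the fibre sizes of \<open>f\<close>, in the form that their variance
  is nonnegative.\<close>

lemma card_square_le_card_image_mult_collisions:
  fixes f :: "'a \<Rightarrow> 'b"
  assumes "finite S"
  shows "real (card S) ^ 2 \<le> real (card (f ` S)) * real (card {(s, t). s \<in> S \<and> t \<in> S \<and> f s = f t})"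
proof (cases "S = {}")
  case False
  define V where "V = f ` S"
  define r where "r = (\<lambda>v. real (card {s\<in>S. f s = v}))"
  have V: "finite V" "real (card V) > 0" using assms False by (auto simp: V_def card_gt_0_iff)
  have sum_r: "sum r V = real (card S)"
  proof -
    have "(\<Sum>v\<in>V. \<Sum>s | s \<in> S \<and> f s = v. 1) = (\<Sum>s\<in>S. 1 :: real)"
      using assms V by (intro sum.group) (auto simp: V_def)
    thus ?thesis by (simp add: r_def)
  qed
  have "{(s, t). s \<in> S \<and> t \<in> S \<and> f s = f t} = (\<Union>v\<in>V. {s\<in>S. f s = v} \<times> {s\<in>S. f s = v})"
    by (auto simp: V_def)
  hence "card {(s, t). s \<in> S \<and> t \<in> S \<and> f s = f t} = (\<Sum>v\<in>V. card ({s\<in>S. f s = v} \<times> {s\<in>S. f s = v}))"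
    using assms V by (simp only:) (intro card_UN_disjoint, auto)
  hence sum_r2: "(\<Sum>v\<in>V. r v ^ 2) = real (card {(s, t). s \<in> S \<and> t \<in> S \<and> f s = f t})"
    by (simp add: r_def card_cartesian_product power2_eq_square)
  define m where "m = real (card S) / real (card V)"
  have "0 \<le> (\<Sum>v\<in>V. (r v - m) ^ 2)" by (intro sum_nonneg) auto
  also have "\<dots> = (\<Sum>v\<in>V. r v ^ 2) - 2 * m * sum r V + real (card V) * m ^ 2"
  proof -
    have "(r v - m) ^ 2 = r v ^ 2 - 2 * m * r v + m ^ 2" for v
      by (simp add: power2_eq_square algebra_simps)
    thus ?thesis by (simp add: sum.distrib sum_subtractf flip: sum_distrib_left)
  qed
  also have "\<dots> = (\<Sum>v\<in>V. r v ^ 2) - real (card S) ^ 2 / real (card V)"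
    using V unfolding sum_r m_def by (simp add: power2_eq_square)
  finally have "real (card S) ^ 2 / real (card V) \<le> (\<Sum>v\<in>V. r v ^ 2)" by simp
  hence "real (card S) ^ 2 \<le> (\<Sum>v\<in>V. r v ^ 2) * real (card V)"
    using V(2) by (simp add: pos_divide_le_eq)
  thus ?thesis unfolding sum_r2 by (simp add: V_def mult.commute)
qed auto

section \<open>Collisions\<close>

text \<open>The exponents only have to make \<open>q\<^sup>2\<close> (sieving limit), \<open>q\<^sup>6\<close> (size of the squarefree part) and
  \<open>q\<^sup>2\<^sup>4\<close> (size of \<open>k\<close>) far enough apart for the sieve error terms to be negligible.\<close>

definition prime_multiples :: "nat \<Rightarrow> (nat set \<times> nat) set"
  where "prime_multiples q = {(A, p). A \<in> sqfree_sets (q ^ 6) \<and> prime p \<and> q ^ 6 < p \<and> \<Prod>A * p \<le> q ^ 24}"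

lemma prime_multiplesD:
  assumes "(A, p) \<in> prime_multiples q"
  shows "A \<in> sqfree_sets (q ^ 6)" "prime p" "q ^ 6 < p" "\<Prod>A * p \<le> q ^ 24"
    "prime_factors (\<Prod>A * p) = insert p A" "p \<notin> A" "\<Prod>A * p > 0"
proof -
  show A: "A \<in> sqfree_sets (q ^ 6)" "prime p" "q ^ 6 < p" "\<Prod>A * p \<le> q ^ 24"
    using assms by (auto simp: prime_multiples_def)
  note A' = sqfree_setsD[OF A(1)]
  show p: "p \<notin> A" using A'(5) A(3) by (auto simp: primes_le_def)
  have "\<Prod>A * p = \<Prod>(insert p A)" using A'(1) p by (simp add: mult.commute)
  thus "prime_factors (\<Prod>A * p) = insert p A"
    using A' A(2) by (simp only:) (intro prime_factors_Prod_primes, auto)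
  show "\<Prod>A * p > 0" using A'(4) A(2) by (simp add: prime_gt_0_nat)
qed

lemma prime_multiples_omega:
  "(A, p) \<in> prime_multiples q \<Longrightarrow> omega (\<Prod>A * p) = card A + 1"
  using prime_multiplesD[of A p q] sqfree_setsD(1)[of A "q ^ 6"] by (simp add: omega_def)

lemma finite_prime_multiples [simp]: "finite (prime_multiples q)"
proof (rule finite_subset)
  show "prime_multiples q \<subseteq> sqfree_sets (q ^ 6) \<times> {..q ^ 24}"
  proof clarify
    fix A p assume Ap: "(A, p) \<in> prime_multiples q"
    note D = prime_multiplesD[OF Ap]
    have "1 * p \<le> \<Prod>A * p" using sqfree_setsD(4)[OF D(1)] by (intro mult_right_mono) auto
    hence "p \<le> q ^ 24" using D(4) by linarith
    thus "A \<in> sqfree_sets (q ^ 6) \<and> p \<in> {..q ^ 24}" using D(1) by simp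
  qed
qed simp

text \<open>\<open>p\<close> is recovered from the product as its only prime factor exceeding
  \<open>q ^ 6\<close>.\<close>

lemma prime_multiples_eqI:
  assumes "(A, p) \<in> prime_multiples q" "(B, r) \<in> prime_multiples q" "\<Prod>A * p = \<Prod>B * r"
  shows "A = B \<and> p = r"
proof -
  note D = prime_multiplesD[OF assms(1)] and D' = prime_multiplesD[OF assms(2)]
  have eq: "insert p A = insert r B" using D(5) D'(5) assms(3) by simp
  have "r \<notin> A" using sqfree_setsD(5)[OF D(1)] D'(3) by (auto simp: primes_le_def)
  hence "p = r" using eq by auto
  thus ?thesis using eq D(6) D'(6) by (metis insert_ident)
qed

text \<open>For fixed \<open>m\<close> the Chebyshev bound at \<open>N div m\<close> gives order
  \<open>N / (m log q)\<close> primes, less the at most \<open>Y\<close> primes that are too small.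
  The sum of \<open>1/m\<close> over squarefree \<open>m \<le> Y\<close> restores the
  logarithm.\<close>

lemma card_prime_multiples_ge:
  "\<exists>c>0. \<exists>q0. \<forall>q\<ge>q0. c * real (q ^ 24) \<le> real (card (prime_multiples q))"
proof -
  obtain c t0 where c: "c > 0" and ct: "\<And>t. t \<ge> t0 \<Longrightarrow> c * real t / ln (real t) \<le> real (card (primes_le t))"
    using chebyshev_lower by blast
  \<comment> \<open>The threshold \<open>32 / c\<close> makes the total loss
    \<open>Y * Y = q^12\<close> at most half of the main term \<open>c / 16 * q^24\<close>.\<close>
  define q0 where "q0 = max (max 3 t0) (nat \<lceil>32 / c\<rceil>)"
  have "c / 32 * real (q ^ 24) \<le> real (card (prime_multiples q))" if q: "q \<ge> q0" for q
  proof -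
    have q3: "q \<ge> 3" "q \<ge> t0" "real q \<ge> 32 / c"
      using q by (auto simp: q0_def)
    define N where "N = q ^ 24"
    define Y where "Y = q ^ 6"
    have lnq: "ln (real q) > 0" using q3 by simp
    \<comment> \<open>Here \<open>48 = 2 * 24\<close>: rounding in \<open>N div m\<close> costs a
      factor 2, and \<open>ln t \<le> ln N = 24 ln q\<close>.\<close>
    have each_le: "c * real N / (48 * ln (real q)) * (1 / real (\<Prod>A)) - real Y \<le> real (card {p. prime p \<and> Y < p \<and> \<Prod>A * p \<le> N})"
      if A: "A \<in> sqfree_sets Y" for A
    proof -
      note A = sqfree_setsD[OF A]
      define m where "m = \<Prod>A"
      define t where "t = N div m"
      have m: "0 < m" "m \<le> Y" using A by (auto simp: m_def)
      have "N = q ^ 18 * Y" by (simp add: N_def Y_def flip: power_add)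
      hence "q ^ 18 * m \<le> N" using m by (simp only: mult_le_mono2)
      hence t18: "q ^ 18 \<le> t" using m by (simp add: t_def less_eq_div_iff_mult_less_eq)
      have "q ^ 1 \<le> q ^ 18" using q3 by (intro power_increasing) auto
      hence tq: "t \<ge> q" using t18 by simp
      have "t \<le> N" by (simp add: t_def)
      hence "ln (real t) \<le> ln (real N)" using tq q3 by (intro ln_mono) auto
      hence lnt: "ln (real t) \<le> 24 * ln (real q)" "ln (real t) > 0" using q3 tq by (auto simp: N_def ln_realpow)
      have "N < m * t + m" using m unfolding t_def
        by (metis add_strict_left_mono mod_less_divisor mult_div_mod_eq)
      also have "\<dots> \<le> m * t + m * t" using tq q3 by (intro add_left_mono) auto
      finally have "N \<le> 2 * m * t" by simp
      hence "real N \<le> real (2 * m * t)" by (simp only: of_nat_le_iff)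
      hence t2: "real N / (2 * real m) \<le> real t" using m by (simp add: field_simps)
      have "c * real N / (48 * ln (real q)) * (1 / real m) = c * (real N / (2 * real m)) / (24 * ln (real q))"
        by simp
      also have "\<dots> \<le> c * real t / ln (real t)"
        using t2 lnt c by (intro frac_le mult_left_mono) auto
      also have "\<dots> \<le> real (card (primes_le t))" using ct tq q3 by auto
      also have "card (primes_le t) \<le> card ({p. prime p \<and> Y < p \<and> m * p \<le> N} \<union> {1..Y})"
      proof (rule card_mono)
        have "p \<le> N" if "m * p \<le> N" for p using that m by (metis Suc_leI le_trans mult_le_mono1 nat_mult_1 One_nat_def)
        hence "{p. prime p \<and> Y < p \<and> m * p \<le> N} \<subseteq> {..N}" by auto
        thus "finite ({p. prime p \<and> Y < p \<and> m * p \<le> N} \<union> {1..Y})" using finite_subset by blast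
        show "primes_le t \<subseteq> {p. prime p \<and> Y < p \<and> m * p \<le> N} \<union> {1..Y}"
        proof
          fix p assume p: "p \<in> primes_le t"
          hence "m * p \<le> m * t" by (simp add: primes_le_def)
          also have "\<dots> \<le> N" by (simp add: t_def)
          finally show "p \<in> {p. prime p \<and> Y < p \<and> m * p \<le> N} \<union> {1..Y}"
            using p prime_gt_0_nat[of p] by (auto simp: primes_le_def)
        qed
      qed
      also have "\<dots> \<le> card {p. prime p \<and> Y < p \<and> m * p \<le> N} + Y"
        using card_Un_le[of "{p. prime p \<and> Y < p \<and> m * p \<le> N}" "{1..Y}"] by simp
      finally show ?thesis by (simp add: m_def)
    qed
    have "prime_multiples q = (SIGMA A:sqfree_sets Y. {p. prime p \<and> Y < p \<and> \<Prod>A * p \<le> N})"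
      by (auto simp: prime_multiples_def Y_def N_def)
    moreover have "finite {p. prime p \<and> Y < p \<and> \<Prod>A * p \<le> N}" if A: "A \<in> sqfree_sets Y" for A
    proof (rule finite_subset)
      show "{p. prime p \<and> Y < p \<and> \<Prod>A * p \<le> N} \<subseteq> snd ` prime_multiples q"
      proof
        fix p assume "p \<in> {p. prime p \<and> Y < p \<and> \<Prod>A * p \<le> N}"
        hence "(A, p) \<in> prime_multiples q" using A by (simp add: prime_multiples_def Y_def N_def)
        thus "p \<in> snd ` prime_multiples q" by (rule rev_image_eqI) simp
      qed
    qed simp
    ultimately have "real (card (prime_multiples q)) = (\<Sum>A\<in>sqfree_sets Y. real (card {p. prime p \<and> Y < p \<and> \<Prod>A * p \<le> N}))"
      by (simp add: card_SigmaI)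
    also have "\<dots> \<ge> (\<Sum>A\<in>sqfree_sets Y. c * real N / (48 * ln (real q)) * (1 / real (\<Prod>A)) - real Y)"
      by (intro sum_mono each_le)
    also have "(\<Sum>A\<in>sqfree_sets Y. c * real N / (48 * ln (real q)) * (1 / real (\<Prod>A)) - real Y)
       = c * real N / (48 * ln (real q)) * (\<Sum>A\<in>sqfree_sets Y. 1 / real (\<Prod>A)) - real (card (sqfree_sets Y)) * real Y"
      by (simp only: sum_subtractf sum_distrib_left sum_constant)
    finally have le: "c * real N / (48 * ln (real q)) * (\<Sum>A\<in>sqfree_sets Y. 1 / real (\<Prod>A)) - real (card (sqfree_sets Y)) * real Y
      \<le> real (card (prime_multiples q))" .
    have "6 * ln (real q) \<le> 2 * (\<Sum>A\<in>sqfree_sets Y. 1 / real (\<Prod>A))"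
      using ln_le_sum_sqfree_sets[of Y] q3 by (simp add: Y_def ln_realpow)
    hence "c * real N / (48 * ln (real q)) * (3 * ln (real q)) \<le> c * real N / (48 * ln (real q)) * (\<Sum>A\<in>sqfree_sets Y. 1 / real (\<Prod>A))"
      using c lnq by (intro mult_left_mono) auto
    hence 1: "c * real N / 16 \<le> c * real N / (48 * ln (real q)) * (\<Sum>A\<in>sqfree_sets Y. 1 / real (\<Prod>A))"
      using lnq by simp
    have "real (card (sqfree_sets Y)) * real Y \<le> real Y * real Y"
      using card_sqfree_sets_le[of Y] by (intro mult_right_mono) auto
    also have "\<dots> = real q ^ 12" by (simp add: Y_def flip: power_add)
    also have "\<dots> = c / 32 * ((32 / c) * real q ^ 12)" using c by simp
    also have "\<dots> \<le> c / 32 * (real q * real q ^ 12)"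
      using c q3 by (intro mult_left_mono mult_right_mono) auto
    also have "real q * real q ^ 12 = real q ^ 13" by (simp add: power_numeral_reduce)
    also have "c / 32 * real q ^ 13 \<le> c / 32 * real q ^ 24"
      using c q3 by (intro mult_left_mono power_increasing) auto
    finally have "real (card (sqfree_sets Y)) * real Y \<le> c / 32 * real N" by (simp add: N_def)
    with 1 le show ?thesis unfolding N_def by (simp add: field_simps)
  qed
  thus ?thesis using c by (intro exI[of _ "c / 32"] conjI exI[of _ q0] allI impI) auto
qed

text \<open>For each admissible pair of sets the collisions inject into a sifted set. Summing the
  sieve bounds yields a factor \<open>exp \<mu> ^ 2\<close>, of order at most
  \<open>ln q ^ 2\<close>, which cancels the denominator from the sieve. Strict inequality of the
  cardinalities makes the shift positive.\<close>

lemma card_collisions_le: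
  "\<exists>K>0. \<forall>q\<ge>3. real (card {(s, t). s \<in> prime_multiples q \<and> t \<in> prime_multiples q \<and> card (fst s) < card (fst t) \<and>
      \<Prod>(fst s) * snd s + card (fst s) = \<Prod>(fst t) * snd t + card (fst t)}) \<le> K * real (q ^ 24)"
proof -
  obtain C where C: "C > 0" and Cb: "\<And>P \<mu>. finite P \<Longrightarrow> (\<forall>p\<in>P. prime p) \<Longrightarrow> 1 \<le> \<mu> \<Longrightarrow> (\<Sum>p\<in>P. euler_sq p / real p) \<le> \<mu> \<Longrightarrow>
    (\<Sum>(A, B) | A \<subseteq> P \<and> B \<subseteq> P \<and> card A < card B \<and> A \<inter> B \<subseteq> prime_factors (card B - card A).
       prod euler_sq (A \<union> B) / real (\<Prod>(A \<union> B)) * prod euler_sq (prime_factors (card B - card A))) \<le> C * exp \<mu> ^ 2"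
    using weighted_pair_sum_le by blast
  \<comment> \<open>The factor \<open>2 * 4\<close> comes from \<open>N + 1 \<le> 2 * N\<close> and
    \<open>euler_sq 2 = 4\<close>, the 6 from \<open>ln (q ^ 6)\<close>, and the summand 1 covers
    all sieve errors.\<close>
  define K where "K = 2 * 4 * C * (exp 17 * 6) ^ 2 + 1"
  have K: "K > 0" unfolding K_def using C by (intro add_nonneg_pos mult_nonneg_nonneg) auto
  have "real (card {(s, t). s \<in> prime_multiples q \<and> t \<in> prime_multiples q \<and> card (fst s) < card (fst t) \<and>
      \<Prod>(fst s) * snd s + card (fst s) = \<Prod>(fst t) * snd t + card (fst t)}) \<le> K * real (q ^ 24)" if q: "q \<ge> 3" for q
  proof -
    define N where "N = q ^ 24"
    define Y where "Y = q ^ 6"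
    define h where "h = (\<lambda>z :: nat set \<times> nat set. card (snd z) - card (fst z))"
    define Q where "Q = (\<lambda>z :: nat set \<times> nat set. {2} \<union> fst z \<union> snd z \<union> prime_factors (h z))"
    define Z where "Z = {(A, B). A \<in> sqfree_sets Y \<and> B \<in> sqfree_sets Y \<and> card A < card B \<and> A \<inter> B \<subseteq> prime_factors (card B - card A)}"
    define sift where "sift = (\<lambda>z. {k. k < N + 1 \<and> (\<forall>r\<in>fst z. r dvd k) \<and> (\<forall>r\<in>snd z. [k = h z] (mod r)) \<and>
            (\<forall>r\<in>primes_le (q * q) - Q z. \<not> (r dvd k \<or> [k = h z] (mod r)))})"
    define E where "E = {(s, t). s \<in> prime_multiples q \<and> t \<in> prime_multiples q \<and> card (fst s) < card (fst t) \<and>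
      \<Prod>(fst s) * snd s + card (fst s) = \<Prod>(fst t) * snd t + card (fst t)}"
    \<comment> \<open>The pair of sets and the number \<open>k = \<Prod>A * p\<close> determine the
      collision: the other number is \<open>k\<close> minus the shift, and both primes follow by
      division.\<close>
    define \<phi> where "\<phi> = (\<lambda>(s :: nat set \<times> nat, t :: nat set \<times> nat). ((fst s, fst t), \<Prod>(fst s) * snd s))"
    have lnq: "ln (real q) \<ge> 1"
    proof -
      have "exp 1 \<le> (3::real)" by (rule exp_le)
      also have "\<dots> \<le> real q" using q by simp
      finally show ?thesis using q by (subst ln_ge_iff) auto
    qed
    have finZ: "finite Z" by (rule finite_subset[of _ "sqfree_sets Y \<times> sqfree_sets Y"]) (auto simp: Z_def)
    have finsift: "finite (sift z)" for z by (rule finite_subset[of _ "{..<N + 1}"]) (auto simp: sift_def)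
    have qY: "q * q \<le> Y"
      using q power_increasing[of 2 6 q] by (simp add: Y_def power2_eq_square)
    have into: "\<phi> ` E \<subseteq> (SIGMA z:Z. sift z)"
    proof (rule image_subsetI, clarify)
      fix A p B r assume E: "((A, p), (B, r)) \<in> E"
      have S: "(A, p) \<in> prime_multiples q" "(B, r) \<in> prime_multiples q" using E by (auto simp: E_def)
      note D = prime_multiplesD[OF S(1)] and D' = prime_multiplesD[OF S(2)]
      note A = sqfree_setsD[OF D(1)] and B = sqfree_setsD[OF D'(1)]
      define k where "k = \<Prod>A * p"
      define j where "j = card B - card A"
      have lt: "card A < card B" using E by (auto simp: E_def)
      have kj: "k = \<Prod>B * r + j" using E lt by (auto simp: E_def k_def j_def)
      have j0: "j > 0" using lt by (simp add: j_def)
      have dk: "s dvd k" if "s \<in> A" for s using that A unfolding k_def by (intro dvd_mult2 dvd_prodI) auto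
      have dB: "s dvd \<Prod>B * r" if "s \<in> B" for s using that B by (intro dvd_mult2 dvd_prodI) auto
      have cong: "[k = j] (mod s) \<longleftrightarrow> s dvd \<Prod>B * r" for s
        unfolding kj by (simp add: cong_add_rcancel_0_nat cong_0_iff)
      have Z: "(A, B) \<in> Z"
      proof -
        have "s \<in> prime_factors j" if s: "s \<in> A" "s \<in> B" for s
        proof -
          have "s dvd j" using dk[OF s(1)] dB[OF s(2)] unfolding kj by (simp add: dvd_add_right_iff)
          thus ?thesis using s A j0 by (auto simp: in_prime_factors_iff)
        qed
        thus ?thesis using D(1) D'(1) lt by (auto simp: Z_def Y_def j_def)
      qed
      moreover have "k \<in> sift (A, B)"
      proof -
        \<comment> \<open>A prime up to \<open>q * q \<le> q ^ 6\<close> differs from both large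
          primes, so it divides one of the two numbers only if it lies in \<open>A\<close> or
          \<open>B\<close>.\<close>
        have "\<not> (s dvd k \<or> [k = j] (mod s))" if s: "s \<in> primes_le (q * q)" "s \<notin> A" "s \<notin> B" for s
        proof -
          have s': "prime s" "s \<le> q ^ 6" using s qY by (auto simp: primes_le_def Y_def)
          have "s \<notin> insert p A" "s \<notin> insert r B" using s s' D(3) D'(3) by auto
          hence "s \<notin> prime_factors k" "s \<notin> prime_factors (\<Prod>B * r)" using D(5) D'(5) by (auto simp: k_def)
          thus ?thesis using s'(1) D(7) D'(7) unfolding cong by (auto simp: in_prime_factors_iff k_def)
        qed
        moreover have "k < N + 1" using D(4) by (simp add: k_def N_def)
        ultimately show ?thesis using dk dB cong by (auto simp: sift_def h_def j_def Q_def)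
      qed
      ultimately show "\<phi> ((A, p), (B, r)) \<in> (SIGMA z:Z. sift z)" by (simp add: \<phi>_def k_def)
    qed
    have inj: "inj_on \<phi> E"
    proof (rule inj_onI)
      fix x y assume xy: "x \<in> E" "y \<in> E" "\<phi> x = \<phi> y"
      obtain A p B r A' p' B' r' where xy': "x = ((A, p), (B, r))" "y = ((A', p'), (B', r'))"
        by (metis prod.exhaust)
      have E: "((A, p), (B, r)) \<in> E" "((A', p'), (B', r')) \<in> E" and eq: "\<phi> ((A, p), (B, r)) = \<phi> ((A', p'), (B', r'))"
        using xy xy' by auto
      have AB: "A' = A" "B' = B" "\<Prod>A * p = \<Prod>A' * p'" using eq by (auto simp: \<phi>_def)
      have S: "(A, p) \<in> prime_multiples q" "(B, r) \<in> prime_multiples q" "(A', p') \<in> prime_multiples q" "(B', r') \<in> prime_multiples q"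
        using E by (auto simp: E_def)
      have "\<Prod>B * r = \<Prod>B' * r'" using E AB by (auto simp: E_def)
      thus "x = y"
        unfolding xy' using prime_multiples_eqI[OF S(1,3) AB(3)] prime_multiples_eqI[OF S(2,4)] by blast
    qed
    have "card E \<le> card (SIGMA z:Z. sift z)"
      using inj into finZ finsift by (intro card_inj_on_le[of \<phi>]) auto
    also have "\<dots> = (\<Sum>z\<in>Z. card (sift z))" using finZ finsift by (intro card_SigmaI) auto
    finally have "real (card E) \<le> (\<Sum>z\<in>Z. real (card (sift z)))"
      by (simp only: of_nat_sum [symmetric] of_nat_le_iff)
    also have "\<dots> \<le> (\<Sum>z\<in>Z. 8 * real N / ln (real q) ^ 2 *
        (prod euler_sq (fst z \<union> snd z) / real (\<Prod>(fst z \<union> snd z)) * prod euler_sq (prime_factors (h z))) + real (q ^ 8))"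
    proof (rule sum_mono)
      fix z assume z: "z \<in> Z"
      then obtain A B where AB: "z = (A, B)" "A \<in> sqfree_sets Y" "B \<in> sqfree_sets Y" "card A < card B" by (auto simp: Z_def)
      note A = sqfree_setsD[OF AB(2)] and B = sqfree_setsD[OF AB(3)]
      have "real (card (sift z)) \<le> real (N + 1) / real (\<Prod>(A \<union> B)) * (prod euler_sq (Q z) / ln (real q) ^ 2) + real (q ^ 8)"
        using sifted_pair_count_le[of q "h z" A B "N + 1"] q A B AB by (simp add: sift_def Q_def h_def del: of_nat_prod of_nat_power)
      also have "real (N + 1) / real (\<Prod>(A \<union> B)) * (prod euler_sq (Q z) / ln (real q) ^ 2)
          \<le> (2 * real N) / real (\<Prod>(A \<union> B)) * ((4 * (prod euler_sq (A \<union> B) * prod euler_sq (prime_factors (h z)))) / ln (real q) ^ 2)"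
      proof (intro mult_mono divide_right_mono)
        have "N \<ge> 1" using q by (simp add: N_def)
        thus "real (N + 1) \<le> 2 * real N" by simp
        have prod_Un: "prod euler_sq (X \<union> X') \<le> prod euler_sq X * prod euler_sq X'"
          if "finite X" "finite X'" "\<forall>p\<in>X. prime p" "\<forall>p\<in>X'. prime p" for X X'
        proof -
          have pos: "prod euler_sq X'' \<ge> 1" if "\<forall>p\<in>X''. prime p" for X''
            using that euler_sq_ge_1 by (intro prod_ge_1) auto
          have "prod euler_sq (X \<union> X') * 1 \<le> prod euler_sq (X \<union> X') * prod euler_sq (X \<inter> X')"
            using that pos[of "X \<inter> X'"] by (intro mult_left_mono prod_nonneg) (auto simp: euler_sq_def)
          also have "\<dots> = prod euler_sq X * prod euler_sq X'" using that by (intro prod.union_inter) auto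
          finally show ?thesis by simp
        qed
        have pr: "\<forall>p\<in>prime_factors (h z). prime p" by auto
        have nn: "prod euler_sq X \<ge> 0" for X by (intro prod_nonneg) (simp add: euler_sq_def)
        have "Q z = {2} \<union> ((A \<union> B) \<union> prime_factors (h z))" by (auto simp: Q_def AB(1))
        hence "prod euler_sq (Q z) = prod euler_sq ({2} \<union> ((A \<union> B) \<union> prime_factors (h z)))" by simp
        also have "\<dots> \<le> prod euler_sq {2} * prod euler_sq ((A \<union> B) \<union> prime_factors (h z))"
          using A B by (intro prod_Un) auto
        also have "\<dots> \<le> prod euler_sq {2} * (prod euler_sq (A \<union> B) * prod euler_sq (prime_factors (h z)))"
          using A B by (intro mult_left_mono prod_Un nn) auto
        also have "prod euler_sq {2} = 4" by (simp add: euler_sq_def)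
        finally show "prod euler_sq (Q z) \<le> 4 * (prod euler_sq (A \<union> B) * prod euler_sq (prime_factors (h z)))" .
        show "0 \<le> prod euler_sq (Q z) / ln (real q) ^ 2" using nn by (intro divide_nonneg_nonneg) auto
      qed (simp_all del: of_nat_prod)
      also have "\<dots> = 8 * real N / ln (real q) ^ 2 *
        (prod euler_sq (fst z \<union> snd z) / real (\<Prod>(fst z \<union> snd z)) * prod euler_sq (prime_factors (h z)))"
        by (simp add: AB(1) mult_ac del: of_nat_prod)
      finally show "real (card (sift z)) \<le> 8 * real N / ln (real q) ^ 2 *
        (prod euler_sq (fst z \<union> snd z) / real (\<Prod>(fst z \<union> snd z)) * prod euler_sq (prime_factors (h z))) + real (q ^ 8)"
        by simp
    qed
    also have "\<dots> = 8 * real N / ln (real q) ^ 2 * (\<Sum>z\<in>Z. 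
        prod euler_sq (fst z \<union> snd z) / real (\<Prod>(fst z \<union> snd z)) * prod euler_sq (prime_factors (h z))) + real (card Z) * real (q ^ 8)"
      by (simp only: sum.distrib sum_distrib_left sum_constant)
    also have "\<dots> \<le> 8 * real N / ln (real q) ^ 2 * (C * (exp 17 * 6 * ln (real q)) ^ 2) + real (q ^ 24)"
    proof (intro add_mono mult_left_mono)
      define \<mu> where "\<mu> = max 1 (\<Sum>p\<in>primes_le Y. euler_sq p / real p)"
      have "(\<Sum>z\<in>Z. prod euler_sq (fst z \<union> snd z) / real (\<Prod>(fst z \<union> snd z)) * prod euler_sq (prime_factors (h z)))
        \<le> (\<Sum>z\<in>{(A, B). A \<subseteq> primes_le Y \<and> B \<subseteq> primes_le Y \<and> card A < card B \<and> A \<inter> B \<subseteq> prime_factors (card B - card A)}.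
            prod euler_sq (fst z \<union> snd z) / real (\<Prod>(fst z \<union> snd z)) * prod euler_sq (prime_factors (h z)))"
      proof (rule sum_mono2)
        show "finite {(A, B). A \<subseteq> primes_le Y \<and> B \<subseteq> primes_le Y \<and> card A < card B \<and> A \<inter> B \<subseteq> prime_factors (card B - card A)}"
          by (rule finite_subset[of _ "Pow (primes_le Y) \<times> Pow (primes_le Y)"]) auto
        show "Z \<subseteq> {(A, B). A \<subseteq> primes_le Y \<and> B \<subseteq> primes_le Y \<and> card A < card B \<and> A \<inter> B \<subseteq> prime_factors (card B - card A)}"
          by (auto simp: Z_def sqfree_sets_def)
      qed (intro mult_nonneg_nonneg divide_nonneg_nonneg prod_nonneg of_nat_0_le_iff; simp add: euler_sq_def)
      also have "\<dots> \<le> C * exp \<mu> ^ 2"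
        using Cb[of "primes_le Y" \<mu>] by (simp add: \<mu>_def h_def case_prod_unfold primes_leD)
      also have "\<dots> \<le> C * (exp 17 * 6 * ln (real q)) ^ 2"
      proof (intro mult_left_mono power_mono)
        have Y3: "Y \<ge> 3" using q qY by (metis le_trans mult_le_mono2 nat_mult_1_right one_le_numeral)
        have "exp (\<Sum>p\<in>primes_le Y. euler_sq p / real p) \<le> exp 17 * ln (real Y)"
          by (rule exp_sum_weights_le) fact
        also have "\<dots> = exp 17 * 6 * ln (real q)" using q by (simp add: Y_def ln_realpow)
        finally have 1: "exp (\<Sum>p\<in>primes_le Y. euler_sq p / real p) \<le> exp 17 * 6 * ln (real q)" .
        have "exp 1 * 1 * 1 \<le> exp 17 * 6 * ln (real q)" using lnq by (intro mult_mono) auto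
        with 1 show "exp \<mu> \<le> exp 17 * 6 * ln (real q)" by (simp add: \<mu>_def max_def)
      qed (use C in auto)
      finally show "(\<Sum>z\<in>Z. prod euler_sq (fst z \<union> snd z) / real (\<Prod>(fst z \<union> snd z)) * prod euler_sq (prime_factors (h z)))
        \<le> C * (exp 17 * 6 * ln (real q)) ^ 2" .
      \<comment> \<open>At most \<open>Y^2 = q^12\<close> pairs, each with sieve error
        \<open>q^8\<close>, give \<open>q^20\<close> in total.\<close>
      have "card Z \<le> card (sqfree_sets Y \<times> sqfree_sets Y)" by (rule card_mono) (auto simp: Z_def)
      also have "\<dots> \<le> Y * Y" by (simp add: card_cartesian_product mult_le_mono card_sqfree_sets_le)
      finally have "card Z * q ^ 8 \<le> (Y * Y) * q ^ 8" by (rule mult_right_mono) simp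
      also have "\<dots> = q ^ 20" by (simp add: Y_def flip: power_add)
      also have "\<dots> \<le> q ^ 24" using q by (intro power_increasing) auto
      finally show "real (card Z) * real (q ^ 8) \<le> real (q ^ 24)" by (simp only: of_nat_mult [symmetric] of_nat_le_iff)
    qed simp
    also have "\<dots> = K * real (q ^ 24)"
    proof -
      have "8 * real N / L ^ 2 * (C * (M * L) ^ 2) = 8 * C * M ^ 2 * real N" if "L > 0" for L M :: real
        using that by (simp add: power_mult_distrib)
      from this[of "ln (real q)" "exp 17 * 6"] show ?thesis using lnq by (simp add: K_def N_def algebra_simps)
    qed
    finally show ?thesis by (simp add: E_def)
  qed
  thus ?thesis using K by blast
qed

text \<open>Pairs with equal values of \<open>f\<close> are diagonal, or lie in \<open>E\<close> or
  its mirror image: equal cardinalities force equal products, hence equal elements. With at most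
  \<open>(2 K + 1) N\<close> such pairs and at least \<open>c N\<close> elements, the second moment
  inequality leaves at least \<open>c^2 N / (2 K + 1)\<close> values. They are at most
  \<open>2 N\<close> because \<open>omega k \<le> k\<close>.\<close>

lemma card_values_ge:
  "\<exists>c>0. \<exists>q0. \<forall>q\<ge>q0. c * real (q ^ 24) \<le> real (card {n. n > 0 \<and> n \<le> 2 * q ^ 24 \<and> (\<exists>k>0. n = k + omega k)})"
proof -
  obtain c q0 where c: "c > 0" and cq: "\<And>q. q \<ge> q0 \<Longrightarrow> c * real (q ^ 24) \<le> real (card (prime_multiples q))"
    using card_prime_multiples_ge by blast
  obtain K where K: "K > 0" and Kq: "\<And>q. q \<ge> 3 \<Longrightarrow> real (card {(s, t). s \<in> prime_multiples q \<and> t \<in> prime_multiples q \<and> card (fst s) < card (fst t) \<and>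
      \<Prod>(fst s) * snd s + card (fst s) = \<Prod>(fst t) * snd t + card (fst t)}) \<le> K * real (q ^ 24)"
    using card_collisions_le by blast
  have "c ^ 2 / (2 * K + 1) * real (q ^ 24) \<le> real (card {n. n > 0 \<and> n \<le> 2 * q ^ 24 \<and> (\<exists>k>0. n = k + omega k)})"
    if q: "q \<ge> max 3 q0" for q
  proof -
    define N where "N = q ^ 24"
    define S where "S = prime_multiples q"
    define val where "val = (\<lambda>s :: nat set \<times> nat. \<Prod>(fst s) * snd s)"
    define f where "f = (\<lambda>s :: nat set \<times> nat. val s + card (fst s) + 1)"
    define E where "E = {(s, t). s \<in> S \<and> t \<in> S \<and> card (fst s) < card (fst t) \<and> val s + card (fst s) = val t + card (fst t)}"
    have N0: "real N > 0" using q by (simp add: N_def)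
    have finS: "finite S" by (simp add: S_def)
    have finE: "finite E" by (rule finite_subset[of _ "S \<times> S"]) (auto simp: E_def finS)
    have val_inj: "s = t" if "s \<in> S" "t \<in> S" "val s = val t" for s t
      using that prime_multiples_eqI[of "fst s" "snd s" q "fst t" "snd t"] by (auto simp: S_def val_def prod_eq_iff)
    have "card S \<le> card {1..N}"
    proof (rule card_inj_on_le)
      show "inj_on val S" by (rule inj_onI) (rule val_inj)
      show "val ` S \<subseteq> {1..N}" using prime_multiplesD(4,7)[of _ _ q] by (auto simp: S_def val_def N_def Suc_le_eq)
    qed simp
    hence SN: "card S \<le> N" by simp
    have "{(s, t). s \<in> S \<and> t \<in> S \<and> f s = f t} \<subseteq> (\<lambda>s. (s, s)) ` S \<union> (E \<union> prod.swap ` E)"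
    proof
      fix z assume "z \<in> {(s, t). s \<in> S \<and> t \<in> S \<and> f s = f t}"
      then obtain s t where z: "z = (s, t)" "s \<in> S" "t \<in> S" "f s = f t" by auto
      consider "card (fst s) < card (fst t)" | "card (fst t) < card (fst s)" | "card (fst s) = card (fst t)"
        by linarith
      thus "z \<in> (\<lambda>s. (s, s)) ` S \<union> (E \<union> prod.swap ` E)"
      proof cases
        case 1
        hence "z \<in> E" using z by (auto simp: E_def f_def)
        thus ?thesis by blast
      next
        case 2
        hence "(t, s) \<in> E" using z by (auto simp: E_def f_def)
        hence "prod.swap (t, s) \<in> prod.swap ` E" by (rule imageI)
        thus ?thesis using z(1) by simp
      next
        case 3
        hence "s = t" using z by (intro val_inj) (auto simp: f_def)
        thus ?thesis using z by blast
      qed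
    qed
    hence "card {(s, t). s \<in> S \<and> t \<in> S \<and> f s = f t} \<le> card ((\<lambda>s. (s, s)) ` S \<union> (E \<union> prod.swap ` E))"
      using finS finE by (intro card_mono) auto
    also have "\<dots> \<le> card S + (card E + card E)"
      using finS finE by (intro order_trans[OF card_Un_le] add_mono card_image_le) auto
    finally have "real (card {(s, t). s \<in> S \<and> t \<in> S \<and> f s = f t}) \<le> real (card S + (card E + card E))" by (simp only: of_nat_le_iff)
    also have "\<dots> \<le> (2 * K + 1) * real N"
    proof -
      have "real (card E) \<le> K * real N" using Kq[of q] q unfolding E_def S_def val_def N_def by simp
      thus ?thesis using SN by (simp add: distrib_right)
    qed
    finally have coll: "real (card {(s, t). s \<in> S \<and> t \<in> S \<and> f s = f t}) \<le> (2 * K + 1) * real N" .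
    have "(c * real N) ^ 2 \<le> real (card S) ^ 2"
      using cq[of q] q c unfolding N_def S_def by (intro power_mono) auto
    also have "\<dots> \<le> real (card (f ` S)) * real (card {(s, t). s \<in> S \<and> t \<in> S \<and> f s = f t})"
      using finS by (rule card_square_le_card_image_mult_collisions)
    also have "\<dots> \<le> real (card (f ` S)) * ((2 * K + 1) * real N)" using coll by (intro mult_left_mono) auto
    finally have "real N * (c ^ 2 * real N) \<le> real N * (real (card (f ` S)) * (2 * K + 1))"
      by (simp add: power2_eq_square mult_ac)
    hence "c ^ 2 * real N \<le> real (card (f ` S)) * (2 * K + 1)" using N0 by (subst (asm) mult_le_cancel_left_pos)
    hence "c ^ 2 / (2 * K + 1) * real N \<le> real (card (f ` S))" using K by (simp add: pos_divide_le_eq)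
    also have "card (f ` S) \<le> card {n. n > 0 \<and> n \<le> 2 * N \<and> (\<exists>k>0. n = k + omega k)}"
    proof (intro card_mono image_subsetI)
      show "finite {n. n > 0 \<and> n \<le> 2 * N \<and> (\<exists>k>0. n = k + omega k)}"
        by (rule finite_subset[of _ "{..2 * N}"]) auto
      fix s assume s: "s \<in> S"
      then obtain A p where Ap: "s = (A, p)" "(A, p) \<in> prime_multiples q" by (cases s) (auto simp: S_def)
      note D = prime_multiplesD[OF Ap(2)]
      define k where "k = \<Prod>A * p"
      have k: "k > 0" "k \<le> N" "omega k = card A + 1"
        using D prime_multiples_omega[OF Ap(2)] by (auto simp: k_def N_def)
      have "omega k \<le> k"
      proof -
        have "prime_factors k \<subseteq> {1..k}" using k(1) by (auto simp: in_prime_factors_iff Suc_le_eq prime_gt_0_nat dest: dvd_imp_le)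
        hence "card (prime_factors k) \<le> card {1..k}" by (intro card_mono) auto
        thus ?thesis by (simp add: omega_def)
      qed
      moreover have "f s = k + omega k" by (simp add: f_def val_def Ap(1) k_def[symmetric] k(3))
      ultimately have "0 < f s \<and> f s \<le> 2 * N \<and> f s = k + omega k" using k(1,2) by linarith
      thus "f s \<in> {n. n > 0 \<and> n \<le> 2 * N \<and> (\<exists>k>0. n = k + omega k)}" using k(1) by blast
    qed
    finally show ?thesis by (simp add: N_def)
  qed
  moreover have "c ^ 2 / (2 * K + 1) > 0" using c K by simp
  ultimately show ?thesis by blast
qed

theorem theorem1:
  shows "\<exists>(c::real)>0. \<exists>x\<^sub>0::real. \<forall>x::real. x \<ge> x\<^sub>0 \<longrightarrow> real (N_plus_omega x) \<ge> c * x"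
proof -
  obtain c q0 where c: "c > 0" and cq: "\<And>q. q \<ge> q0 \<Longrightarrow>
      c * real (q ^ 24) \<le> real (card {n. n > 0 \<and> n \<le> 2 * q ^ 24 \<and> (\<exists>k>0. n = k + omega k)})"
    using card_values_ge by blast
  \<comment> \<open>The largest \<open>q\<close> with \<open>2 q^24 \<le> x\<close> satisfies
    \<open>x < 2 (q + 1)^24 \<le> 2 (2 q)^24\<close>, and \<open>2 * 2^24 = 2^25\<close>.\<close>
  define C where "C = (2::real) ^ 25"
  have C: "C > 0" by (simp add: C_def)
  have "c / C * x \<le> real (N_plus_omega x)" if x: "x \<ge> 2 * real (max 1 q0) ^ 24" for x
  proof -
    define Q where "Q = {q::nat. 2 * real q ^ 24 \<le> x}"
    have Qle: "real q \<le> x" if "q \<in> Q" for q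
    proof (cases "q = 0")
      case True
      thus ?thesis using x by (metis max.cobounded1 mult_nonneg_nonneg of_nat_0 of_nat_0_le_iff order_trans zero_le_numeral zero_le_power)
    next
      case False
      hence "real q ^ 1 \<le> real q ^ 24" by (intro power_increasing) auto
      moreover have "2 * real q ^ 24 \<le> x" using that by (simp add: Q_def)
      moreover have "real q ^ 24 \<ge> 0" by simp
      ultimately show ?thesis by (simp only: power_one_right)
    qed
    have finQ: "finite Q"
      by (rule finite_subset[of _ "{..nat \<lfloor>x\<rfloor>}"]) (auto intro!: le_nat_floor Qle)
    define q where "q = Max Q"
    have m: "max 1 q0 \<in> Q" using x by (simp add: Q_def)
    have q: "q \<in> Q" "q \<ge> max 1 q0"
      unfolding q_def using finQ m by (blast intro: Max_in, rule Max_ge)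
    have "Suc q \<notin> Q" using Max_ge[OF finQ, of "Suc q"] unfolding q_def by linarith
    hence "x < 2 * real (Suc q) ^ 24" by (simp add: Q_def)
    also have "\<dots> \<le> 2 * (2 * real q) ^ 24" using q(2) by (intro mult_left_mono power_mono) auto
    also have "\<dots> = C * real q ^ 24" by (simp add: C_def power_mult_distrib)
    finally have "c / C * x \<le> c / C * (C * real q ^ 24)" using c C by (intro mult_left_mono) auto
    also have "\<dots> = c * real (q ^ 24)" using C by simp
    also have "\<dots> \<le> real (card {n. n > 0 \<and> n \<le> 2 * q ^ 24 \<and> (\<exists>k>0. n = k + omega k)})"
      using q by (intro cq) simp
    also have "card {n. n > 0 \<and> n \<le> 2 * q ^ 24 \<and> (\<exists>k>0. n = k + omega k)} \<le> N_plus_omega x"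
      unfolding N_plus_omega_def
    proof (rule card_mono)
      show "finite {n. n > 0 \<and> real n \<le> x \<and> (\<exists>k>0. n = k + omega k)}"
        by (rule finite_subset[of _ "{..nat \<lfloor>x\<rfloor>}"]) (auto intro!: le_nat_floor simp del: of_nat_add)
      have "real n \<le> x" if "n \<le> 2 * q ^ 24" for n
      proof -
        have "real n \<le> real (2 * q ^ 24)" using that by (simp only: of_nat_le_iff)
        also have "\<dots> \<le> x" using q(1) by (simp add: Q_def)
        finally show ?thesis .
      qed
      thus "{n. n > 0 \<and> n \<le> 2 * q ^ 24 \<and> (\<exists>k>0. n = k + omega k)} \<subseteq> {n. n > 0 \<and> real n \<le> x \<and> (\<exists>k>0. n = k + omega k)}"
        by auto
    qed
    finally show ?thesis by simp
  qed
  moreover have "c / C > 0" using c C by simp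
  ultimately show ?thesis by blast
qed

end
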